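(* Let $N\in\mathbb{N}$, $T>0$, let $a_2,a_{1,1},\dots,a_{1,N},a_0\in C([0,T];\mathbb{C})$ and consider $$P(t,D_x,D_t)=D_t-a_2(t)\Delta_x+\sum_{j=1}^N a_{1,j}(t)D_{x_j}+a_0(t)$$ and the Cauchy problem (CP): $Pu(t,x)=f(t,x)$, $u(0,x)=g(x)$, $t\in[0,T]$, $x\in\mathbb{T}^N$. Suppose that $\operatorname{Im}(a_2)(t)\le0$ and $\operatorname{Im}(a_{1,j})(t)=0$ for every $j\in\{1,\dots,N\}$ and $t\in[0,T]$. Then: (i) Given $r\in\mathbb{R}$, $f\in C([0,T];H^r(\mathbb{T}^N))$ and $g\in H^r(\mathbb{T}^N)$, there exists a unique $u\in C([0,T];H^r(\mathbb{T}^N))\cap C^1([0,T];H^{r-2}(\mathbb{T}^N))$ which solves (CP). (ii) For every $f\in C([0,T];C^\infty(\mathbb{T}^N))$ and $g\in C^\infty(\mathbb{T}^N)$, there exists a unique $u\in C^1([0,T];C^\infty(\mathbb{T}^N))$ which solves (CP). (iii) Given $s\ge1$, $f\in C([0,T];G^s(\mathbb{T}^N))$ and $g\in G^s(\mathbb{T}^N)$, there exists a unique $u\in C^1([0,T];G^s(\mathbb{T}^N))$ which solves (CP).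
   Context: $\mathbb{T}^N=\mathbb{R}^N/2\pi\mathbb{Z}^N$, $D_t=\frac1i\partial_t$, $D_{x_j}=\frac1i\partial_{x_j}$, $\Delta_x=\sum_j\partial_{x_j}^2$. Spaces. For a distribution $u$ on $\mathbb{T}^N$ its Fourier coefficients are $\widehat u(\xi)=\langle u,e^{-ix\xi}\rangle$, $\xi\in\mathbb{Z}^N$, normalized so that $u=\sum_\xi\widehat u(\xi)e^{ix\xi}$. For $r\in\mathbb{R}$, $H^r(\mathbb{T}^N)$ is the set of distributions with $\|u\|_{H^r}^2=\sum_{\xi}|\widehat u(\xi)|^2(1+|\xi|)^{2r}<\infty$. $C^\infty(\mathbb{T}^N)=\bigcap_r H^r(\mathbb{T}^N)$ carries the projective limit topology. For $s\ge1$, $G^s(\mathbb{T}^N)$ is the set of $f\in C^\infty(\mathbb{T}^N)$ for which there are $C,h>0$ with $|D^\alpha f(x)|\le Ch^{|\alpha|}|\alpha|!^s$ for all multi-indices $\alpha$ and all $x$. With $\|f\|_{h,s}=\sup_\alpha \|D^\alpha f\|_\infty/(h^{|\alpha|}|\alpha|!^s)$ and $G^s_h(\mathbb{T}^N)=\{f:\|f\|_{h,s}<\infty\}$, $G^s(\mathbb{T}^N)$ carries the (locally convex) inductive limit topology of the Banach spaces $G^s_h(\mathbb{T}^N)$, $h\to\infty$. $C([0,T];X)$ and $C^1([0,T];X)$ denote the continuous, resp. continuously differentiable, maps $[0,T]\to X$. Solutions. $u\in C([0,T];H^\rho(\mathbb{T}^N))$ (some $\rho\in\mathbb{R}$) solves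 (CP) if $u(0)=g$ and $Pu=f$ holds with $D_tu$ understood as the weak derivative in $t$ on $(0,T)$: $\langle D_tu,\varphi\rangle=\int_0^T u(t)(-D_t\varphi(t))\,dt$ for $\varphi\in C_c^\infty((0,T))$. *)

theory Defs
  imports "HOL-Analysis.Analysis"
begin

section \<open>Smooth functions on the torus\<close>

definition ivec :: "int^'n \<Rightarrow> real^'n" where
  "ivec k = (\<chi> j. real_of_int (k $ j))"

definition partial :: "'n::finite \<Rightarrow> (real^'n \<Rightarrow> complex) \<Rightarrow> real^'n \<Rightarrow> complex" where
  "partial j f x = vector_derivative (\<lambda>t. f (x + t *\<^sub>R axis j 1)) (at 0)"

definition smooth :: "(real^'n::finite \<Rightarrow> complex) \<Rightarrow> bool" where
  "smooth f \<longleftrightarrow> (\<forall>js. continuous_on UNIV (foldr partial js f) \<and>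
     (\<forall>j x. (\<lambda>t. foldr partial js f (x + t *\<^sub>R axis j 1)) differentiable (at 0)))"

definition periodic :: "(real^'n::finite \<Rightarrow> complex) \<Rightarrow> bool" where
  "periodic f \<longleftrightarrow> (\<forall>k x. f (x + (2 * pi) *\<^sub>R ivec k) = f x)"

lemma partial_works:
  assumes "smooth f"
  shows "((\<lambda>t. foldr partial js f (x + t *\<^sub>R axis j 1)) has_vector_derivative
            foldr partial (j # js) f x) (at 0)"
  using assms by (simp add: smooth_def partial_def vector_derivative_works)

lemma smooth_linear_comb:
  assumes f: "smooth f" and g: "smooth g"
  shows "foldr partial js (\<lambda>x. c * f x + d * g x)
           = (\<lambda>x. c * foldr partial js f x + d * foldr partial js g x)" (is "?A js")
    and "smooth (\<lambda>x. c * f x + d * g x)"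
proof -
  have der: "((\<lambda>t. c * foldr partial js f (x + t *\<^sub>R axis j 1)
                 + d * foldr partial js g (x + t *\<^sub>R axis j 1)) has_vector_derivative
               c * foldr partial (j # js) f x + d * foldr partial (j # js) g x) (at 0)" for j js x
    by (intro has_vector_derivative_add has_vector_derivative_mult_right partial_works f g)
  have A: "?A js" for js
  proof (induction js)
    case (Cons j js)
    show ?case
    proof
      fix x
      have "foldr partial (j # js) (\<lambda>x. c * f x + d * g x) x
          = partial j (\<lambda>x. c * foldr partial js f x + d * foldr partial js g x) x"
        using Cons by simp
      also have "\<dots> = c * foldr partial (j # js) f x + d * foldr partial (j # js) g x"
        by (subst partial_def) (rule vector_derivative_at[OF der])
      finally show "foldr partial (j # js) (\<lambda>x. c * f x + d * g x) x
          = c * foldr partial (j # js) f x + d * foldr partial (j # js) g x" .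
    qed
  qed simp
  show "?A js" by (rule A)
  show "smooth (\<lambda>x. c * f x + d * g x)"
    unfolding smooth_def A using f g der
    by (auto simp: smooth_def intro!: continuous_intros differentiableI_vector)
qed

lemma smooth_partial: "smooth f \<Longrightarrow> smooth (partial j f)"
  unfolding smooth_def
proof (intro allI)
  fix js
  assume "\<forall>js. continuous_on UNIV (foldr partial js f) \<and>
     (\<forall>j x. (\<lambda>t. foldr partial js f (x + t *\<^sub>R axis j 1)) differentiable (at 0))"
  from this[rule_format, of "js @ [j]"]
  show "continuous_on UNIV (foldr partial js (partial j f)) \<and>
     (\<forall>ja x. (\<lambda>t. foldr partial js (partial j f) (x + t *\<^sub>R axis ja 1)) differentiable (at 0))"
    by simp
qed

lemma periodic_partial: "periodic f \<Longrightarrow> periodic (partial j f)"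
proof -
  assume f: "periodic f"
  have "f (x + (2 * pi) *\<^sub>R ivec k + y) = f (x + y)" for x y k
    using f[unfolded periodic_def, rule_format, of "x + y" k] by (simp add: ac_simps)
  then show ?thesis unfolding periodic_def partial_def by simp
qed

lemma smooth_exp: "smooth (\<lambda>x. c * exp (- \<i> * complex_of_real (x \<bullet> y)))"
proof -
  have der: "((\<lambda>t. c * exp (- \<i> * complex_of_real ((x + t *\<^sub>R axis j 1) \<bullet> y))) has_vector_derivative
        (- \<i> * complex_of_real (y $ j) * c) * exp (- \<i> * complex_of_real (x \<bullet> y))) (at 0)" for c j x
  proof -
    have *: "((\<lambda>t::real. c * exp (- \<i> * (a + of_real t * b))) has_vector_derivative
        (- \<i> * b * c) * exp (- \<i> * a)) (at 0)" for a b :: complex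
      by (rule has_vector_derivative_real_field) (auto intro!: derivative_eq_intros)
    show ?thesis
      using *[of "complex_of_real (x \<bullet> y)" "complex_of_real (y $ j)"]
      by (simp add: inner_add_left inner_axis')
  qed
  have "partial j (\<lambda>x. c * exp (- \<i> * complex_of_real (x \<bullet> y)))
      = (\<lambda>x. (- \<i> * complex_of_real (y $ j) * c) * exp (- \<i> * complex_of_real (x \<bullet> y)))" for j c
    unfolding partial_def using vector_derivative_at[OF der] by blast
  note partial_exp = this
  have iter: "\<exists>c'. foldr partial js (\<lambda>x. c * exp (- \<i> * complex_of_real (x \<bullet> y)))
      = (\<lambda>x. c' * exp (- \<i> * complex_of_real (x \<bullet> y)))" for js
  proof (induction js)
    case (Cons j js)
    then obtain c' where "foldr partial js (\<lambda>x. c * exp (- \<i> * complex_of_real (x \<bullet> y)))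
      = (\<lambda>x. c' * exp (- \<i> * complex_of_real (x \<bullet> y)))" by blast
    then show ?case
      using partial_exp[of j c'] by (intro exI[of _ "- \<i> * complex_of_real (y $ j) * c'"]) simp
  qed auto
  show ?thesis unfolding smooth_def
  proof (intro allI)
    fix js
    obtain c' where c': "foldr partial js (\<lambda>x. c * exp (- \<i> * complex_of_real (x \<bullet> y)))
      = (\<lambda>x. c' * exp (- \<i> * complex_of_real (x \<bullet> y)))"
      using iter by blast
    show "continuous_on UNIV (foldr partial js (\<lambda>x. c * exp (- \<i> * complex_of_real (x \<bullet> y)))) \<and>
      (\<forall>j x. (\<lambda>t. foldr partial js (\<lambda>x. c * exp (- \<i> * complex_of_real (x \<bullet> y)))
          (x + t *\<^sub>R axis j 1)) differentiable at 0)"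
      unfolding c'
    proof (intro conjI allI)
      show "(\<lambda>t. c' * exp (- \<i> * complex_of_real ((x + t *\<^sub>R axis j 1) \<bullet> y))) differentiable at 0" for j x
        using der by (rule differentiableI_vector)
    qed (intro continuous_intros)
  qed
qed

lemma periodic_exp:
  fixes \<xi> :: "int^'n::finite"
  shows "periodic (\<lambda>x. exp (- \<i> * complex_of_real (x \<bullet> ivec \<xi>)))"
  unfolding periodic_def
proof (intro allI)
  fix k :: "int^'n" and x
  have "exp (- \<i> * complex_of_real ((x + (2 * pi) *\<^sub>R ivec k) \<bullet> ivec \<xi>))
      = exp (- \<i> * complex_of_real (x \<bullet> ivec \<xi>) +
             2 * of_int (- (\<Sum>j\<in>UNIV. k $ j * \<xi> $ j)) * pi * \<i>)"
  proof -
    have "ivec k \<bullet> ivec \<xi> = of_int (\<Sum>j\<in>UNIV. k $ j * \<xi> $ j)"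
      by (simp add: inner_vec_def ivec_def)
    then show ?thesis by (simp add: inner_add_left distrib_left mult_ac)
  qed
  also have "\<dots> = exp (- \<i> * complex_of_real (x \<bullet> ivec \<xi>))"
    by (simp only: exp_add exp_integer_2pi[OF Ints_of_int] mult_1_right)
  finally show "exp (- \<i> * complex_of_real ((x + (2 * pi) *\<^sub>R ivec k) \<bullet> ivec \<xi>))
      = exp (- \<i> * complex_of_real (x \<bullet> ivec \<xi>))" .
qed

typedef (overloaded) ('n::finite) torus_test =
  "{f :: real^'n \<Rightarrow> complex. smooth f \<and> periodic f}"
  morphisms test_apply Abs_torus_test
  using smooth_exp[of 0] by (auto intro!: exI[of _ "\<lambda>x. 0"] simp: periodic_def)

setup_lifting type_definition_torus_test

lift_definition test_add :: "('n::finite) torus_test \<Rightarrow> 'n torus_test \<Rightarrow> 'n torus_test"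
  is "\<lambda>f g x. f x + g x"
  using smooth_linear_comb(2)[where c = 1 and d = 1] by (auto simp: periodic_def)

lift_definition test_scale :: "complex \<Rightarrow> ('n::finite) torus_test \<Rightarrow> 'n torus_test"
  is "\<lambda>c f x. c * f x"
  using smooth_linear_comb(2)[where d = 0] by (auto simp: periodic_def)

lift_definition test_deriv :: "'n::finite \<Rightarrow> 'n torus_test \<Rightarrow> 'n torus_test"
  is partial
  by (simp add: smooth_partial periodic_partial)

text \<open>The frequency enters with a minus sign, so that the Fourier coefficients of a distribution are
  its values at these functions.\<close>

lift_definition test_exp :: "int^'n::finite \<Rightarrow> 'n torus_test"
  is "\<lambda>\<xi> x. exp (- \<i> * complex_of_real (x \<bullet> ivec \<xi>))"
  using smooth_exp[of 1] periodic_exp by auto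


section \<open>Distributions on the torus\<close>

text \<open>Complex-linear functionals that are continuous for the Frechet topology of the space of smooth
  periodic functions, i.e. bounded by finitely many of the norms given by the suprema of the
  iterated partial derivatives. A derivative is indexed here by the list of the directions in which
  one differentiates; the order in that list is immaterial since all functions are smooth.\<close>

definition distribution :: "(('n::finite) torus_test \<Rightarrow> complex) \<Rightarrow> bool" where
  "distribution u \<longleftrightarrow>
     (\<forall>\<phi> \<psi>. u (test_add \<phi> \<psi>) = u \<phi> + u \<psi>) \<and>
     (\<forall>c \<phi>. u (test_scale c \<phi>) = c * u \<phi>) \<and>
     (\<exists>m C. \<forall>\<phi> M.
        (\<forall>js x. length js \<le> m \<longrightarrow> cmod (test_apply (foldr test_deriv js \<phi>) x) \<le> M)
          \<longrightarrow> cmod (u \<phi>) \<le> C * M)"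

lemma distribution_linear_comb:
  assumes u: "distribution u" and v: "distribution v"
  shows "distribution (\<lambda>\<phi>. c * u \<phi> + d * v \<phi>)"
proof -
  obtain m C where C: "\<And>\<phi> M. (\<forall>js x. length js \<le> m \<longrightarrow> cmod (test_apply (foldr test_deriv js \<phi>) x) \<le> M)
          \<Longrightarrow> cmod (u \<phi>) \<le> C * M" using u unfolding distribution_def by metis
  obtain m' C' where C': "\<And>\<phi> M. (\<forall>js x. length js \<le> m' \<longrightarrow> cmod (test_apply (foldr test_deriv js \<phi>) x) \<le> M)
          \<Longrightarrow> cmod (v \<phi>) \<le> C' * M" using v unfolding distribution_def by metis
  have "cmod (c * u \<phi> + d * v \<phi>) \<le> (cmod c * C + cmod d * C') * M"
    if "\<forall>js x. length js \<le> max m m' \<longrightarrow> cmod (test_apply (foldr test_deriv js \<phi>) x) \<le> M" for \<phi> M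
  proof -
    have "cmod (u \<phi>) \<le> C * M" "cmod (v \<phi>) \<le> C' * M"
      using C[of \<phi> M] C'[of \<phi> M] that by auto
    then have "cmod c * cmod (u \<phi>) \<le> cmod c * (C * M)" "cmod d * cmod (v \<phi>) \<le> cmod d * (C' * M)"
      by (auto intro: mult_left_mono)
    then show ?thesis
      using norm_triangle_ineq[of "c * u \<phi>" "d * v \<phi>"] by (simp add: norm_mult algebra_simps)
  qed
  then have "\<exists>m C. \<forall>\<phi> M. (\<forall>js x. length js \<le> m \<longrightarrow> cmod (test_apply (foldr test_deriv js \<phi>) x) \<le> M)
          \<longrightarrow> cmod (c * u \<phi> + d * v \<phi>) \<le> C * M" by blast
  then show ?thesis
    using u v unfolding distribution_def by (simp add: algebra_simps)
qed

lemma distribution_zero: "distribution (\<lambda>\<phi>. 0)"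
  unfolding distribution_def by (auto intro!: exI[of _ 0])

lemma test_deriv_add: "test_deriv j (test_add \<phi> \<psi>) = test_add (test_deriv j \<phi>) (test_deriv j \<psi>)"
  using smooth_linear_comb(1)[of _ _ "[j]" 1 1] by transfer auto

lemma test_deriv_scale: "test_deriv j (test_scale c \<phi>) = test_scale c (test_deriv j \<phi>)"
  using smooth_linear_comb(1)[of _ _ "[j]" c 0] by transfer auto

lemma distribution_deriv:
  assumes u: "distribution u"
  shows "distribution (\<lambda>\<phi>. - u (test_deriv j \<phi>))"
proof -
  obtain m C where C: "\<And>\<phi> M. (\<forall>js x. length js \<le> m \<longrightarrow> cmod (test_apply (foldr test_deriv js \<phi>) x) \<le> M)
          \<Longrightarrow> cmod (u \<phi>) \<le> C * M" using u unfolding distribution_def by metis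
  have "cmod (- u (test_deriv j \<phi>)) \<le> C * M"
    if *: "\<forall>js x. length js \<le> Suc m \<longrightarrow> cmod (test_apply (foldr test_deriv js \<phi>) x) \<le> M" for \<phi> M
    using C[of "test_deriv j \<phi>" M] *[rule_format, of "_ @ [j]"] by simp
  then have "\<exists>m C. \<forall>\<phi> M. (\<forall>js x. length js \<le> m \<longrightarrow> cmod (test_apply (foldr test_deriv js \<phi>) x) \<le> M)
          \<longrightarrow> cmod (- u (test_deriv j \<phi>)) \<le> C * M" by blast
  then show ?thesis
    using u unfolding distribution_def by (simp add: test_deriv_add test_deriv_scale)
qed

text \<open>Integration over a fundamental domain, normalized so that the function with constant value
  one pairs to one with itself.\<close>

definition torus_mean :: "(real^'n::finite \<Rightarrow> complex) \<Rightarrow> complex" where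
  "torus_mean f = integral (cbox 0 (\<chi> j. 2 * pi)) f / complex_of_real ((2 * pi) ^ CARD('n))"

lemma continuous_test_apply: "continuous_on S (test_apply \<phi>)"
proof -
  have "smooth (test_apply \<phi>)" using test_apply[of \<phi>] by simp
  then have "continuous_on UNIV (foldr partial [] (test_apply \<phi>))" unfolding smooth_def by blast
  then show ?thesis by (auto intro: continuous_on_subset)
qed

lemma distribution_of_test:
  fixes F :: "('n::finite) torus_test"
  shows "distribution (\<lambda>\<phi>. torus_mean (\<lambda>x. test_apply F x * test_apply \<phi> x))"
proof -
  let ?B = "cbox 0 (\<chi> j. 2 * pi) :: (real^'n) set"
  let ?c = "complex_of_real ((2 * pi) ^ CARD('n))"
  have int: "(\<lambda>x. test_apply F x * test_apply \<phi> x) integrable_on ?B" for \<phi>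
    by (intro integrable_continuous continuous_intros continuous_test_apply)
  have intF: "(\<lambda>x. cmod (test_apply F x)) integrable_on ?B"
    by (intro integrable_continuous continuous_intros continuous_test_apply)
  have add: "torus_mean (\<lambda>x. test_apply F x * test_apply (test_add \<phi> \<psi>) x) =
     torus_mean (\<lambda>x. test_apply F x * test_apply \<phi> x) + torus_mean (\<lambda>x. test_apply F x * test_apply \<psi> x)" for \<phi> \<psi>
    using integral_add[OF int[of \<phi>] int[of \<psi>]]
    by (simp add: torus_mean_def test_add.rep_eq distrib_left add_divide_distrib)
  have scale: "torus_mean (\<lambda>x. test_apply F x * test_apply (test_scale c \<phi>) x) =
     c * torus_mean (\<lambda>x. test_apply F x * test_apply \<phi> x)" for c \<phi>
    using integral_mult_right[of ?B c "\<lambda>x. test_apply F x * test_apply \<phi> x"]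
    by (simp add: torus_mean_def test_scale.rep_eq mult.left_commute)
  have "cmod (torus_mean (\<lambda>x. test_apply F x * test_apply \<phi> x))
       \<le> (integral ?B (\<lambda>x. cmod (test_apply F x)) / (2 * pi) ^ CARD('n)) * M"
    if "\<forall>js x. length js \<le> 0 \<longrightarrow> cmod (test_apply (foldr test_deriv js \<phi>) x) \<le> M" for \<phi> M
  proof -
    have M: "cmod (test_apply \<phi> x) \<le> M" for x using that by simp
    have "cmod (integral ?B (\<lambda>x. test_apply F x * test_apply \<phi> x))
        \<le> integral ?B (\<lambda>x. cmod (test_apply F x) * M)"
      by (rule integral_norm_bound_integral[OF int])
        (auto simp: norm_mult intro!: mult_left_mono M integrable_on_mult_left intF)
    then show ?thesis
      by (simp add: torus_mean_def norm_divide norm_mult norm_power divide_right_mono)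
  qed
  then show ?thesis unfolding distribution_def using add scale by blast
qed

typedef (overloaded) ('n::finite) torus_distr = "{u :: 'n torus_test \<Rightarrow> complex. distribution u}"
  morphisms pairing Abs_torus_distr
  using distribution_zero by blast

setup_lifting type_definition_torus_distr

instantiation torus_distr :: (finite) real_vector
begin

lift_definition zero_torus_distr :: "'a torus_distr" is "\<lambda>\<phi>. 0"
  by (rule distribution_zero)

lift_definition plus_torus_distr :: "'a torus_distr \<Rightarrow> 'a torus_distr \<Rightarrow> 'a torus_distr"
  is "\<lambda>u v \<phi>. u \<phi> + v \<phi>"
  using distribution_linear_comb[where c = 1 and d = 1] by auto

lift_definition minus_torus_distr :: "'a torus_distr \<Rightarrow> 'a torus_distr \<Rightarrow> 'a torus_distr"
  is "\<lambda>u v \<phi>. u \<phi> - v \<phi>"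
  using distribution_linear_comb[where c = 1 and d = "-1"] by auto

lift_definition uminus_torus_distr :: "'a torus_distr \<Rightarrow> 'a torus_distr"
  is "\<lambda>u \<phi>. - u \<phi>"
  using distribution_linear_comb[where c = "-1" and d = 0] by auto

lift_definition scaleR_torus_distr :: "real \<Rightarrow> 'a torus_distr \<Rightarrow> 'a torus_distr"
  is "\<lambda>r u \<phi>. complex_of_real r * u \<phi>"
  using distribution_linear_comb[where d = 0] by auto

instance
  by standard (transfer, auto simp: algebra_simps)+

end

lift_definition scaleC :: "complex \<Rightarrow> ('n::finite) torus_distr \<Rightarrow> 'n torus_distr" (infixr "*\<^sub>C" 75)
  is "\<lambda>c u \<phi>. c * u \<phi>"
  using distribution_linear_comb[where d = 0] by auto

lift_definition distr_partial :: "'n::finite \<Rightarrow> 'n torus_distr \<Rightarrow> 'n torus_distr"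
  is "\<lambda>j u \<phi>. - u (test_deriv j \<phi>)"
  by (rule distribution_deriv)

definition D_x :: "'n::finite \<Rightarrow> 'n torus_distr \<Rightarrow> 'n torus_distr" where
  "D_x j u = (1 / \<i>) *\<^sub>C distr_partial j u"

definition laplacian :: "('n::finite) torus_distr \<Rightarrow> 'n torus_distr" where
  "laplacian u = (\<Sum>j\<in>UNIV. distr_partial j (distr_partial j u))"

lift_definition of_test :: "('n::finite) torus_test \<Rightarrow> 'n torus_distr"
  is "\<lambda>F \<phi>. torus_mean (\<lambda>x. test_apply F x * test_apply \<phi> x)"
  by (rule distribution_of_test)

definition fourier_coeff :: "('n::finite) torus_distr \<Rightarrow> int^'n \<Rightarrow> complex" where
  "fourier_coeff u \<xi> = pairing u (test_exp \<xi>)"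


section \<open>Sobolev spaces and smooth functions\<close>

definition sobolev_term :: "real \<Rightarrow> ('n::finite) torus_distr \<Rightarrow> int^'n \<Rightarrow> real" where
  "sobolev_term r u \<xi> = (cmod (fourier_coeff u \<xi>))\<^sup>2 * (1 + norm (ivec \<xi>)) powr (2 * r)"

definition sobolev :: "real \<Rightarrow> ('n::finite) torus_distr set" where
  "sobolev r = {u. sobolev_term r u summable_on UNIV}"

definition sobolev_norm :: "real \<Rightarrow> ('n::finite) torus_distr \<Rightarrow> real" where
  "sobolev_norm r u = sqrt (\<Sum>\<^sub>\<infinity>\<xi>. sobolev_term r u \<xi>)"

definition sobolev_topology :: "real \<Rightarrow> ('n::finite) torus_distr topology" where
  "sobolev_topology r = Metric_space.mtopology (sobolev r) (\<lambda>u v. sobolev_norm r (u - v))"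

definition Cinf :: "('n::finite) torus_distr set" where
  "Cinf = (\<Inter>r. sobolev r)"

definition Cinf_topology :: "('n::finite) torus_distr topology" where
  "Cinf_topology = topology_generated_by {U \<inter> Cinf | U r. openin (sobolev_topology r) U}"


section \<open>Gevrey spaces\<close>

text \<open>The coordinates carry no order, so the order of differentiation is fixed by an arbitrary
  enumeration; it is immaterial for smooth functions.\<close>

definition coord_enum :: "('n::finite) list" where
  "coord_enum = (SOME js. distinct js \<and> set js = UNIV)"

definition multi_abs :: "nat^'n::finite \<Rightarrow> nat" where
  "multi_abs \<alpha> = (\<Sum>j\<in>UNIV. \<alpha> $ j)"

definition multi_D :: "nat^'n::finite \<Rightarrow> 'n torus_test \<Rightarrow> real^'n \<Rightarrow> complex" where
  "multi_D \<alpha> F x = (1 / \<i>) ^ multi_abs \<alpha> *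
     test_apply (foldr (\<lambda>j. test_deriv j ^^ (\<alpha> $ j)) coord_enum F) x"

definition gevrey :: "real \<Rightarrow> ('n::finite) torus_distr set" where
  "gevrey s = {f \<in> Cinf. \<exists>F. f = of_test F \<and> (\<exists>C>0. \<exists>h>0. \<forall>\<alpha> x.
     cmod (multi_D \<alpha> F x) \<le> C * h ^ multi_abs \<alpha> * fact (multi_abs \<alpha>) powr s)}"

definition gevrey_norm :: "real \<Rightarrow> real \<Rightarrow> ('n::finite) torus_test \<Rightarrow> ennreal" where
  "gevrey_norm h s F = (SUP \<alpha>. (SUP x. ennreal (cmod (multi_D \<alpha> F x))) /
     ennreal (h ^ multi_abs \<alpha> * fact (multi_abs \<alpha>) powr s))"

text \<open>The locally convex inductive limit topology is the finest locally convex topology for which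
  all inclusions of the Banach spaces with parameter \<open>h\<close> are continuous. Its neighbourhoods of zero
  are generated by the convex balanced sets whose intersection with each of these spaces is a
  neighbourhood of zero there.\<close>

definition gevrey_zero_nhd :: "real \<Rightarrow> ('n::finite) torus_distr set \<Rightarrow> bool" where
  "gevrey_zero_nhd s V \<longleftrightarrow> V \<subseteq> gevrey s \<and> convex V \<and>
     (\<forall>c. \<forall>v\<in>V. cmod c \<le> 1 \<longrightarrow> c *\<^sub>C v \<in> V) \<and>
     (\<forall>h>0. \<exists>\<epsilon>>0. \<forall>F. gevrey_norm h s F < ennreal \<epsilon> \<longrightarrow> of_test F \<in> V)"

definition gevrey_topology :: "real \<Rightarrow> ('n::finite) torus_distr topology" where
  "gevrey_topology s = topology (\<lambda>U. U \<subseteq> gevrey s \<and>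
     (\<forall>u\<in>U. \<exists>V. gevrey_zero_nhd s V \<and> (\<lambda>v. u + v) ` V \<subseteq> U))"

lemma gevrey_zero_nhd_Int:
  assumes V: "gevrey_zero_nhd s V" and W: "gevrey_zero_nhd s W"
  shows "gevrey_zero_nhd s (V \<inter> W)"
proof -
  have "\<exists>\<epsilon>>0. \<forall>F. gevrey_norm h s F < ennreal \<epsilon> \<longrightarrow> of_test F \<in> V \<inter> W" if "h > 0" for h
  proof -
    obtain a where "a > 0" and "\<And>F. gevrey_norm h s F < ennreal a \<Longrightarrow> of_test F \<in> V"
      using V \<open>h > 0\<close> unfolding gevrey_zero_nhd_def by blast
    moreover obtain b where "b > 0" and "\<And>F. gevrey_norm h s F < ennreal b \<Longrightarrow> of_test F \<in> W"
      using W \<open>h > 0\<close> unfolding gevrey_zero_nhd_def by blast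
    moreover have "ennreal (min a b) \<le> ennreal a" "ennreal (min a b) \<le> ennreal b"
      by (auto intro: ennreal_leI)
    ultimately show ?thesis
      by (intro exI[of _ "min a b"]) (metis IntI min_less_iff_conj order_less_le_trans)
  qed
  then show ?thesis
    using V W unfolding gevrey_zero_nhd_def by (auto intro: convex_Int)
qed

lemma openin_gevrey_topology:
  fixes U :: "('n::finite) torus_distr set"
  shows "openin (gevrey_topology s) U \<longleftrightarrow>
     U \<subseteq> gevrey s \<and> (\<forall>u\<in>U. \<exists>V. gevrey_zero_nhd s V \<and> (\<lambda>v. u + v) ` V \<subseteq> U)"
proof -
  have "istopology (\<lambda>U :: 'n torus_distr set. U \<subseteq> gevrey s \<and>
     (\<forall>u\<in>U. \<exists>V. gevrey_zero_nhd s V \<and> (\<lambda>v. u + v) ` V \<subseteq> U))"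
    unfolding istopology_def
  proof (intro conjI allI impI ballI)
    fix S T u
    assume S: "S \<subseteq> gevrey s \<and> (\<forall>u\<in>S. \<exists>V. gevrey_zero_nhd s V \<and> (\<lambda>v. u + v) ` V \<subseteq> S)"
      and T: "T \<subseteq> gevrey s \<and> (\<forall>u\<in>T. \<exists>V. gevrey_zero_nhd s V \<and> (\<lambda>v. u + v) ` V \<subseteq> T)"
      and u: "u \<in> S \<inter> T"
    then obtain V W where "gevrey_zero_nhd s V" "(\<lambda>v. u + v) ` V \<subseteq> S"
      "gevrey_zero_nhd s W" "(\<lambda>v. u + v) ` W \<subseteq> T" by blast
    then show "\<exists>V. gevrey_zero_nhd s V \<and> (\<lambda>v. u + v) ` V \<subseteq> S \<inter> T"
      by (intro exI[of _ "V \<inter> W"]) (auto intro: gevrey_zero_nhd_Int)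
  next
    fix K and u :: "'n torus_distr"
    assume K: "\<forall>U\<in>K. U \<subseteq> gevrey s \<and> (\<forall>u\<in>U. \<exists>V. gevrey_zero_nhd s V \<and> (\<lambda>v. u + v) ` V \<subseteq> U)"
      and u: "u \<in> \<Union>K"
    then obtain U V where "U \<in> K" "gevrey_zero_nhd s V" "(\<lambda>v. u + v) ` V \<subseteq> U" by blast
    then show "\<exists>V. gevrey_zero_nhd s V \<and> (\<lambda>v. u + v) ` V \<subseteq> \<Union>K" by blast
  qed auto
  then show ?thesis unfolding gevrey_topology_def by (subst topology_inverse') auto
qed


section \<open>Continuous and continuously differentiable maps on an interval\<close>

text \<open>Maps on \<open>[0,T]\<close> are the HOL functions that are \<open>extensional\<close> on that interval, so that two of
  them are equal as soon as they agree on it.\<close>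

definition C0_maps :: "real \<Rightarrow> 'a topology \<Rightarrow> (real \<Rightarrow> 'a) set" where
  "C0_maps T X = {u \<in> extensional {0..T}. continuous_map (top_of_set {0..T}) X u}"

definition C1_maps :: "real \<Rightarrow> 'a::real_vector topology \<Rightarrow> (real \<Rightarrow> 'a) set" where
  "C1_maps T X = {u \<in> C0_maps T X. \<exists>u'\<in>C0_maps T X. \<forall>t\<in>{0..T}.
     limitin X (\<lambda>\<tau>. (u \<tau> - u t) /\<^sub>R (\<tau> - t)) (u' t) (at t within {0..T})}"


section \<open>The Cauchy problem\<close>

definition time_deriv :: "(real \<Rightarrow> complex) \<Rightarrow> real \<Rightarrow> complex" where
  "time_deriv \<phi> t = vector_derivative \<phi> (at t)"

text \<open>A closed subset of the bounded open interval is automatically compact.\<close>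

definition time_test :: "real \<Rightarrow> (real \<Rightarrow> complex) set" where
  "time_test T = {\<phi>. (\<forall>n t. (time_deriv ^^ n) \<phi> differentiable (at t)) \<and>
     closure {t. \<phi> t \<noteq> 0} \<subseteq> {0<..<T}}"

text \<open>The integral of a distribution-valued function is taken weakly, i.e. after pairing with a
  test function on the torus. For continuous maps into a Sobolev space this is the pairing of the
  test function with the Riemann integral in that space.\<close>

definition distr_integral :: "real \<Rightarrow> (real \<Rightarrow> ('n::finite) torus_distr) \<Rightarrow> 'n torus_test \<Rightarrow> complex" where
  "distr_integral T v \<psi> = integral {0..T} (\<lambda>t. pairing (v t) \<psi>)"

definition weak_D_t ::
    "real \<Rightarrow> (real \<Rightarrow> ('n::finite) torus_distr) \<Rightarrow> (real \<Rightarrow> complex) \<Rightarrow> 'n torus_test \<Rightarrow> complex" where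
  "weak_D_t T u \<phi> = distr_integral T (\<lambda>t. (- (1 / \<i>) * time_deriv \<phi> t) *\<^sub>C u t)"

definition spatial_op ::
    "complex \<Rightarrow> ('n \<Rightarrow> complex) \<Rightarrow> complex \<Rightarrow> ('n::finite) torus_distr \<Rightarrow> 'n torus_distr" where
  "spatial_op a2 a1 a0 u =
     - (a2 *\<^sub>C laplacian u) + (\<Sum>j\<in>UNIV. a1 j *\<^sub>C D_x j u) + a0 *\<^sub>C u"

definition solves_CP ::
    "real \<Rightarrow> (real \<Rightarrow> complex) \<Rightarrow> ('n::finite \<Rightarrow> real \<Rightarrow> complex) \<Rightarrow> (real \<Rightarrow> complex) \<Rightarrow>
     (real \<Rightarrow> 'n torus_distr) \<Rightarrow> 'n torus_distr \<Rightarrow> (real \<Rightarrow> 'n torus_distr) \<Rightarrow> bool" where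
  "solves_CP T a2 a1 a0 f g u \<longleftrightarrow>
     (\<exists>\<rho>. u \<in> C0_maps T (sobolev_topology \<rho>)) \<and>
     u 0 = g \<and>
     (\<forall>\<phi>\<in>time_test T. \<forall>\<psi>.
        weak_D_t T u \<phi> \<psi>
          + distr_integral T (\<lambda>t. \<phi> t *\<^sub>C spatial_op (a2 t) (\<lambda>j. a1 j t) (a0 t) (u t)) \<psi>
        = distr_integral T (\<lambda>t. \<phi> t *\<^sub>C f t) \<psi>)"

end

theory Submission
  imports Defs
begin

text \<open>A distribution on the torus is determined by its Fourier coefficients, which turn the equation
  into one scalar linear equation \<open>y' = \<i> (f - \<lambda> y)\<close> for each frequency \<open>\<xi>\<close>, where \<open>\<lambda>\<close> is the symbol of
  the spatial operator. The sign conditions bound \<open>Im \<lambda>\<close> from above uniformly in \<open>\<xi>\<close>, so Duhamel's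
  formula gives \<open>|y(t)| \<le> M (|y(0)| + \<integral> |f|)\<close> with one constant \<open>M\<close> for all frequencies. Continuity in time
  with values in a Sobolev or Gevrey space amounts to continuity of every coefficient together with
  smallness at high frequencies that is uniform in time (by compactness of \<open>[0,T]\<close>), and the bound
  carries this uniform smallness from the data over to the solution and its difference quotients.
  A weak solution solves each scalar equation weakly, hence classically by the lemma of du
  Bois-Reymond, which yields uniqueness.\<close>

section \<open>Summability over the lattice\<close>

text \<open>The first-order coefficients are real, so they only make the propagator oscillate, while
  \<open>Im a2 \<le> 0\<close> damps it; growth comes from \<open>a0\<close> alone and is the same
  at every frequency. Hence the solution loses no regularity, whereas its time derivative contains
  the quadratically growing symbol and lands in \<open>H^(r-2)\<close>. The damping is unbounded in
  the frequency, so the backward propagator is not controlled and every estimate has to run forward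
  in time. The inductive limit topology of the Gevrey space is the main obstacle: it is described
  only through its zero neighbourhoods, and a continuous curve must first be shown to be bounded in
  a single Banach step before any estimate applies. Weighted sup seminorms on the coefficients serve
  this purpose. Difference quotients are time averages of the derivative, so bounds that hold
  uniformly in time pass to them. Since distributions are functionals on smooth periodic functions,
  test functions have to be expanded into Fourier series before a distribution can be recovered from
  its coefficients; this rests on the completeness of the characters.\<close>

definition bracket :: "int^'n::finite \<Rightarrow> real" where
  "bracket \<xi> = 1 + norm (ivec \<xi>)"

lemma bracket_ge_1: "1 \<le> bracket \<xi>"
  by (simp add: bracket_def)

lemma bracket_pos [simp]: "0 < bracket \<xi>"
  using bracket_ge_1[of \<xi>] by linarith

lemma ivec_minus: "ivec (- \<xi>) = - ivec \<xi>"
  by (simp add: ivec_def vec_eq_iff)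

lemma ivec_0 [simp]: "ivec 0 = 0"
  by (simp add: ivec_def vec_eq_iff)

lemma bracket_minus [simp]: "bracket (- \<xi>) = bracket \<xi>"
  by (simp add: bracket_def ivec_minus)

lemma ivec_nth [simp]: "ivec \<xi> $ j = real_of_int (\<xi> $ j)"
  by (simp add: ivec_def)

lemma abs_component_le_norm_ivec: "\<bar>real_of_int (\<xi> $ j)\<bar> \<le> norm (ivec \<xi>)"
  using component_le_norm_cart[of "ivec \<xi>" j] by simp

lemma abs_component_le_bracket: "\<bar>real_of_int (\<xi> $ j)\<bar> \<le> bracket \<xi>"
  using abs_component_le_norm_ivec[of \<xi> j] by (simp add: bracket_def)

lemma norm_ivec_le_sum: "norm (ivec \<xi>) \<le> (\<Sum>j\<in>UNIV. \<bar>real_of_int (\<xi> $ j)\<bar>)"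
  using norm_le_l1_cart[of "ivec \<xi>"] by simp

text \<open>A finite set of lattice points lies in the box spanned by its coordinate values
  \<open>K\<close>, and over a box the sum of products factors into a power of a one-dimensional
  sum.\<close>

lemma summable_on_prod_components:
  fixes g :: "int \<Rightarrow> real"
  assumes g: "g summable_on UNIV" and pos: "\<And>k. g k \<ge> 0"
  shows "(\<lambda>\<xi>::int^'n::finite. \<Prod>j\<in>UNIV. g (\<xi> $ j)) summable_on UNIV"
proof (rule nonneg_bdd_above_summable_on)
  have "sum (\<lambda>\<xi>::int^'n. \<Prod>j\<in>UNIV. g (\<xi> $ j)) F \<le> infsum g UNIV ^ CARD('n)" if F: "finite F" for F
  proof -
    define K where "K = (\<Union>j. (\<lambda>\<xi>. \<xi> $ j) ` F)"
    have "finite K" unfolding K_def using F by (intro finite_UN_I) auto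
    have "sum (\<lambda>\<xi>::int^'n. \<Prod>j\<in>UNIV. g (\<xi> $ j)) F = sum (\<lambda>h. \<Prod>j\<in>UNIV. g (h j)) (($) ` F)"
      by (subst sum.reindex) (auto simp: inj_on_def vec_eq_iff)
    also have "\<dots> \<le> sum (\<lambda>h. \<Prod>j\<in>UNIV. g (h j)) (PiE (UNIV::'n set) (\<lambda>_. K))"
    proof (rule sum_mono2)
      show "finite (PiE (UNIV::'n set) (\<lambda>_. K))" using \<open>finite K\<close> by (intro finite_PiE) auto
      show "($) ` F \<subseteq> PiE UNIV (\<lambda>_. K)" by (auto simp: K_def)
    qed (intro prod_nonneg pos ballI)
    also have "\<dots> = (\<Prod>j\<in>(UNIV::'n set). sum g K)"
      using \<open>finite K\<close> by (subst prod_sum_PiE) auto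
    also have "\<dots> = sum g K ^ CARD('n)" by simp
    also have "\<dots> \<le> infsum g UNIV ^ CARD('n)"
    proof (rule power_mono)
      show "sum g K \<le> infsum g UNIV" by (rule finite_sum_le_infsum[OF g \<open>finite K\<close>]) (auto intro: pos)
    qed (intro sum_nonneg pos)
    finally show ?thesis .
  qed
  then show "bdd_above (sum (\<lambda>\<xi>::int^'n. \<Prod>j\<in>UNIV. g (\<xi> $ j)) ` {F. F \<subseteq> UNIV \<and> finite F})"
    by (intro bdd_aboveI2) auto
qed (intro prod_nonneg pos ballI)

lemma summable_on_int_inverse_square: "(\<lambda>k::int. 1 / (1 + \<bar>real_of_int k\<bar>)\<^sup>2) summable_on UNIV"
proof -
  let ?g = "\<lambda>k::int. 1 / (1 + \<bar>real_of_int k\<bar>)\<^sup>2"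
  have "summable (\<lambda>n. inverse (real n ^ 2))"
    by (rule inverse_power_summable) simp
  then have "summable (\<lambda>n. inverse (real (Suc n) ^ 2))"
    by (rule summable_Suc_iff[THEN iffD2])
  then have s: "(\<lambda>n::nat. 1 / (1 + real n)\<^sup>2) summable_on UNIV"
    by (intro norm_summable_imp_summable_on) (simp add: inverse_eq_divide)
  have 1: "?g summable_on {0..}"
    using s by (subst summable_on_reindex_bij_betw[of int UNIV "{0..}", symmetric])
      (auto simp: bij_betw_def inj_on_def image_def intro: zero_le_imp_eq_int)
  have b: "bij_betw (\<lambda>n. - int (Suc n)) UNIV {..<0}"
    by (rule bij_betwI[of _ _ _ "\<lambda>k. nat (-k) - 1"]) auto
  have "(\<lambda>n::nat. ?g (- int (Suc n))) summable_on UNIV"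
  proof (rule summable_on_comparison_test[OF s])
    show "?g (- int (Suc n)) \<le> 1 / (1 + real n)\<^sup>2" for n
      by (intro divide_left_mono power_mono mult_pos_pos zero_less_power) auto
  qed simp
  then have 2: "?g summable_on {..<0}"
    using summable_on_reindex_bij_betw[OF b, of ?g] by blast
  have "({0..} :: int set) \<union> {..<0} = UNIV" by auto
  moreover have "({0..} :: int set) \<inter> {..<0} = {}" by auto
  ultimately show ?thesis using summable_on_Un_disjoint[OF 1 2] by simp
qed

text \<open>The exponent 2N gives one square to each of the N coordinates, because
  \<open>bracket\<close> dominates every \<open>1 + |\<xi> $ j|\<close>. This majorant turns
  polynomial decay into summability.\<close>

lemma summable_on_inverse_bracket:
  "(\<lambda>\<xi>::int^'n::finite. 1 / bracket \<xi> ^ (2 * CARD('n))) summable_on UNIV"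
proof (rule summable_on_comparison_test)
  show "(\<lambda>\<xi>::int^'n. \<Prod>j\<in>UNIV. 1 / (1 + \<bar>real_of_int (\<xi> $ j)\<bar>)\<^sup>2) summable_on UNIV"
    by (rule summable_on_prod_components[OF summable_on_int_inverse_square]) auto
  fix \<xi> :: "int^'n"
  have "1 / (bracket \<xi>)\<^sup>2 \<le> 1 / (1 + \<bar>real_of_int (\<xi> $ j)\<bar>)\<^sup>2" for j
  proof (rule divide_left_mono)
    show "(1 + \<bar>real_of_int (\<xi> $ j)\<bar>)\<^sup>2 \<le> (bracket \<xi>)\<^sup>2"
      using abs_component_le_norm_ivec[of \<xi> j] by (intro power_mono) (auto simp: bracket_def)
    have "0 < 1 + \<bar>real_of_int (\<xi> $ j)\<bar>" by linarith
    then show "0 < (bracket \<xi>)\<^sup>2 * (1 + \<bar>real_of_int (\<xi> $ j)\<bar>)\<^sup>2"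
      by (intro mult_pos_pos zero_less_power bracket_pos)
  qed simp
  then have "(\<Prod>j\<in>(UNIV::'n set). 1 / (bracket \<xi>)\<^sup>2) \<le> (\<Prod>j\<in>UNIV. 1 / (1 + \<bar>real_of_int (\<xi> $ j)\<bar>)\<^sup>2)"
    by (intro prod_mono) auto
  moreover have "(\<Prod>j\<in>(UNIV::'n set). 1 / (bracket \<xi>)\<^sup>2) = 1 / bracket \<xi> ^ (2 * CARD('n))"
    by (simp only: prod_constant power_one_over[symmetric] power_mult[symmetric])
  ultimately show "1 / bracket \<xi> ^ (2 * CARD('n)) \<le> (\<Prod>j\<in>UNIV. 1 / (1 + \<bar>real_of_int (\<xi> $ j)\<bar>)\<^sup>2)"
    by simp
qed (auto simp: less_imp_le)

lemma summable_on_bracket_decay: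
  fixes c :: "int^'n::finite \<Rightarrow> 'b::banach"
  assumes "\<And>\<xi>. norm (c \<xi>) * bracket \<xi> ^ (2 * CARD('n)) \<le> M"
  shows "(\<lambda>\<xi>. norm (c \<xi>)) summable_on UNIV"
proof (rule summable_on_comparison_test)
  show "(\<lambda>\<xi>::int^'n. M * (1 / bracket \<xi> ^ (2 * CARD('n)))) summable_on UNIV"
    by (rule summable_on_cmult_right[OF summable_on_inverse_bracket])
  show "norm (c \<xi>) \<le> M * (1 / bracket \<xi> ^ (2 * CARD('n)))" for \<xi>
    using assms[of \<xi>] by (subst times_divide_eq_right, subst pos_le_divide_eq) auto
qed auto

section \<open>The mean over the torus\<close>

abbreviation torus_box :: "(real^'n::finite) set" where
  "torus_box \<equiv> cbox 0 (\<chi> j. 2 * pi)"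

lemma torus_mean_add:
  assumes "continuous_on UNIV f" "continuous_on UNIV g"
  shows "torus_mean (\<lambda>x. f x + g x) = torus_mean f + torus_mean g"
  unfolding torus_mean_def
  by (subst integral_add) (auto intro!: integrable_continuous continuous_on_subset[OF assms(1)] continuous_on_subset[OF assms(2)] simp: add_divide_distrib)

lemma torus_mean_cmult: "torus_mean (\<lambda>x. c * f x) = c * torus_mean f"
  unfolding torus_mean_def by simp

lemma norm_torus_mean_le:
  fixes f :: "real^'n::finite \<Rightarrow> complex"
  assumes f: "continuous_on UNIV f" and le: "\<And>x. cmod (f x) \<le> M"
  shows "cmod (torus_mean f) \<le> M"
proof -
  have "M \<ge> 0" using le[of 0] norm_ge_zero order_trans by blast
  have c: "measure lborel (torus_box :: (real^'n) set) = (2 * pi) ^ CARD('n)"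
    by (subst content_cbox_cart) (auto simp: interval_ne_empty_cart(1))
  have "cmod (integral torus_box f) \<le> M * measure lborel (torus_box :: (real^'n) set)"
    by (rule integrable_bound[OF \<open>M \<ge> 0\<close>]) (auto intro!: le integrable_continuous continuous_on_subset[OF f])
  then show ?thesis
    unfolding torus_mean_def c by (simp add: norm_divide norm_power norm_mult pos_divide_le_eq)
qed

lemma torus_mean_const [simp]: "torus_mean (\<lambda>x::real^'n::finite. c) = c"
proof -
  have c: "measure lborel (torus_box :: (real^'n) set) = (2 * pi) ^ CARD('n)"
    by (subst content_cbox_cart) (auto simp: interval_ne_empty_cart(1))
  show ?thesis unfolding torus_mean_def by (simp add: c scaleR_conv_of_real)
qed

section \<open>Translation invariance of the mean and integration by parts\<close>

lemma periodic_axis: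
  fixes f :: "real^'n::finite \<Rightarrow> complex"
  assumes "periodic f"
  shows "f (x + (2 * pi) *\<^sub>R axis j 1) = f x"
proof -
  have "(axis j 1 :: real^'n) = ivec (axis j 1)"
    by (simp add: vec_eq_iff axis_def)
  show ?thesis unfolding \<open>axis j 1 = _\<close> using assms unfolding periodic_def by blast
qed

text \<open>A box shifted along one axis sticks out over the face at \<open>2 * pi\<close>; cutting
  there and moving the overhanging slab back by one period restores the original box.\<close>

lemma torus_mean_translate:
  fixes f :: "real^'n::finite \<Rightarrow> complex"
  assumes f: "continuous_on UNIV f" and per: "periodic f" and t: "0 \<le> t" "t \<le> 2 * pi"
  shows "torus_mean (\<lambda>x. f (x + t *\<^sub>R axis j 1)) = torus_mean f"
proof -
  define b :: "real^'n" where "b = (\<chi> j. 2 * pi)"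
  define e :: "real^'n" where "e = axis j 1"
  have int: "f integrable_on cbox u v" for u v
    by (auto intro!: integrable_continuous continuous_on_subset[OF f])
  have eB: "e \<in> Basis" by (auto simp: e_def axis_in_Basis_iff)
  have ie: "x \<bullet> e = x $ j" for x by (simp add: e_def inner_axis)
  note split = interval_split_cart[unfolded interval_cbox_cart]
  have en: "e $ i = (if i = j then 1 else 0)" for i by (simp add: e_def axis_def)
  have "integral (cbox 0 b) (\<lambda>x. f (x + t *\<^sub>R e)) = integral (cbox (t *\<^sub>R e) (b + t *\<^sub>R e)) f"
    using integral_shift_cbox[of "t *\<^sub>R e" "t *\<^sub>R e" "b + t *\<^sub>R e" f] by simp
  also have "\<dots> = integral (cbox (t *\<^sub>R e) (b + t *\<^sub>R e) \<inter> {x. x \<bullet> e \<le> 2 * pi}) f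
               + integral (cbox (t *\<^sub>R e) (b + t *\<^sub>R e) \<inter> {x. x \<bullet> e \<ge> 2 * pi}) f"
    by (rule integral_split[OF int eB])
  also have "cbox (t *\<^sub>R e) (b + t *\<^sub>R e) \<inter> {x. x \<bullet> e \<le> 2 * pi} = cbox (t *\<^sub>R e) b"
    unfolding ie split using t
    by (intro arg_cong2[where f = cbox]) (auto simp: vec_eq_iff en b_def)
  also have "cbox (t *\<^sub>R e) (b + t *\<^sub>R e) \<inter> {x. x \<bullet> e \<ge> 2 * pi}
           = cbox (0 + (2 * pi) *\<^sub>R e) (b + (t - 2 * pi) *\<^sub>R e + (2 * pi) *\<^sub>R e)"
    unfolding ie split using t
    by (intro arg_cong2[where f = cbox]) (auto simp: vec_eq_iff en b_def)
  also have "integral \<dots> f = integral (cbox 0 (b + (t - 2 * pi) *\<^sub>R e)) (\<lambda>x. f (x + (2 * pi) *\<^sub>R e))"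
    using integral_shift_cbox[of "0 + (2 * pi) *\<^sub>R e" "(2 * pi) *\<^sub>R e" "b + (t - 2 * pi) *\<^sub>R e + (2 * pi) *\<^sub>R e" f] by simp
  also have "(\<lambda>x. f (x + (2 * pi) *\<^sub>R e)) = f"
    using periodic_axis[OF per] by (auto simp: e_def)
  also have "cbox 0 (b + (t - 2 * pi) *\<^sub>R e) = cbox 0 b \<inter> {x. x \<bullet> e \<le> t}"
    unfolding ie split using t
    by (intro arg_cong2[where f = cbox]) (auto simp: vec_eq_iff en b_def)
  also have "cbox (t *\<^sub>R e) b = cbox 0 b \<inter> {x. x \<bullet> e \<ge> t}"
    unfolding ie split using t
    by (intro arg_cong2[where f = cbox]) (auto simp: vec_eq_iff en b_def)
  also have "integral (cbox 0 b \<inter> {x. x \<bullet> e \<ge> t}) f + integral (cbox 0 b \<inter> {x. x \<bullet> e \<le> t}) f = integral (cbox 0 b) f"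
    using integral_split[OF int[of 0 b] eB, of t] by simp
  finally show ?thesis unfolding torus_mean_def b_def e_def by simp
qed

text \<open>\<open>partial\<close> speaks of the derivative at parameter 0, so the derivative at
  \<open>s\<close> is the one at 0 for the shifted base point.\<close>

lemma directional_derivative_shift:
  fixes f :: "real^'n::finite \<Rightarrow> complex"
  assumes "\<And>x. ((\<lambda>t. f (x + t *\<^sub>R axis j 1)) has_vector_derivative f' x) (at 0)"
  shows "((\<lambda>t. f (x + t *\<^sub>R axis j 1)) has_vector_derivative f' (x + s *\<^sub>R axis j 1)) (at s within A)"
proof -
  let ?g = "\<lambda>t. f ((x + s *\<^sub>R axis j 1) + t *\<^sub>R axis j 1)"
  have "(?g has_vector_derivative f' (x + s *\<^sub>R axis j 1)) (at (s - s))"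
    using assms[of "x + s *\<^sub>R axis j 1"] by simp
  moreover have "((\<lambda>t. t - s) has_vector_derivative 1) (at s)"
    by (auto intro!: derivative_eq_intros)
  ultimately have "(?g \<circ> (\<lambda>t. t - s) has_vector_derivative 1 *\<^sub>R f' (x + s *\<^sub>R axis j 1)) (at s)"
    by (intro vector_diff_chain_at)
  then have "((\<lambda>t. f (x + t *\<^sub>R axis j 1)) has_vector_derivative f' (x + s *\<^sub>R axis j 1)) (at s)"
    by (simp add: o_def scaleR_left_diff_distrib add_ac)
  then show ?thesis by (rule has_vector_derivative_at_within)
qed

text \<open>The means of all translates agree, so differentiating under the integral at
  \<open>t = 0\<close> gives zero. Periodicity takes the place of boundary terms, and applied to a
  product this is integration by parts.\<close>

lemma torus_mean_directional_derivative:
  fixes f :: "real^'n::finite \<Rightarrow> complex"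
  assumes cf: "continuous_on UNIV f" and cp: "continuous_on UNIV f'" and per: "periodic f"
    and der: "\<And>x. ((\<lambda>t. f (x + t *\<^sub>R axis j 1)) has_vector_derivative f' x) (at 0)"
  shows "torus_mean f' = 0"
proof -
  let ?e = "axis j 1 :: real^'n"
  have "((\<lambda>t. integral torus_box (\<lambda>x. f (x + t *\<^sub>R ?e))) has_vector_derivative
      integral torus_box (\<lambda>x. f' (x + 0 *\<^sub>R ?e))) (at 0 within {0..2*pi})"
  proof (rule leibniz_rule_vector_derivative)
    show "continuous_on ({0..2*pi} \<times> torus_box) (\<lambda>(t, x). f' (x + t *\<^sub>R ?e))"
      unfolding split_def by (intro continuous_on_compose2[OF cp] continuous_intros) auto
    show "(\<lambda>x. f (x + t *\<^sub>R ?e)) integrable_on torus_box" for t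
      by (intro integrable_continuous continuous_on_compose2[OF cf] continuous_intros) auto
  qed (auto intro!: directional_derivative_shift[OF der])
  moreover have "integral torus_box (\<lambda>x. f (x + t *\<^sub>R ?e)) = integral torus_box f" if "t \<in> {0..2*pi}" for t
    using torus_mean_translate[OF cf per, of t j] that unfolding torus_mean_def by simp
  ultimately have "((\<lambda>t. integral torus_box f) has_vector_derivative
      integral torus_box f') (at 0 within {0..2*pi})"
    by (intro has_vector_derivative_transform[of 0 "{0..2*pi}" "\<lambda>t. integral torus_box f"]) auto
  moreover have "((\<lambda>t. integral torus_box f) has_vector_derivative 0) (at 0 within {0..2*pi})"
    by simp
  ultimately have "integral torus_box f' = 0"
    by (rule vector_derivative_unique_within[rotated]) (simp add: trivial_limit_within islimpt_Icc)
  then show ?thesis by (simp add: torus_mean_def)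
qed

section \<open>Fourier coefficients of test functions: derivatives and decay\<close>

lemma fourier_coeff_of_test:
  "fourier_coeff (of_test \<phi>) \<xi> = torus_mean (\<lambda>x. test_apply \<phi> x * exp (- \<i> * complex_of_real (x \<bullet> ivec \<xi>)))"
  by (simp add: fourier_coeff_def of_test.rep_eq test_exp.rep_eq)

lemma test_has_deriv:
  "((\<lambda>t. test_apply \<phi> (x + t *\<^sub>R axis j 1)) has_vector_derivative test_apply (test_deriv j \<phi>) x) (at 0)"
  using partial_works[of "test_apply \<phi>" "[]" x j] test_apply[of \<phi>] by (simp add: test_deriv.rep_eq)

lemma exp_inner_has_deriv:
  "((\<lambda>t. exp (\<i> * c * complex_of_real ((x + t *\<^sub>R axis j 1) \<bullet> y))) has_vector_derivative
     (\<i> * c * complex_of_real (y $ j)) * exp (\<i> * c * complex_of_real (x \<bullet> y))) (at 0)"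
proof -
  have *: "((\<lambda>t::real. exp (\<i> * c * (a + of_real t * b))) has_vector_derivative
      (\<i> * c * b) * exp (\<i> * c * a)) (at 0)" for a b :: complex
    by (rule has_vector_derivative_real_field) (auto intro!: derivative_eq_intros)
  show ?thesis
    using *[of "complex_of_real (x \<bullet> y)" "complex_of_real (y $ j)"]
    by (simp add: inner_add_left inner_axis')
qed

lemma periodic_test_apply: "periodic (test_apply \<phi>)"
  using test_apply[of \<phi>] by simp

lemma periodic_mult: "periodic f \<Longrightarrow> periodic g \<Longrightarrow> periodic (\<lambda>x. f x * g x)"
  by (simp add: periodic_def)

text \<open>Integration by parts: the derivative of \<open>\<phi>\<close> times the character has
  mean zero, and the product rule splits it into the two sides.\<close>

lemma fourier_coeff_of_test_deriv:
  "fourier_coeff (of_test (test_deriv j \<phi>)) \<xi> = \<i> * of_int (\<xi> $ j) * fourier_coeff (of_test \<phi>) \<xi>"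
proof -
  let ?e = "\<lambda>x. exp (- \<i> * complex_of_real (x \<bullet> ivec \<xi>))"
  let ?f1 = "\<lambda>x. test_apply (test_deriv j \<phi>) x * ?e x"
  let ?f2 = "\<lambda>x. (- \<i> * of_int (\<xi> $ j)) * (test_apply \<phi> x * ?e x)"
  have c: "continuous_on UNIV ?f1" "continuous_on UNIV ?f2" "continuous_on UNIV (\<lambda>x. test_apply \<phi> x * ?e x)"
    by (intro continuous_intros continuous_test_apply)+
  have "torus_mean (\<lambda>x. ?f1 x + ?f2 x) = 0"
  proof (rule torus_mean_directional_derivative)
    show "periodic (\<lambda>x. test_apply \<phi> x * ?e x)"
      by (intro periodic_mult periodic_test_apply periodic_exp)
    show "((\<lambda>t. test_apply \<phi> (x + t *\<^sub>R axis j 1) * ?e (x + t *\<^sub>R axis j 1)) has_vector_derivative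
        ?f1 x + ?f2 x) (at 0)" for x
      using has_vector_derivative_mult[OF test_has_deriv[of \<phi> x j] exp_inner_has_deriv[of "-1" x j "ivec \<xi>"]]
      by (simp add: algebra_simps)
  qed (intro c continuous_on_add)+
  then have "torus_mean ?f1 + (- \<i> * of_int (\<xi> $ j)) * torus_mean (\<lambda>x. test_apply \<phi> x * ?e x) = 0"
    unfolding torus_mean_add[OF c(1,2)] torus_mean_cmult .
  then show ?thesis unfolding fourier_coeff_of_test by (simp add: algebra_simps)
qed

definition derivative_symbol :: "'n list \<Rightarrow> int^'n::finite \<Rightarrow> complex" where
  "derivative_symbol js \<xi> = (\<Prod>j\<leftarrow>js. \<i> * of_int (\<xi> $ j))"

lemma derivative_symbol_simps [simp]:
  "derivative_symbol [] \<xi> = 1"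
  "derivative_symbol (j # js) \<xi> = \<i> * of_int (\<xi> $ j) * derivative_symbol js \<xi>"
  by (auto simp: derivative_symbol_def)

lemma norm_derivative_symbol_le: "cmod (derivative_symbol js \<xi>) \<le> norm (ivec \<xi>) ^ length js"
  using abs_component_le_norm_ivec[of \<xi>]
  by (induction js) (auto simp: norm_mult intro!: mult_mono)

lemma norm_derivative_symbol_le_bracket:
  assumes "length js \<le> m"
  shows "cmod (derivative_symbol js \<xi>) \<le> bracket \<xi> ^ m"
proof -
  have "norm (ivec \<xi>) ^ length js \<le> bracket \<xi> ^ length js"
    by (intro power_mono) (auto simp: bracket_def)
  also have "\<dots> \<le> bracket \<xi> ^ m"
    by (intro power_increasing assms bracket_ge_1)
  finally show ?thesis using norm_derivative_symbol_le[of js \<xi>] by linarith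
qed

lemma fourier_coeff_of_test_derivs:
  "fourier_coeff (of_test (foldr test_deriv js \<phi>)) \<xi> = derivative_symbol js \<xi> * fourier_coeff (of_test \<phi>) \<xi>"
  by (induction js) (auto simp: fourier_coeff_of_test_deriv)

lemma derivative_symbol_replicate:
  "cmod (derivative_symbol (replicate m j) \<xi>) = \<bar>real_of_int (\<xi> $ j)\<bar> ^ m"
  by (induction m) (auto simp: norm_mult)

lemma norm_fourier_coeff_of_test_le:
  assumes "\<And>x. cmod (test_apply \<phi> x) \<le> M"
  shows "cmod (fourier_coeff (of_test \<phi>) \<xi>) \<le> M"
  unfolding fourier_coeff_of_test
proof (rule norm_torus_mean_le)
  show "cmod (test_apply \<phi> x * exp (- \<i> * complex_of_real (x \<bullet> ivec \<xi>))) \<le> M" for x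
    using assms[of x] by (simp add: norm_mult)
qed (intro continuous_intros continuous_test_apply)

text \<open>Differentiating \<open>k\<close> times along the largest coordinate of
  \<open>\<xi>\<close> gains its \<open>k\<close>-th power, and \<open>norm (ivec \<xi>)\<close> is
  at most N times that coordinate. The bound is linear in \<open>M\<close> with a factor depending
  on \<open>k\<close> and N only, as the continuity of \<open>fourier_distr\<close>
  requires.\<close>

lemma fourier_coeff_of_test_decay:
  fixes \<phi> :: "'n::finite torus_test"
  assumes M: "\<And>js x. length js \<le> k \<Longrightarrow> cmod (test_apply (foldr test_deriv js \<phi>) x) \<le> M"
  shows "cmod (fourier_coeff (of_test \<phi>) \<xi>) * bracket \<xi> ^ k \<le> (1 + real CARD('n)) ^ k * M"
proof -
  define m where "m = Max (range (\<lambda>j. \<bar>real_of_int (\<xi> $ j)\<bar>))"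
  have "m \<in> range (\<lambda>j. \<bar>real_of_int (\<xi> $ j)\<bar>)" unfolding m_def by (intro Max_in) auto
  then obtain j where j: "m = \<bar>real_of_int (\<xi> $ j)\<bar>" by blast
  have le: "\<bar>real_of_int (\<xi> $ i)\<bar> \<le> m" for i unfolding m_def by (intro Max_ge) auto
  have "norm (ivec \<xi>) \<le> (\<Sum>i\<in>(UNIV::'n set). m)"
    using norm_ivec_le_sum[of \<xi>] sum_mono[of UNIV "\<lambda>i. \<bar>real_of_int (\<xi> $ i)\<bar>" "\<lambda>i. m"] le by fastforce
  then have br: "bracket \<xi> \<le> 1 + real CARD('n) * m" by (simp add: bracket_def)
  have f0: "cmod (fourier_coeff (of_test \<phi>) \<xi>) \<le> M"
    using M[of "[]"] by (intro norm_fourier_coeff_of_test_le) auto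
  then have M0: "M \<ge> 0" using norm_ge_zero order_trans by blast
  show ?thesis
  proof (cases "m = 0")
    case True
    then have "bracket \<xi> = 1" using br bracket_ge_1[of \<xi>] by simp
    moreover have "1 * M \<le> (1 + real CARD('n)) ^ k * M"
      by (intro mult_right_mono one_le_power M0) auto
    ultimately show ?thesis using f0 by simp
  next
    case False
    \<comment> \<open>A nonzero integer has modulus at least 1, which absorbs the summand 1 of
      \<open>bracket\<close>.\<close>
    then have "m \<ge> 1" using j by (cases "\<xi> $ j = 0") (auto simp: abs_if)
    then have "bracket \<xi> \<le> (1 + real CARD('n)) * m" using br by (simp add: distrib_right)
    then have "bracket \<xi> ^ k \<le> ((1 + real CARD('n)) * m) ^ k" by (intro power_mono) (auto simp: less_imp_le)
    then have "cmod (fourier_coeff (of_test \<phi>) \<xi>) * bracket \<xi> ^ k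
        \<le> cmod (fourier_coeff (of_test \<phi>) \<xi>) * ((1 + real CARD('n)) * m) ^ k"
      by (intro mult_left_mono) auto
    also have "\<dots> = (1 + real CARD('n)) ^ k * cmod (fourier_coeff (of_test (foldr test_deriv (replicate k j) \<phi>)) \<xi>)"
      by (simp only: fourier_coeff_of_test_derivs norm_mult derivative_symbol_replicate j power_mult_distrib mult_ac)
    also have "\<dots> \<le> (1 + real CARD('n)) ^ k * M"
      by (intro mult_left_mono norm_fourier_coeff_of_test_le M) auto
    finally show ?thesis .
  qed
qed

lemma translate_into_torus_box:
  fixes x :: "real^'n::finite"
  obtains k where "x + (2 * pi) *\<^sub>R ivec k \<in> torus_box"
proof
  let ?k = "\<chi> j. - \<lfloor>x $ j / (2 * pi)\<rfloor>"
  have "0 \<le> x $ j - 2 * pi * of_int \<lfloor>x $ j / (2 * pi)\<rfloor>" "x $ j - 2 * pi * of_int \<lfloor>x $ j / (2 * pi)\<rfloor> \<le> 2 * pi" for j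
  proof -
    have "of_int \<lfloor>x $ j / (2 * pi)\<rfloor> \<le> x $ j / (2 * pi)" "x $ j / (2 * pi) \<le> of_int \<lfloor>x $ j / (2 * pi)\<rfloor> + 1"
      by linarith+
    then have "of_int \<lfloor>x $ j / (2 * pi)\<rfloor> * (2 * pi) \<le> x $ j" "x $ j \<le> (of_int \<lfloor>x $ j / (2 * pi)\<rfloor> + 1) * (2 * pi)"
      by (simp_all only: pos_le_divide_eq pos_divide_le_eq pi_gt_zero zero_less_mult_iff zero_less_numeral simp_thms)
    then show "0 \<le> x $ j - 2 * pi * of_int \<lfloor>x $ j / (2 * pi)\<rfloor>" "x $ j - 2 * pi * of_int \<lfloor>x $ j / (2 * pi)\<rfloor> \<le> 2 * pi"
      by (simp_all add: algebra_simps)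
  qed
  then show "x + (2 * pi) *\<^sub>R ivec ?k \<in> torus_box"
    by (simp add: mem_box_cart)
qed

lemma periodic_bounded:
  fixes f :: "real^'n::finite \<Rightarrow> complex"
  assumes f: "continuous_on UNIV f" and per: "periodic f"
  shows "\<exists>M. \<forall>x. cmod (f x) \<le> M"
proof -
  have "compact (f ` torus_box)"
    by (intro compact_continuous_image compact_cbox continuous_on_subset[OF f]) auto
  then obtain M where M: "\<And>y. y \<in> f ` torus_box \<Longrightarrow> cmod y \<le> M"
    using compact_imp_bounded bounded_iff by metis
  have "cmod (f x) \<le> M" for x
  proof -
    obtain k where "x + (2 * pi) *\<^sub>R ivec k \<in> torus_box" by (rule translate_into_torus_box)
    then show ?thesis using M per unfolding periodic_def by (metis imageI)
  qed
  then show ?thesis by blast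
qed

lemma test_derivs_bounded:
  fixes \<phi> :: "'n::finite torus_test"
  shows "\<exists>M. \<forall>js x. length js \<le> k \<longrightarrow> cmod (test_apply (foldr test_deriv js \<phi>) x) \<le> M"
proof -
  have "\<exists>M. \<forall>x. cmod (test_apply (foldr test_deriv js \<phi>) x) \<le> M" for js
    by (rule periodic_bounded[OF continuous_test_apply periodic_test_apply])
  then obtain M where M: "\<And>js x. cmod (test_apply (foldr test_deriv js \<phi>) x) \<le> M js" by metis
  have fin: "finite {js :: 'n list. length js \<le> k}"
    using finite_lists_length_le[of "UNIV :: 'n set" k] by simp
  show ?thesis
  proof (intro exI allI impI)
    fix js :: "'n list" and x
    assume "length js \<le> k"
    then have "M js \<le> Max (M ` {js. length js \<le> k})" using fin by (intro Max_ge) auto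
    then show "cmod (test_apply (foldr test_deriv js \<phi>) x) \<le> Max (M ` {js. length js \<le> k})"
      using M[of js x] by linarith
  qed
qed

section \<open>Uniqueness of Fourier coefficients\<close>

text \<open>The powers \<open>p\<^sup>n\<close> concentrate where \<open>p = 1\<close>, and there \<open>h\<close> is positive.\<close>

lemma power_kernel_concentration:
  fixes h p :: "'a::euclidean_space \<Rightarrow> real"
  assumes h: "continuous_on UNIV h" and p: "continuous_on UNIV p"
    and p01: "\<And>x. 0 \<le> p x" "\<And>x. p x \<le> 1"
    and a: "a \<in> box u v" "p a = 1"
    and pos: "\<And>x. x \<in> cbox u v \<Longrightarrow> p x = 1 \<Longrightarrow> h x > \<epsilon>" and "\<epsilon> > 0"
    and int: "\<And>n. integral (cbox u v) (\<lambda>x. h x * p x ^ n) = 0"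
  shows False
proof -
  define K where "K = {x \<in> cbox u v. h x \<le> \<epsilon>}"
  have "compact K"
  proof -
    have "closed {x. h x \<le> \<epsilon>}" by (intro closed_Collect_le h continuous_on_const)
    moreover have "K = cbox u v \<inter> {x. h x \<le> \<epsilon>}" by (auto simp: K_def)
    ultimately show ?thesis by (simp add: compact_Int_closed)
  qed
  \<comment> \<open>On the compact set where \<open>h\<close> is small, \<open>p\<close> stays
    uniformly below 1.\<close>
  have "\<exists>\<rho>. 0 \<le> \<rho> \<and> \<rho> < 1 \<and> (\<forall>x\<in>K. p x \<le> \<rho>)"
  proof (cases "K = {}")
    case False
    obtain y where y: "y \<in> K" "\<And>x. x \<in> K \<Longrightarrow> p x \<le> p y"
      using continuous_attains_sup[OF \<open>compact K\<close> False continuous_on_subset[OF p]] by auto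
    have "p y \<noteq> 1" using pos[of y] y(1) by (auto simp: K_def)
    then show ?thesis using y p01[of y] by (intro exI[of _ "p y"]) auto
  qed auto
  then obtain \<rho> where \<rho>: "0 \<le> \<rho>" "\<rho> < 1" "\<And>x. x \<in> K \<Longrightarrow> p x \<le> \<rho>" by blast
  \<comment> \<open>A level strictly between \<open>\<rho>\<close> and 1: \<open>p\<close> exceeds
    it on a box around \<open>a\<close>, so the positive part of the integral is at least of order
    \<open>\<sigma> ^ n\<close>, while the part over \<open>K\<close> is at most of order
    \<open>\<rho> ^ n\<close>.\<close>
  define \<sigma> where "\<sigma> = (1 + \<rho>) / 2"
  have \<sigma>: "\<rho> < \<sigma>" "\<sigma> < 1" "0 < \<sigma>" using \<rho> by (auto simp: \<sigma>_def)
  have "open (box u v \<inter> {x. \<sigma> < p x})"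
    by (intro open_Int open_box open_Collect_less p continuous_on_const)
  moreover have "a \<in> box u v \<inter> {x. \<sigma> < p x}" using a \<sigma> by auto
  ultimately obtain c d where cd: "cbox c d \<subseteq> box u v \<inter> {x. \<sigma> < p x}" "a \<in> box c d"
    by (metis open_contains_cbox)
  have "measure lborel (cbox c d) > 0"
    using cd(2) by (metis box_ne_empty(2) content_pos_lt_eq empty_iff)
  have "compact (h ` cbox u v)"
    by (intro compact_continuous_image compact_cbox continuous_on_subset[OF h]) auto
  then obtain M where M: "\<And>y. y \<in> h ` cbox u v \<Longrightarrow> \<bar>y\<bar> \<le> M"
    using compact_imp_bounded bounded_iff by (metis real_norm_def)
  have M0: "M \<ge> 0" using M[of "h a"] a(1) box_subset_cbox[of u v] by force
  have ineq: "\<epsilon> * measure lborel (cbox c d) \<le> M * measure lborel (cbox u v) * (\<rho> / \<sigma>) ^ n" for n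
  proof -
    have ptw: "(if x \<in> cbox c d then \<epsilon> * \<sigma> ^ n else 0) - M * \<rho> ^ n \<le> h x * p x ^ n" if x: "x \<in> cbox u v" for x
    proof (cases "x \<in> K")
      case True
      then have "x \<notin> cbox c d" using \<rho>(3)[OF True] cd(1) \<sigma>(1) by force
      have "- (h x * p x ^ n) \<le> M * \<rho> ^ n"
      proof -
        have "\<bar>h x * p x ^ n\<bar> \<le> M * \<rho> ^ n"
          unfolding abs_mult using M[of "h x"] x p01[of x] \<rho>(3)[OF True] M0
          by (intro mult_mono) (auto simp: power_abs intro: power_mono)
        then show ?thesis by linarith
      qed
      then show ?thesis using \<open>x \<notin> cbox c d\<close> by simp
    next
      case False
      then have hx: "h x > \<epsilon>" using x by (simp add: K_def)
      have "(if x \<in> cbox c d then \<epsilon> * \<sigma> ^ n else 0) \<le> h x * p x ^ n"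
      proof (cases "x \<in> cbox c d")
        case True
        then have "\<sigma> \<le> p x" using cd(1) by force
        then show ?thesis using True hx \<open>\<epsilon> > 0\<close> \<sigma> by (auto intro!: mult_mono power_mono)
      next
        case False
        then show ?thesis using hx \<open>\<epsilon> > 0\<close> p01[of x] by simp
      qed
      moreover have "M * \<rho> ^ n \<ge> 0" using M0 \<rho> by simp
      ultimately show ?thesis by linarith
    qed
    have sub: "cbox c d \<subseteq> cbox u v" using cd(1) box_subset_cbox[of u v] by blast
    have "((\<lambda>x. \<epsilon> * \<sigma> ^ n) has_integral measure lborel (cbox c d) *\<^sub>R (\<epsilon> * \<sigma> ^ n)) (cbox c d)"
      by (rule has_integral_const)
    then have i1: "((\<lambda>x. if x \<in> cbox c d then \<epsilon> * \<sigma> ^ n else 0) has_integral measure lborel (cbox c d) *\<^sub>R (\<epsilon> * \<sigma> ^ n)) (cbox u v)"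
      using has_integral_restrict[OF sub, of "\<lambda>x. \<epsilon> * \<sigma> ^ n"] by simp
    have i2: "((\<lambda>x. (if x \<in> cbox c d then \<epsilon> * \<sigma> ^ n else 0) - M * \<rho> ^ n) has_integral
        measure lborel (cbox c d) *\<^sub>R (\<epsilon> * \<sigma> ^ n) - measure lborel (cbox u v) *\<^sub>R (M * \<rho> ^ n)) (cbox u v)"
      by (intro has_integral_diff i1 has_integral_const)
    have i3: "((\<lambda>x. h x * p x ^ n) has_integral 0) (cbox u v)"
    proof -
      have "(\<lambda>x. h x * p x ^ n) integrable_on cbox u v"
        by (intro integrable_continuous continuous_intros continuous_on_subset[OF h] continuous_on_subset[OF p]) auto
      then show ?thesis using int[of n] by (metis integrable_integral)
    qed
    have "measure lborel (cbox c d) * (\<epsilon> * \<sigma> ^ n) - measure lborel (cbox u v) * (M * \<rho> ^ n) \<le> 0"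
      using has_integral_le[OF i2 i3 ptw] by simp
    then have "\<epsilon> * measure lborel (cbox c d) \<le> M * measure lborel (cbox u v) * (\<rho> ^ n / \<sigma> ^ n)"
      using \<sigma>(3) by (simp add: field_simps)
    then show ?thesis by (simp add: power_divide)
  qed
  have "(\<lambda>n. M * measure lborel (cbox u v) * (\<rho> / \<sigma>) ^ n) \<longlonglongrightarrow> M * measure lborel (cbox u v) * 0"
    using \<rho> \<sigma> by (intro tendsto_intros LIMSEQ_realpow_zero) auto
  then have "\<epsilon> * measure lborel (cbox c d) \<le> M * measure lborel (cbox u v) * 0"
    by (rule LIMSEQ_le_const) (use ineq in blast)
  then show False using \<open>measure lborel (cbox c d) > 0\<close> \<open>\<epsilon> > 0\<close> by (simp add: mult_le_0_iff)
qed

section \<open>Completeness of the characters on continuous periodic functions\<close>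

inductive trig_poly :: "(real^'n::finite \<Rightarrow> complex) \<Rightarrow> bool" where
  trig_poly_char: "trig_poly (\<lambda>x. c * exp (- \<i> * complex_of_real (x \<bullet> ivec \<xi>)))"
| trig_poly_add: "trig_poly p \<Longrightarrow> trig_poly q \<Longrightarrow> trig_poly (\<lambda>x. p x + q x)"

lemma trig_poly_continuous: "trig_poly p \<Longrightarrow> continuous_on S p"
  by (induction rule: trig_poly.induct) (auto intro!: continuous_intros)

lemma trig_poly_mult_char:
  "trig_poly p \<Longrightarrow> trig_poly (\<lambda>x. c * exp (- \<i> * complex_of_real (x \<bullet> ivec \<xi>)) * p x)"
proof (induction rule: trig_poly.induct)
  case (trig_poly_char d \<eta>)
  have "(\<lambda>x. c * exp (- \<i> * complex_of_real (x \<bullet> ivec \<xi>)) * (d * exp (- \<i> * complex_of_real (x \<bullet> ivec \<eta>))))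
      = (\<lambda>x. (c * d) * exp (- \<i> * complex_of_real (x \<bullet> ivec (\<xi> + \<eta>))))"
  proof
    fix x
    have "ivec (\<xi> + \<eta>) = ivec \<xi> + ivec \<eta>" by (simp add: vec_eq_iff)
    then show "c * exp (- \<i> * complex_of_real (x \<bullet> ivec \<xi>)) * (d * exp (- \<i> * complex_of_real (x \<bullet> ivec \<eta>)))
        = (c * d) * exp (- \<i> * complex_of_real (x \<bullet> ivec (\<xi> + \<eta>)))"
      by (simp add: inner_add_right exp_add[symmetric] algebra_simps)
  qed
  then show ?case using trig_poly.trig_poly_char[of "c * d" "\<xi> + \<eta>"] by simp
next
  case (trig_poly_add p q)
  then show ?case using trig_poly.trig_poly_add by (fastforce simp: distrib_left)
qed

lemma trig_poly_mult: "trig_poly p \<Longrightarrow> trig_poly q \<Longrightarrow> trig_poly (\<lambda>x. p x * q x)"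
proof (induction rule: trig_poly.induct)
  case (trig_poly_add p p')
  then show ?case using trig_poly.trig_poly_add by (fastforce simp: distrib_right)
qed (rule trig_poly_mult_char)

lemma trig_poly_const: "trig_poly (\<lambda>x. c)"
  using trig_poly_char[of c 0] by simp

lemma trig_poly_prod: "finite A \<Longrightarrow> (\<And>j. j \<in> A \<Longrightarrow> trig_poly (p j)) \<Longrightarrow> trig_poly (\<lambda>x. \<Prod>j\<in>A. p j x)"
  by (induction rule: finite_induct) (auto intro: trig_poly_const trig_poly_mult)

lemma trig_poly_power: "trig_poly p \<Longrightarrow> trig_poly (\<lambda>x. p x ^ n)"
  by (induction n) (auto intro: trig_poly_const trig_poly_mult)

text \<open>The factor \<open>(1 + cos) / 2\<close> takes values in the unit interval and equals 1
  exactly at the translates of \<open>b\<close> by full periods, so products of such factors serve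
  as concentrating kernels.\<close>

lemma trig_poly_cos:
  fixes j :: "'n::finite"
  shows "trig_poly (\<lambda>x. complex_of_real ((1 + cos (x $ j - b)) / 2))"
proof -
  have "(ivec (axis j 1) :: real^'n) = axis j 1" by (simp add: vec_eq_iff axis_def)
  then have ax: "x \<bullet> ivec (axis j 1) = x $ j" "x \<bullet> ivec (- axis j 1) = - x $ j" for x :: "real^'n"
    by (simp_all add: inner_axis ivec_minus)
  have cos: "complex_of_real ((1 + cos (y - b)) / 2) =
      1 / 2 + (exp (\<i> * b) / 4 * exp (- \<i> * complex_of_real y) + exp (- \<i> * b) / 4 * exp (- \<i> * complex_of_real (- y)))" for y
  proof -
    have "complex_of_real (cos (y - b)) = (exp (\<i> * complex_of_real (y - b)) + exp (- (\<i> * complex_of_real (y - b)))) / 2"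
      by (simp only: cos_of_real[symmetric] cos_exp_eq)
    moreover have "exp (\<i> * complex_of_real (y - b)) = exp (- \<i> * b) * exp (- \<i> * complex_of_real (- y))"
      "exp (- (\<i> * complex_of_real (y - b))) = exp (\<i> * b) * exp (- \<i> * complex_of_real y)"
      unfolding exp_add[symmetric] by (simp_all add: algebra_simps)
    ultimately show ?thesis by (simp add: add_divide_distrib)
  qed
  have "trig_poly (\<lambda>x::real^'n. 1 / 2 + (exp (\<i> * b) / 4 * exp (- \<i> * complex_of_real (x \<bullet> ivec (axis j 1)))
      + exp (- \<i> * b) / 4 * exp (- \<i> * complex_of_real (x \<bullet> ivec (- axis j 1)))))"
    by (intro trig_poly_add trig_poly_char trig_poly_const)
  then show ?thesis unfolding cos ax .
qed

lemma torus_mean_trig_poly_eq_0: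
  assumes f: "continuous_on UNIV f"
    and 0: "\<And>\<xi>. torus_mean (\<lambda>x. f x * exp (- \<i> * complex_of_real (x \<bullet> ivec \<xi>))) = 0"
  shows "trig_poly p \<Longrightarrow> torus_mean (\<lambda>x. f x * p x) = 0"
proof (induction rule: trig_poly.induct)
  case (trig_poly_char c \<xi>)
  then show ?case using 0[of \<xi>] torus_mean_cmult[of c "\<lambda>x. f x * exp (- \<i> * complex_of_real (x \<bullet> ivec \<xi>))"]
    by (simp add: mult.left_commute)
next
  case (trig_poly_add p q)
  then show ?case
    using torus_mean_add[of "\<lambda>x. f x * p x" "\<lambda>x. f x * q x"]
    by (simp add: distrib_left continuous_on_mult f trig_poly_continuous)
qed

text \<open>If \<open>f a\<close> is nonzero, the powers of a product of cosine factors centred at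
  \<open>a\<close> are trigonometric polynomials that concentrate on the translates of
  \<open>a\<close>, where periodicity makes \<open>f\<close> equal to \<open>f a\<close>. Their
  integrals against \<open>f\<close> vanish by hypothesis, which contradicts the
  concentration.\<close>

lemma fourier_uniqueness:
  fixes f :: "real^'n::finite \<Rightarrow> complex"
  assumes f: "continuous_on UNIV f" and per: "periodic f"
    and 0: "\<And>\<xi>. torus_mean (\<lambda>x. f x * exp (- \<i> * complex_of_real (x \<bullet> ivec \<xi>))) = 0"
  shows "f x = 0"
proof -
  let ?u = "0 :: real^'n" and ?v = "(\<chi> j. 2 * pi) :: real^'n"
  have inner: "f a = 0" if a: "a \<in> box ?u ?v" for a
  proof (rule ccontr)
    assume "f a \<noteq> 0"
    define p where "p x = (\<Prod>j\<in>UNIV. (1 + cos (x $ j - a $ j)) / 2)" for x :: "real^'n"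
    \<comment> \<open>Rotating by \<open>cnj (f a)\<close> turns the value at \<open>a\<close> into
      the positive number \<open>|f a|^2\<close> and makes the integrand real.\<close>
    define h where "h x = Re (cnj (f a) * f x)" for x
    have fac: "0 \<le> (1 + cos (y::real)) / 2" "(1 + cos y) / 2 \<le> 1" for y
      using cos_ge_minus_one[of y] cos_le_one[of y] by (simp_all del: cos_le_one cos_ge_minus_one)
    show False
    proof (rule power_kernel_concentration[of h p a ?u ?v "(cmod (f a))\<^sup>2 / 2"])
      show ch: "continuous_on UNIV h" unfolding h_def by (intro continuous_intros f)
      show cp: "continuous_on UNIV p" unfolding p_def by (intro continuous_intros) simp_all
      show "0 \<le> p x" for x unfolding p_def by (intro prod_nonneg ballI fac)
      show "p x \<le> 1" for x unfolding p_def by (intro prod_le_1 fac conjI)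
      show "a \<in> box ?u ?v" by (rule that)
      show "p a = 1" by (simp add: p_def)
      show "(cmod (f a))\<^sup>2 / 2 > 0" using \<open>f a \<noteq> 0\<close> by simp
      show "h x > (cmod (f a))\<^sup>2 / 2" if "p x = 1" for x
      proof -
        \<comment> \<open>A product of numbers in the unit interval is at most each of its factors,
          so every cosine equals 1 and \<open>x\<close> differs from \<open>a\<close> by full
          periods.\<close>
        have "cos (x $ j - a $ j) = 1" for j
        proof -
          have "p x = (1 + cos (x $ j - a $ j)) / 2 * (\<Prod>j\<in>UNIV - {j}. (1 + cos (x $ j - a $ j)) / 2)"
            unfolding p_def by (subst prod.remove[of _ j]) auto
          also have "\<dots> \<le> (1 + cos (x $ j - a $ j)) / 2 * 1"
            by (intro mult_left_mono prod_le_1 conjI fac)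
          finally show ?thesis using that cos_le_one[of "x $ j - a $ j"] by simp
        qed
        then have "\<exists>k::int. x $ j - a $ j = of_int k * 2 * pi" for j
          by (simp add: cos_one_2pi_int)
        then obtain k where "\<And>j. x $ j - a $ j = of_int (k j) * 2 * pi" by metis
        then have "x = a + (2 * pi) *\<^sub>R ivec (\<chi> j. k j)" by (simp add: vec_eq_iff algebra_simps)
        then have "f x = f a" using per by (simp add: periodic_def)
        then have "h x = (cmod (f a))\<^sup>2"
          by (simp add: h_def cmod_def power2_eq_square[symmetric])
        then show ?thesis using \<open>f a \<noteq> 0\<close> by simp
      qed
      show "integral torus_box (\<lambda>x. h x * p x ^ n) = 0" for n
      proof -
        have "trig_poly (\<lambda>x. (\<Prod>j\<in>UNIV. complex_of_real ((1 + cos (x $ j - a $ j)) / 2)) ^ n)"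
          by (intro trig_poly_power trig_poly_prod trig_poly_cos) auto
        then have "torus_mean (\<lambda>x. f x * complex_of_real (p x) ^ n) = 0"
          using torus_mean_trig_poly_eq_0[OF f 0] by (simp add: p_def)
        then have i0: "integral torus_box (\<lambda>x. f x * complex_of_real (p x) ^ n) = 0"
          by (simp add: torus_mean_def)
        have int: "(\<lambda>x. f x * complex_of_real (p x) ^ n) integrable_on torus_box"
          by (intro integrable_continuous continuous_intros continuous_on_subset[OF f] continuous_on_subset[OF cp]) auto
        have "bounded_linear (\<lambda>z. Re (cnj (f a) * z))"
          by (intro bounded_linear_compose[OF bounded_linear_Re] bounded_linear_mult_right)
        from integral_linear[OF int this] i0
        have "integral torus_box (\<lambda>x. Re (cnj (f a) * (f x * complex_of_real (p x) ^ n))) = 0"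
          by (simp add: o_def)
        moreover have "Re (cnj (f a) * (f x * complex_of_real (p x) ^ n)) = h x * p x ^ n" for x
          unfolding h_def by (simp add: mult.assoc[symmetric] of_real_power[symmetric] del: of_real_power)
        ultimately show ?thesis by simp
      qed
    qed
  qed
  \<comment> \<open>The kernel argument concerns interior points; the boundary of the box follows by
    continuity and all other points by periodicity.\<close>
  have "box ?u ?v \<noteq> {}" by (simp add: interval_ne_empty_cart(2))
  then have cl: "closure (box ?u ?v) = torus_box" by (rule closure_box)
  have "f y = 0" if "y \<in> torus_box" for y
    using continuous_constant_on_closure[of "box ?u ?v" f 0 y] inner that
    unfolding cl by (blast intro: continuous_on_subset[OF f])
  moreover obtain k where "x + (2 * pi) *\<^sub>R ivec k \<in> torus_box" by (rule translate_into_torus_box)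
  ultimately show ?thesis using per unfolding periodic_def by metis
qed

section \<open>Fourier series of test functions\<close>

lemma summable_on_diff:
  fixes f g :: "'a \<Rightarrow> 'b::real_normed_vector"
  assumes "f summable_on A" "g summable_on A"
  shows "(\<lambda>x. f x - g x) summable_on A"
  using summable_on_add[OF assms(1) summable_on_uminus[THEN iffD2, OF assms(2)]] by simp

lemma infsum_diff:
  fixes f g :: "'a \<Rightarrow> 'b::real_normed_vector"
  assumes "f summable_on A" "g summable_on A"
  shows "infsum (\<lambda>x. f x - g x) A = infsum f A - infsum g A"
  using infsum_add[OF assms(1) summable_on_uminus[THEN iffD2, OF assms(2)]] by (simp add: infsum_uminus)

text \<open>Weighted absolute summability instead of decay: it directly gives the convergence of the
  series and of all its derivatives, and it is stable under polynomial factors.\<close>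

definition rapid :: "(int^'n::finite \<Rightarrow> complex) \<Rightarrow> bool" where
  "rapid c \<longleftrightarrow> (\<forall>k. (\<lambda>\<xi>. cmod (c \<xi>) * bracket \<xi> ^ k) summable_on UNIV)"

definition fourier_sum :: "(int^'n::finite \<Rightarrow> complex) \<Rightarrow> real^'n \<Rightarrow> complex" where
  "fourier_sum c x = (\<Sum>\<^sub>\<infinity>\<xi>. c \<xi> * exp (\<i> * complex_of_real (x \<bullet> ivec \<xi>)))"

lemma rapidD: "rapid c \<Longrightarrow> (\<lambda>\<xi>. cmod (c \<xi>) * bracket \<xi> ^ k) summable_on UNIV"
  by (simp add: rapid_def)

lemma rapid_le:
  assumes "rapid c" and le: "\<And>\<xi>. cmod (d \<xi>) \<le> cmod (c \<xi>) * bracket \<xi> ^ m"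
  shows "rapid d"
  unfolding rapid_def
proof
  fix k
  show "(\<lambda>\<xi>. cmod (d \<xi>) * bracket \<xi> ^ k) summable_on UNIV"
  proof (rule summable_on_comparison_test[OF rapidD[OF assms(1), of "m + k"]])
    show "cmod (d \<xi>) * bracket \<xi> ^ k \<le> cmod (c \<xi>) * bracket \<xi> ^ (m + k)" for \<xi>
      using mult_right_mono[OF le, of "bracket \<xi> ^ k" \<xi>] by (simp add: power_add mult_ac less_imp_le)
  qed (simp add: less_imp_le)
qed

lemma rapid_derivative_symbol: "rapid c \<Longrightarrow> rapid (\<lambda>\<xi>. derivative_symbol js \<xi> * c \<xi>)"
proof (rule rapid_le)
  show "cmod (derivative_symbol js \<xi> * c \<xi>) \<le> cmod (c \<xi>) * bracket \<xi> ^ length js" for \<xi>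
    using mult_right_mono[OF norm_derivative_symbol_le_bracket[of js "length js" \<xi>], of "cmod (c \<xi>)"]
    by (simp add: norm_mult mult_ac)
qed

lemma rapid_add:
  assumes "rapid c" "rapid d"
  shows "rapid (\<lambda>\<xi>. c \<xi> + d \<xi>)"
  unfolding rapid_def
proof
  fix k
  show "(\<lambda>\<xi>. cmod (c \<xi> + d \<xi>) * bracket \<xi> ^ k) summable_on UNIV"
  proof (rule summable_on_comparison_test[OF summable_on_add[OF rapidD[OF assms(1), of k] rapidD[OF assms(2), of k]]])
    show "cmod (c \<xi> + d \<xi>) * bracket \<xi> ^ k \<le> cmod (c \<xi>) * bracket \<xi> ^ k + cmod (d \<xi>) * bracket \<xi> ^ k" for \<xi>
      using mult_right_mono[OF norm_triangle_ineq[of "c \<xi>" "d \<xi>"], of "bracket \<xi> ^ k"]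
      by (simp add: distrib_right less_imp_le)
  qed (simp add: less_imp_le)
qed

lemma rapid_restrict: "rapid c \<Longrightarrow> rapid (\<lambda>\<xi>. if P \<xi> then c \<xi> else 0)"
  by (erule rapid_le[where m = 0]) auto

lemma rapid_norm_summable: "rapid c \<Longrightarrow> (\<lambda>\<xi>. cmod (c \<xi>)) summable_on UNIV"
  using rapidD[of c 0] by simp

lemma fourier_sum_abs_summable:
  "rapid c \<Longrightarrow> (\<lambda>\<xi>. cmod (c \<xi> * exp (\<i> * complex_of_real (x \<bullet> ivec \<xi>)))) summable_on UNIV"
  using rapid_norm_summable[of c] by (simp add: norm_mult)

lemma fourier_sum_summable:
  "rapid c \<Longrightarrow> (\<lambda>\<xi>. c \<xi> * exp (\<i> * complex_of_real (x \<bullet> ivec \<xi>))) summable_on UNIV"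
  by (rule abs_summable_summable[OF fourier_sum_abs_summable])

lemma norm_fourier_sum_le:
  assumes "rapid c"
  shows "cmod (fourier_sum c x) \<le> (\<Sum>\<^sub>\<infinity>\<xi>. cmod (c \<xi>))"
  using norm_infsum_bound[OF fourier_sum_abs_summable[OF assms, of x]] by (simp add: fourier_sum_def norm_mult)

lemma norm_exp_i_diff_le: "cmod (exp (\<i> * complex_of_real a) - exp (\<i> * complex_of_real b)) \<le> \<bar>a - b\<bar>"
proof -
  have "exp (\<i> * complex_of_real a) - exp (\<i> * complex_of_real b)
      = exp (\<i> * complex_of_real b) * (exp (\<i> * complex_of_real (a - b)) - 1)"
    by (simp add: right_diff_distrib exp_add[symmetric])
  then show ?thesis
    using Taylor_exp[of "\<i> * complex_of_real (a - b)" 0]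
    by (simp add: norm_mult del: of_real_diff)
qed

lemma norm_exp_i_linear_le:
  "cmod (exp (\<i> * complex_of_real (a + y)) - exp (\<i> * complex_of_real a) - \<i> * complex_of_real y * exp (\<i> * complex_of_real a)) \<le> y\<^sup>2"
proof -
  have "exp (\<i> * complex_of_real (a + y)) - exp (\<i> * complex_of_real a) - \<i> * complex_of_real y * exp (\<i> * complex_of_real a)
      = exp (\<i> * complex_of_real a) * (exp (\<i> * complex_of_real y) - (1 + \<i> * complex_of_real y))"
    by (simp add: algebra_simps exp_add)
  then show ?thesis
    using Taylor_exp[of "\<i> * complex_of_real y" 1] by (simp add: norm_mult power2_eq_square)
qed

text \<open>One power of \<open>bracket\<close> bounds the Lipschitz constant of each character, so
  the weighted sum of the coefficients is a Lipschitz constant of the series.\<close>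

lemma fourier_sum_continuous:
  assumes "rapid c"
  shows "continuous_on S (fourier_sum c)"
proof -
  have "dist (fourier_sum c x) (fourier_sum c y) \<le> (\<Sum>\<^sub>\<infinity>\<xi>. cmod (c \<xi>) * bracket \<xi> ^ 1) * dist x y" for x y
  proof -
    let ?d = "\<lambda>\<xi>. c \<xi> * exp (\<i> * complex_of_real (x \<bullet> ivec \<xi>)) - c \<xi> * exp (\<i> * complex_of_real (y \<bullet> ivec \<xi>))"
    have le: "cmod (?d \<xi>) \<le> cmod (c \<xi>) * bracket \<xi> ^ 1 * dist x y" for \<xi>
    proof -
      have "cmod (?d \<xi>) = cmod (c \<xi>) * cmod (exp (\<i> * complex_of_real (x \<bullet> ivec \<xi>)) - exp (\<i> * complex_of_real (y \<bullet> ivec \<xi>)))"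
        by (simp only: right_diff_distrib[symmetric] norm_mult)
      also have "\<dots> \<le> cmod (c \<xi>) * \<bar>x \<bullet> ivec \<xi> - y \<bullet> ivec \<xi>\<bar>"
        by (intro mult_left_mono norm_exp_i_diff_le) auto
      also have "\<dots> \<le> cmod (c \<xi>) * (dist x y * bracket \<xi>)"
      proof (rule mult_left_mono)
        have "\<bar>x \<bullet> ivec \<xi> - y \<bullet> ivec \<xi>\<bar> \<le> norm (x - y) * norm (ivec \<xi>)"
          unfolding inner_diff_left[symmetric] by (rule Cauchy_Schwarz_ineq2)
        also have "\<dots> \<le> dist x y * bracket \<xi>"
          by (intro mult_mono) (auto simp: dist_norm bracket_def)
        finally show "\<bar>x \<bullet> ivec \<xi> - y \<bullet> ivec \<xi>\<bar> \<le> dist x y * bracket \<xi>" .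
      qed simp
      finally have "cmod (?d \<xi>) \<le> cmod (c \<xi>) * (dist x y * bracket \<xi>)" .
      then show ?thesis by (simp add: mult_ac)
    qed
    have s: "(\<lambda>\<xi>. cmod (c \<xi>) * bracket \<xi> ^ 1 * dist x y) summable_on UNIV"
      by (intro summable_on_cmult_left rapidD assms)
    have s': "(\<lambda>\<xi>. cmod (?d \<xi>)) summable_on UNIV"
      by (rule summable_on_comparison_test[OF s le]) auto
    have "fourier_sum c x - fourier_sum c y = infsum ?d UNIV"
      unfolding fourier_sum_def by (intro infsum_diff[symmetric] fourier_sum_summable assms)
    then have "dist (fourier_sum c x) (fourier_sum c y) \<le> (\<Sum>\<^sub>\<infinity>\<xi>. cmod (?d \<xi>))"
      using norm_infsum_bound[OF s'] by (simp add: dist_norm)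
    also have "\<dots> \<le> (\<Sum>\<^sub>\<infinity>\<xi>. cmod (c \<xi>) * bracket \<xi> ^ 1 * dist x y)"
      by (rule infsum_mono[OF s' s le])
    finally show ?thesis by (simp add: infsum_cmult_left')
  qed
  then have "(\<Sum>\<^sub>\<infinity>\<xi>. cmod (c \<xi>) * bracket \<xi> ^ 1)-lipschitz_on S (fourier_sum c)"
    by (intro lipschitz_onI infsum_nonneg) (auto simp: less_imp_le)
  then show ?thesis by (rule lipschitz_on_continuous_on)
qed

text \<open>Differentiability from one explicit remainder estimate. It serves both for Fourier
  series, where Taylor remainders are summed, and for \<open>flat\<close> at the origin.\<close>

lemma has_vector_derivative_quadratic:
  fixes g :: "real \<Rightarrow> 'a::real_normed_vector"
  assumes "\<And>t. norm (g t - g 0 - t *\<^sub>R g') \<le> K * t\<^sup>2"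
  shows "(g has_vector_derivative g') (at 0)"
  unfolding has_vector_derivative_def has_derivative_at_alt
proof (intro conjI allI impI)
  fix e :: real
  assume "e > 0"
  have K: "K \<ge> 0" using order_trans[OF norm_ge_zero assms[of 1]] by simp
  \<comment> \<open>The radius \<open>e / (K + 1)\<close> is chosen instead of \<open>e / K\<close>
    to cover \<open>K = 0\<close>.\<close>
  have "norm (g y - g 0 - (y - 0) *\<^sub>R g') \<le> e * norm (y - 0)" if y: "norm (y - 0) < e / (K + 1)" for y
  proof -
    have "norm (g y - g 0 - y *\<^sub>R g') \<le> (K * \<bar>y\<bar>) * \<bar>y\<bar>"
      using assms[of y] by (simp add: power2_eq_square mult.assoc)
    also have "\<dots> \<le> e * \<bar>y\<bar>"
    proof (rule mult_right_mono)
      have "\<bar>y\<bar> * (K + 1) \<le> e" using y K by (simp add: field_simps)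
      then show "K * \<bar>y\<bar> \<le> e" by (simp add: algebra_simps)
    qed simp
    finally show ?thesis by simp
  qed
  then show "\<exists>d>0. \<forall>y. norm (y - 0) < d \<longrightarrow> norm (g y - g 0 - (y - 0) *\<^sub>R g') \<le> e * norm (y - 0)"
    using \<open>e > 0\<close> K by (intro exI[of _ "e / (K + 1)"]) auto
qed (rule bounded_linear_scaleR_left)

text \<open>The Taylor remainder of each character after the linear term is at most the square of
  \<open>t * \<xi> $ j\<close>, so the remainder of the series is at most \<open>t^2\<close> times
  the sum of the coefficients with weight \<open>bracket \<xi> ^ 2\<close>.\<close>

lemma fourier_sum_has_deriv:
  assumes "rapid c"
  shows "((\<lambda>t. fourier_sum c (x + t *\<^sub>R axis j 1)) has_vector_derivative
     fourier_sum (\<lambda>\<xi>. \<i> * of_int (\<xi> $ j) * c \<xi>) x) (at 0)"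
proof (rule has_vector_derivative_quadratic)
  fix t :: real
  have r: "rapid (\<lambda>\<xi>. \<i> * of_int (\<xi> $ j) * c \<xi>)"
    using rapid_derivative_symbol[OF assms, of "[j]"] by simp
  let ?e = "\<lambda>y \<xi>. exp (\<i> * complex_of_real (y \<bullet> ivec \<xi>))"
  let ?d = "\<lambda>\<xi>. c \<xi> * ?e (x + t *\<^sub>R axis j 1) \<xi> - c \<xi> * ?e x \<xi> - complex_of_real t * (\<i> * of_int (\<xi> $ j) * c \<xi> * ?e x \<xi>)"
  have le: "cmod (?d \<xi>) \<le> cmod (c \<xi>) * bracket \<xi> ^ 2 * t\<^sup>2" for \<xi>
  proof -
    have in_eq: "(x + t *\<^sub>R axis j 1) \<bullet> ivec \<xi> = x \<bullet> ivec \<xi> + t * of_int (\<xi> $ j)"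
      by (simp add: inner_add_left inner_axis')
    have "?d \<xi> = c \<xi> * (exp (\<i> * complex_of_real (x \<bullet> ivec \<xi> + t * of_int (\<xi> $ j))) - ?e x \<xi>
        - \<i> * complex_of_real (t * of_int (\<xi> $ j)) * ?e x \<xi>)"
      unfolding in_eq by (simp add: algebra_simps)
    then have "cmod (?d \<xi>) \<le> cmod (c \<xi>) * (t * of_int (\<xi> $ j))\<^sup>2"
      by (simp only: norm_mult mult_left_mono norm_exp_i_linear_le norm_ge_zero)
    also have "(t * of_int (\<xi> $ j))\<^sup>2 \<le> bracket \<xi> ^ 2 * t\<^sup>2"
      using power_mono[OF abs_component_le_bracket[of \<xi> j], of 2]
      by (subst power_mult_distrib, subst mult.commute, intro mult_right_mono) auto
    finally show ?thesis by (simp add: mult_left_mono mult.assoc)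
  qed
  have s: "(\<lambda>\<xi>. cmod (c \<xi>) * bracket \<xi> ^ 2 * t\<^sup>2) summable_on UNIV"
    by (intro summable_on_cmult_left rapidD assms)
  have s': "(\<lambda>\<xi>. cmod (?d \<xi>)) summable_on UNIV"
    by (rule summable_on_comparison_test[OF s le]) auto
  have "fourier_sum c (x + t *\<^sub>R axis j 1) - fourier_sum c (x + 0 *\<^sub>R axis j 1)
      - t *\<^sub>R fourier_sum (\<lambda>\<xi>. \<i> * of_int (\<xi> $ j) * c \<xi>) x = infsum ?d UNIV"
  proof -
    let ?A = "\<lambda>\<xi>. c \<xi> * ?e (x + t *\<^sub>R axis j 1) \<xi>" and ?B = "\<lambda>\<xi>. c \<xi> * ?e x \<xi>"
    let ?C = "\<lambda>\<xi>. \<i> * of_int (\<xi> $ j) * c \<xi> * ?e x \<xi>"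
    have sm: "?A summable_on UNIV" "?B summable_on UNIV" "?C summable_on UNIV"
      by (intro fourier_sum_summable assms r)+
    have "infsum ?d UNIV = infsum (\<lambda>\<xi>. ?A \<xi> - ?B \<xi>) UNIV - infsum (\<lambda>\<xi>. complex_of_real t * ?C \<xi>) UNIV"
      by (rule infsum_diff[OF summable_on_diff[OF sm(1,2)] summable_on_cmult_right[OF sm(3)]])
    also have "\<dots> = (infsum ?A UNIV - infsum ?B UNIV) - complex_of_real t * infsum ?C UNIV"
      by (simp only: infsum_diff[OF sm(1,2)] infsum_cmult_right')
    finally show ?thesis by (simp add: fourier_sum_def scaleR_conv_of_real)
  qed
  then have "norm (fourier_sum c (x + t *\<^sub>R axis j 1) - fourier_sum c (x + 0 *\<^sub>R axis j 1)
      - t *\<^sub>R fourier_sum (\<lambda>\<xi>. \<i> * of_int (\<xi> $ j) * c \<xi>) x) \<le> (\<Sum>\<^sub>\<infinity>\<xi>. cmod (?d \<xi>))"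
    using norm_infsum_bound[OF s'] by simp
  also have "\<dots> \<le> (\<Sum>\<^sub>\<infinity>\<xi>. cmod (c \<xi>) * bracket \<xi> ^ 2 * t\<^sup>2)"
    by (rule infsum_mono[OF s' s le])
  finally show "norm (fourier_sum c (x + t *\<^sub>R axis j 1) - fourier_sum c (x + 0 *\<^sub>R axis j 1)
      - t *\<^sub>R fourier_sum (\<lambda>\<xi>. \<i> * of_int (\<xi> $ j) * c \<xi>) x) \<le> (\<Sum>\<^sub>\<infinity>\<xi>. cmod (c \<xi>) * bracket \<xi> ^ 2) * t\<^sup>2"
    by (simp add: infsum_cmult_left')
qed

lemma foldr_partial_fourier_sum:
  assumes "rapid c"
  shows "foldr partial js (fourier_sum c) = fourier_sum (\<lambda>\<xi>. derivative_symbol js \<xi> * c \<xi>)"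
proof (induction js)
  case (Cons j js)
  have "partial j (fourier_sum (\<lambda>\<xi>. derivative_symbol js \<xi> * c \<xi>)) = fourier_sum (\<lambda>\<xi>. derivative_symbol (j # js) \<xi> * c \<xi>)"
    unfolding partial_def
    using vector_derivative_at[OF fourier_sum_has_deriv[OF rapid_derivative_symbol[OF assms, of js], of _ j]]
    by (simp add: fun_eq_iff mult.assoc)
  then show ?case by (simp only: foldr.simps o_apply Cons)
qed simp

lemma exp_char_eq: "exp (\<i> * complex_of_real (x \<bullet> ivec \<xi>)) = test_apply (test_exp (- \<xi>)) x"
  by (simp add: test_exp.rep_eq ivec_minus)

lemma smooth_fourier_sum: "rapid c \<Longrightarrow> smooth (fourier_sum c)"
  unfolding smooth_def
  by (auto simp: foldr_partial_fourier_sum rapid_derivative_symbol fourier_sum_continuous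
      intro!: differentiableI_vector[OF fourier_sum_has_deriv])

lemma periodic_fourier_sum: "periodic (fourier_sum c)"
proof -
  have "test_apply \<phi> (x + (2 * pi) *\<^sub>R ivec k) = test_apply \<phi> x" for \<phi> :: "'a torus_test" and k x
    using periodic_test_apply[of \<phi>] by (simp add: periodic_def)
  then show ?thesis unfolding periodic_def fourier_sum_def exp_char_eq by simp
qed

definition fourier_test :: "(int^'n::finite \<Rightarrow> complex) \<Rightarrow> 'n torus_test" where
  "fourier_test c = Abs_torus_test (fourier_sum c)"

lemma test_apply_fourier_test: "rapid c \<Longrightarrow> test_apply (fourier_test c) = fourier_sum c"
  unfolding fourier_test_def by (simp add: Abs_torus_test_inverse smooth_fourier_sum periodic_fourier_sum)

lemma foldr_test_deriv_rep: "test_apply (foldr test_deriv js \<phi>) = foldr partial js (test_apply \<phi>)"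
  by (induction js) (auto simp: test_deriv.rep_eq)

lemma test_derivs_fourier_test:
  "rapid c \<Longrightarrow> test_apply (foldr test_deriv js (fourier_test c)) = fourier_sum (\<lambda>\<xi>. derivative_symbol js \<xi> * c \<xi>)"
  by (simp add: foldr_test_deriv_rep test_apply_fourier_test foldr_partial_fourier_sum)

lemma fourier_test_add:
  assumes "rapid c" "rapid d"
  shows "fourier_test (\<lambda>\<xi>. c \<xi> + d \<xi>) = test_add (fourier_test c) (fourier_test d)"
proof -
  have "fourier_sum (\<lambda>\<xi>. c \<xi> + d \<xi>) x = fourier_sum c x + fourier_sum d x" for x
    unfolding fourier_sum_def distrib_right by (intro infsum_add fourier_sum_summable assms)
  then show ?thesis
    by (simp add: test_apply_inject[symmetric] test_add.rep_eq test_apply_fourier_test assms rapid_add fun_eq_iff)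
qed

lemma infsum_single:
  fixes f :: "'a \<Rightarrow> 'b::{comm_monoid_add,t2_space}"
  assumes "\<And>x. x \<noteq> a \<Longrightarrow> f x = 0"
  shows "infsum f UNIV = f a"
  by (rule infsumI, rule has_sum_finite_neutralI[of "{a}"]) (use assms in auto)

lemma fourier_sum_single: "fourier_sum (\<lambda>\<eta>. if \<eta> = \<xi> then a else 0) x = a * exp (\<i> * complex_of_real (x \<bullet> ivec \<xi>))"
  unfolding fourier_sum_def by (subst infsum_single[of \<xi>]) auto

lemma rapid_finite_support:
  assumes "finite F"
  shows "rapid (\<lambda>\<xi>. if \<xi> \<in> F then c \<xi> else 0)"
  unfolding rapid_def
proof
  fix k
  have "(\<lambda>\<xi>. cmod (c \<xi>) * bracket \<xi> ^ k) summable_on F" using assms by (rule summable_on_finite)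
  moreover have "((\<lambda>\<xi>. cmod (if \<xi> \<in> F then c \<xi> else 0) * bracket \<xi> ^ k) summable_on UNIV) =
      ((\<lambda>\<xi>. cmod (c \<xi>) * bracket \<xi> ^ k) summable_on F)"
    by (rule summable_on_cong_neutral) auto
  ultimately show "(\<lambda>\<xi>. cmod (if \<xi> \<in> F then c \<xi> else 0) * bracket \<xi> ^ k) summable_on UNIV" by simp
qed

lemma fourier_test_single: "fourier_test (\<lambda>\<eta>. if \<eta> = \<xi> then a else 0) = test_scale a (test_exp (- \<xi>))"
  using rapid_finite_support[of "{\<xi>}" "\<lambda>_. a"]
  by (simp add: test_apply_inject[symmetric] test_apply_fourier_test test_scale.rep_eq fun_eq_iff fourier_sum_single exp_char_eq)

section \<open>Pairing distributions with Fourier series, and Fourier inversion\<close>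

lemma pairing_add: "pairing u (test_add \<phi> \<psi>) = pairing u \<phi> + pairing u \<psi>"
  and pairing_scale: "pairing u (test_scale c \<phi>) = c * pairing u \<phi>"
  using pairing[of u] by (auto simp: distribution_def)

lemma fourier_test_zero: "pairing u (fourier_test (\<lambda>\<xi>. 0)) = 0"
proof -
  have "fourier_test (\<lambda>\<xi>. 0) = test_scale 0 (test_exp (- (0 :: int^'a)))"
    using fourier_test_single[of 0 0] by simp
  then show ?thesis by (simp add: pairing_scale)
qed

text \<open>The frequency \<open>- \<xi>\<close> appears because \<open>test_exp\<close> carries a
  minus sign in the exponent, whereas Fourier sums are built with the opposite one.\<close>

lemma pairing_fourier_test_finite:
  "finite F \<Longrightarrow> pairing u (fourier_test (\<lambda>\<xi>. if \<xi> \<in> F then c \<xi> else 0)) = (\<Sum>\<xi>\<in>F. c \<xi> * fourier_coeff u (- \<xi>))"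
proof (induction rule: finite_induct)
  case empty
  then show ?case by (simp add: fourier_test_zero)
next
  case (insert \<eta> F)
  have "(\<lambda>\<xi>. if \<xi> \<in> insert \<eta> F then c \<xi> else 0) =
      (\<lambda>\<xi>. (if \<xi> = \<eta> then c \<eta> else 0) + (if \<xi> \<in> F then c \<xi> else 0))"
    using insert by auto
  moreover have "rapid (\<lambda>\<xi>. if \<xi> = \<eta> then c \<eta> else 0)"
    using rapid_finite_support[of "{\<eta>}" "\<lambda>_. c \<eta>"] by simp
  ultimately show ?case
    using insert by (simp add: fourier_test_add rapid_finite_support pairing_add fourier_test_single pairing_scale fourier_coeff_def)
qed

text \<open>A distribution is controlled by finitely many derivatives, and these are controlled by a
  weighted sum of the coefficients. The part of the series outside a finite set therefore pairs to
  something bounded by a tail of a convergent sum.\<close>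

lemma pairing_fourier_test_has_sum:
  assumes c: "rapid c"
  shows "((\<lambda>\<xi>. c \<xi> * fourier_coeff u (- \<xi>)) has_sum pairing u (fourier_test c)) UNIV"
proof -
  have "distribution (pairing u)" using pairing[of u] by simp
  then obtain m C where C: "\<And>\<phi> M. (\<forall>js x. length js \<le> m \<longrightarrow> cmod (test_apply (foldr test_deriv js \<phi>) x) \<le> M)
          \<Longrightarrow> cmod (pairing u \<phi>) \<le> C * M" unfolding distribution_def by metis
  have bound: "cmod (pairing u (fourier_test d)) \<le> C * (\<Sum>\<^sub>\<infinity>\<xi>. cmod (d \<xi>) * bracket \<xi> ^ m)" if d: "rapid d" for d
  proof (rule C, intro allI impI)
    fix js :: "'a list" and x
    assume js: "length js \<le> m"
    have r: "rapid (\<lambda>\<xi>. derivative_symbol js \<xi> * d \<xi>)" by (rule rapid_derivative_symbol[OF d])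
    have "cmod (test_apply (foldr test_deriv js (fourier_test d)) x) \<le> (\<Sum>\<^sub>\<infinity>\<xi>. cmod (derivative_symbol js \<xi> * d \<xi>))"
      unfolding test_derivs_fourier_test[OF d] by (rule norm_fourier_sum_le[OF r])
    also have "\<dots> \<le> (\<Sum>\<^sub>\<infinity>\<xi>. cmod (d \<xi>) * bracket \<xi> ^ m)"
    proof (rule infsum_mono[OF rapid_norm_summable[OF r] rapidD[OF d]])
      show "cmod (derivative_symbol js \<xi> * d \<xi>) \<le> cmod (d \<xi>) * bracket \<xi> ^ m" for \<xi>
        using mult_right_mono[OF norm_derivative_symbol_le_bracket[OF js, of \<xi>], of "cmod (d \<xi>)"]
        by (simp add: norm_mult mult_ac)
    qed
    finally show "cmod (test_apply (foldr test_deriv js (fourier_test d)) x) \<le> (\<Sum>\<^sub>\<infinity>\<xi>. cmod (d \<xi>) * bracket \<xi> ^ m)" .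
  qed
  let ?w = "\<lambda>\<xi>. cmod (c \<xi>) * bracket \<xi> ^ m"
  define S where "S = infsum ?w UNIV"
  have hs: "(?w has_sum S) UNIV" unfolding S_def by (rule has_sum_infsum[OF rapidD[OF c]])
  have est: "cmod ((\<Sum>\<xi>\<in>F. c \<xi> * fourier_coeff u (- \<xi>)) - pairing u (fourier_test c)) \<le> C * (S - sum ?w F)"
    if F: "finite F" for F
  proof -
    let ?in = "\<lambda>\<xi>. if \<xi> \<in> F then c \<xi> else 0" and ?out = "\<lambda>\<xi>. if \<xi> \<notin> F then c \<xi> else 0"
    have split: "(\<lambda>\<xi>. ?in \<xi> + ?out \<xi>) = c" by auto
    have "pairing u (fourier_test (\<lambda>\<xi>. ?in \<xi> + ?out \<xi>)) = pairing u (fourier_test ?in) + pairing u (fourier_test ?out)"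
      by (subst fourier_test_add) (rule rapid_finite_support[OF F] rapid_restrict[OF c] pairing_add)+
    then have "pairing u (fourier_test c) = pairing u (fourier_test ?in) + pairing u (fourier_test ?out)"
      unfolding split .
    then have "cmod ((\<Sum>\<xi>\<in>F. c \<xi> * fourier_coeff u (- \<xi>)) - pairing u (fourier_test c)) = cmod (pairing u (fourier_test ?out))"
      using pairing_fourier_test_finite[OF F, of u c] by simp
    also have "\<dots> \<le> C * (\<Sum>\<^sub>\<infinity>\<xi>. cmod (?out \<xi>) * bracket \<xi> ^ m)"
      by (rule bound[OF rapid_restrict[OF c, of "\<lambda>\<xi>. \<xi> \<notin> F"]])
    also have "(\<Sum>\<^sub>\<infinity>\<xi>. cmod (?out \<xi>) * bracket \<xi> ^ m) = infsum ?w (UNIV - F)"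
      by (rule infsum_cong_neutral) auto
    also have "\<dots> = S - sum ?w F"
      unfolding S_def infsum_finite[OF F, symmetric]
      by (rule infsum_Diff[OF rapidD[OF c] summable_on_finite[OF F] subset_UNIV])
    finally show ?thesis .
  qed
  have "((\<lambda>F. C * (S - sum ?w F)) \<longlongrightarrow> C * (S - S)) (finite_subsets_at_top UNIV)"
    using hs unfolding has_sum_def by (intro tendsto_intros)
  then have lim: "((\<lambda>F. C * (S - sum ?w F)) \<longlongrightarrow> 0) (finite_subsets_at_top UNIV)"
    by (simp only: diff_self mult_zero_right)
  have "((\<lambda>F. (\<Sum>\<xi>\<in>F. c \<xi> * fourier_coeff u (- \<xi>)) - pairing u (fourier_test c)) \<longlongrightarrow> 0) (finite_subsets_at_top UNIV)"
    by (rule Lim_null_comparison[OF eventually_finite_subsets_at_top_weakI lim]) (rule est)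
  then show ?thesis unfolding has_sum_def by (rule LIM_zero_cancel)
qed

text \<open>A character with \<open>k $ j\<close> nonzero is a constant multiple of its own
  derivative along \<open>j\<close>, hence has mean zero.\<close>

lemma torus_mean_exp:
  "torus_mean (\<lambda>x. exp (\<i> * complex_of_real (x \<bullet> ivec k))) = (if k = 0 then 1 else 0)"
proof (cases "k = 0")
  case False
  then obtain j where j: "k $ j \<noteq> 0" by (auto simp: vec_eq_iff)
  have "torus_mean (\<lambda>x. (\<i> * of_int (k $ j)) * exp (\<i> * complex_of_real (x \<bullet> ivec k))) = 0"
  proof (rule torus_mean_directional_derivative)
    show "periodic (\<lambda>x. exp (\<i> * complex_of_real (x \<bullet> ivec k)))"
      unfolding exp_char_eq by (rule periodic_test_apply)
    show "((\<lambda>t. exp (\<i> * complex_of_real ((x + t *\<^sub>R axis j 1) \<bullet> ivec k))) has_vector_derivative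
        \<i> * of_int (k $ j) * exp (\<i> * complex_of_real (x \<bullet> ivec k))) (at 0)" for x
      using exp_inner_has_deriv[of 1 x j "ivec k"] by simp
  qed (intro continuous_intros)+
  then show ?thesis using j False by (simp add: torus_mean_cmult)
qed simp

lemma fourier_coeff_of_test_exp: "fourier_coeff (of_test (test_exp \<xi>)) \<eta> = (if \<eta> = - \<xi> then 1 else 0)"
proof -
  have "exp (- \<i> * complex_of_real (x \<bullet> ivec \<xi>)) * exp (- \<i> * complex_of_real (x \<bullet> ivec \<eta>))
      = exp (\<i> * complex_of_real (x \<bullet> ivec (- \<xi> - \<eta>)))" for x :: "real^'a"
  proof -
    have "ivec (- \<xi> - \<eta>) = - ivec \<xi> - ivec \<eta>" by (simp add: vec_eq_iff)
    then have "complex_of_real (x \<bullet> ivec (- \<xi> - \<eta>)) = - complex_of_real (x \<bullet> ivec \<xi>) - complex_of_real (x \<bullet> ivec \<eta>)"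
      by (simp add: inner_diff_right)
    then show ?thesis unfolding exp_add[symmetric] by (simp add: right_diff_distrib)
  qed
  then show ?thesis
    by (auto simp: fourier_coeff_of_test test_exp.rep_eq torus_mean_exp)
qed

text \<open>The pairing of two test functions is symmetric, so the coefficient is the value of the
  distribution \<open>of_test (test_exp \<xi>)\<close> at the series. The expansion above then takes
  the place of an interchange of sum and integral.\<close>

lemma fourier_coeff_fourier_test:
  assumes "rapid c"
  shows "fourier_coeff (of_test (fourier_test c)) \<xi> = c \<xi>"
proof -
  have "pairing (of_test (test_exp \<xi>)) (fourier_test c) = fourier_coeff (of_test (fourier_test c)) \<xi>"
    by (simp add: fourier_coeff_def of_test.rep_eq mult.commute)
  then have "((\<lambda>\<eta>. c \<eta> * fourier_coeff (of_test (test_exp \<xi>)) (- \<eta>)) has_sum fourier_coeff (of_test (fourier_test c)) \<xi>) UNIV"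
    using pairing_fourier_test_has_sum[OF assms, of "of_test (test_exp \<xi>)"] by simp
  moreover have "(\<lambda>\<eta>. c \<eta> * fourier_coeff (of_test (test_exp \<xi>)) (- \<eta>)) = (\<lambda>\<eta>. if \<eta> = \<xi> then c \<xi> else 0)"
    by (auto simp: fourier_coeff_of_test_exp)
  ultimately have "(\<Sum>\<^sub>\<infinity>\<eta>. if \<eta> = \<xi> then c \<xi> else 0) = fourier_coeff (of_test (fourier_test c)) \<xi>"
    by (metis infsumI)
  then show ?thesis by (subst (asm) infsum_single[of \<xi>]) auto
qed

lemma rapid_fourier_coeff_of_test:
  fixes \<phi> :: "'n::finite torus_test"
  shows "rapid (fourier_coeff (of_test \<phi>))"
  unfolding rapid_def
proof
  fix k
  \<comment> \<open>Here \<open>k\<close> derivatives pay for the weight and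
    \<open>2 * CARD('n)\<close> for summability over the lattice.\<close>
  obtain M where M: "\<And>js x. length js \<le> k + 2 * CARD('n) \<Longrightarrow> cmod (test_apply (foldr test_deriv js \<phi>) x) \<le> M"
    using test_derivs_bounded[of "k + 2 * CARD('n)" \<phi>] by blast
  let ?c = "\<lambda>\<xi>. fourier_coeff (of_test \<phi>) \<xi> * complex_of_real (bracket \<xi> ^ k)"
  have "(\<lambda>\<xi>. norm (?c \<xi>)) summable_on UNIV"
  proof (rule summable_on_bracket_decay)
    show "cmod (?c \<xi>) * bracket \<xi> ^ (2 * CARD('n)) \<le> (1 + real CARD('n)) ^ (k + 2 * CARD('n)) * M" for \<xi>
    proof -
      have "cmod (fourier_coeff (of_test \<phi>) \<xi>) * bracket \<xi> ^ (k + 2 * CARD('n)) \<le> (1 + real CARD('n)) ^ (k + 2 * CARD('n)) * M"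
        by (rule fourier_coeff_of_test_decay, rule M)
      then show ?thesis by (simp add: norm_mult norm_power power_add mult.assoc abs_of_pos)
    qed
  qed
  then show "(\<lambda>\<xi>. cmod (fourier_coeff (of_test \<phi>) \<xi>) * bracket \<xi> ^ k) summable_on UNIV"
    by (simp add: norm_mult norm_power abs_of_pos)
qed

text \<open>Synthesis followed by analysis reproduces the coefficients, and a continuous periodic
  function is determined by them.\<close>

lemma fourier_inversion:
  fixes \<phi> :: "'n::finite torus_test"
  shows "fourier_test (fourier_coeff (of_test \<phi>)) = \<phi>"
proof -
  let ?\<psi> = "fourier_test (fourier_coeff (of_test \<phi>))"
  have "test_apply \<phi> x - test_apply ?\<psi> x = 0" for x :: "real^'n"
  proof (rule fourier_uniqueness)
    show "continuous_on UNIV (\<lambda>x. test_apply \<phi> x - test_apply ?\<psi> x)"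
      by (intro continuous_intros continuous_test_apply)
    show "periodic (\<lambda>x. test_apply \<phi> x - test_apply ?\<psi> x)"
      using periodic_test_apply[of \<phi>] periodic_test_apply[of ?\<psi>] by (simp add: periodic_def)
    fix \<xi> :: "int^'n"
    let ?e = "\<lambda>x. exp (- \<i> * complex_of_real (x \<bullet> ivec \<xi>))"
    have "torus_mean (\<lambda>x. test_apply \<phi> x * ?e x + (- 1) * (test_apply ?\<psi> x * ?e x))
        = torus_mean (\<lambda>x. test_apply \<phi> x * ?e x) + (- 1) * torus_mean (\<lambda>x. test_apply ?\<psi> x * ?e x)"
      by (subst torus_mean_add) (intro continuous_intros continuous_test_apply, intro continuous_intros continuous_test_apply, simp only: torus_mean_cmult)
    also have "\<dots> = 0"
      using fourier_coeff_fourier_test[OF rapid_fourier_coeff_of_test[of \<phi>], of \<xi>]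
      unfolding fourier_coeff_of_test by simp
    finally show "torus_mean (\<lambda>x. (test_apply \<phi> x - test_apply ?\<psi> x) * ?e x) = 0"
      by (simp add: left_diff_distrib)
  qed
  then show ?thesis by (simp add: test_apply_inject[symmetric] fun_eq_iff)
qed

text \<open>Parseval's formula for the duality between distributions and test functions.\<close>

lemma pairing_has_sum:
  "((\<lambda>\<xi>. fourier_coeff (of_test \<phi>) \<xi> * fourier_coeff u (- \<xi>)) has_sum pairing u \<phi>) UNIV"
  using pairing_fourier_test_has_sum[OF rapid_fourier_coeff_of_test[of \<phi>], of u] by (simp add: fourier_inversion)

lemma distr_eqI:
  assumes "\<And>\<xi>. fourier_coeff u \<xi> = fourier_coeff v \<xi>"
  shows "u = v"
proof -
  have "pairing u \<phi> = pairing v \<phi>" for \<phi>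
    using has_sum_unique[OF pairing_has_sum[of \<phi> u]] pairing_has_sum[of \<phi> v] assms by simp
  then show ?thesis by (simp add: pairing_inject[symmetric] fun_eq_iff)
qed

section \<open>Distributions with prescribed Fourier coefficients\<close>

definition temperate :: "(int^'n::finite \<Rightarrow> complex) \<Rightarrow> bool" where
  "temperate c \<longleftrightarrow> (\<exists>C k. \<forall>\<xi>. cmod (c \<xi>) \<le> C * bracket \<xi> ^ k)"

text \<open>Meaningful for temperate \<open>c\<close>, when the functional is a distribution. The
  opposite frequencies are those of Parseval's formula.\<close>

definition fourier_distr :: "(int^'n::finite \<Rightarrow> complex) \<Rightarrow> 'n torus_distr" where
  "fourier_distr c = Abs_torus_distr (\<lambda>\<phi>. \<Sum>\<^sub>\<infinity>\<xi>. c \<xi> * fourier_coeff (of_test \<phi>) (- \<xi>))"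

text \<open>Growth of order \<open>k\<close> is beaten by \<open>k + 2 * CARD('n)\<close>
  derivatives of the test function; the resulting bound is linear in their supremum, which is
  exactly the continuity asked of a distribution.\<close>

lemma distribution_fourier_distr:
  fixes c :: "int^'n::finite \<Rightarrow> complex"
  assumes "temperate c"
  shows "distribution (\<lambda>\<phi>. \<Sum>\<^sub>\<infinity>\<xi>. c \<xi> * fourier_coeff (of_test \<phi>) (- \<xi>))"
proof -
  obtain C k where C: "\<And>\<xi>. cmod (c \<xi>) \<le> C * bracket \<xi> ^ k" using assms unfolding temperate_def by blast
  have C0: "C \<ge> 0" using order_trans[OF norm_ge_zero C[of 0]] by (simp add: bracket_def)
  define K where "K = (1 + real CARD('n)) ^ (k + 2 * CARD('n))"
  define Z where "Z = (\<Sum>\<^sub>\<infinity>\<xi>::int^'n. 1 / bracket \<xi> ^ (2 * CARD('n)))"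
  have est: "cmod (c \<xi> * fourier_coeff (of_test \<phi>) (- \<xi>)) \<le> C * K * M * (1 / bracket \<xi> ^ (2 * CARD('n)))"
    if M: "\<And>js x. length js \<le> k + 2 * CARD('n) \<Longrightarrow> cmod (test_apply (foldr test_deriv js \<phi>) x) \<le> M" for \<phi> M \<xi>
  proof -
    have "cmod (c \<xi>) * cmod (fourier_coeff (of_test \<phi>) (- \<xi>)) * bracket \<xi> ^ (2 * CARD('n))
        \<le> (C * bracket \<xi> ^ k) * cmod (fourier_coeff (of_test \<phi>) (- \<xi>)) * bracket \<xi> ^ (2 * CARD('n))"
      by (intro mult_right_mono C) (auto simp: less_imp_le)
    also have "\<dots> = C * (cmod (fourier_coeff (of_test \<phi>) (- \<xi>)) * bracket (- \<xi>) ^ (k + 2 * CARD('n)))"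
      by (simp add: power_add mult_ac)
    also have "\<dots> \<le> C * (K * M)"
      unfolding K_def by (intro mult_left_mono fourier_coeff_of_test_decay M C0)
    finally show ?thesis by (simp add: norm_mult pos_le_divide_eq mult.assoc)
  qed
  have summ: "(\<lambda>\<xi>. cmod (c \<xi> * fourier_coeff (of_test \<phi>) (- \<xi>))) summable_on UNIV" for \<phi>
  proof -
    obtain M where M: "\<And>js x. length js \<le> k + 2 * CARD('n) \<Longrightarrow> cmod (test_apply (foldr test_deriv js \<phi>) x) \<le> M"
      using test_derivs_bounded[of "k + 2 * CARD('n)" \<phi>] by blast
    show ?thesis
    proof (rule summable_on_comparison_test)
      show "(\<lambda>\<xi>::int^'n. C * K * M * (1 / bracket \<xi> ^ (2 * CARD('n)))) summable_on UNIV"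
        by (rule summable_on_cmult_right[OF summable_on_inverse_bracket])
      show "cmod (c \<xi> * fourier_coeff (of_test \<phi>) (- \<xi>)) \<le> C * K * M * (1 / bracket \<xi> ^ (2 * CARD('n)))" for \<xi>
        by (rule est, rule M)
    qed simp
  qed
  have "cmod (\<Sum>\<^sub>\<infinity>\<xi>. c \<xi> * fourier_coeff (of_test \<phi>) (- \<xi>)) \<le> (C * K * Z) * M"
    if M: "\<forall>js x. length js \<le> k + 2 * CARD('n) \<longrightarrow> cmod (test_apply (foldr test_deriv js \<phi>) x) \<le> M" for \<phi> M
  proof -
    have "cmod (\<Sum>\<^sub>\<infinity>\<xi>. c \<xi> * fourier_coeff (of_test \<phi>) (- \<xi>)) \<le> (\<Sum>\<^sub>\<infinity>\<xi>. cmod (c \<xi> * fourier_coeff (of_test \<phi>) (- \<xi>)))"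
      by (rule norm_infsum_bound[OF summ])
    also have "\<dots> \<le> (\<Sum>\<^sub>\<infinity>\<xi>::int^'n. C * K * M * (1 / bracket \<xi> ^ (2 * CARD('n))))"
    proof (rule infsum_mono[OF summ summable_on_cmult_right[OF summable_on_inverse_bracket]])
      show "cmod (c \<xi> * fourier_coeff (of_test \<phi>) (- \<xi>)) \<le> C * K * M * (1 / bracket \<xi> ^ (2 * CARD('n)))" for \<xi>
        by (rule est) (use M in blast)
    qed
    also have "\<dots> = (C * K * Z) * M" by (simp only: infsum_cmult_right' Z_def mult_ac)
    finally show ?thesis .
  qed
  then have "\<exists>m C'. \<forall>\<phi> M. (\<forall>js x. length js \<le> m \<longrightarrow> cmod (test_apply (foldr test_deriv js \<phi>) x) \<le> M)
      \<longrightarrow> cmod (\<Sum>\<^sub>\<infinity>\<xi>. c \<xi> * fourier_coeff (of_test \<phi>) (- \<xi>)) \<le> C' * M" by blast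
  moreover have "fourier_coeff (of_test (test_add \<phi> \<psi>)) \<xi> = fourier_coeff (of_test \<phi>) \<xi> + fourier_coeff (of_test \<psi>) \<xi>"
    for \<phi> \<psi> :: "'n torus_test" and \<xi>
    unfolding fourier_coeff_of_test test_add.rep_eq distrib_right
    by (intro torus_mean_add continuous_intros continuous_test_apply)
  moreover have "fourier_coeff (of_test (test_scale a \<phi>)) \<xi> = a * fourier_coeff (of_test \<phi>) \<xi>"
    for a and \<phi> :: "'n torus_test" and \<xi>
    unfolding fourier_coeff_of_test test_scale.rep_eq mult.assoc by (rule torus_mean_cmult)
  ultimately show ?thesis
    unfolding distribution_def
    by (intro conjI allI)
      (simp_all only: distrib_left mult.left_commute[of "c _"] infsum_cmult_right'
        infsum_add[OF abs_summable_summable[OF summ] abs_summable_summable[OF summ]])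
qed

lemma fourier_coeff_fourier_distr:
  assumes "temperate c"
  shows "fourier_coeff (fourier_distr c) \<xi> = c \<xi>"
proof -
  have "fourier_coeff (fourier_distr c) \<xi> = (\<Sum>\<^sub>\<infinity>\<eta>. c \<eta> * fourier_coeff (of_test (test_exp \<xi>)) (- \<eta>))"
    using distribution_fourier_distr[OF assms] by (simp add: fourier_coeff_def fourier_distr_def Abs_torus_distr_inverse)
  also have "\<dots> = (\<Sum>\<^sub>\<infinity>\<eta>. if \<eta> = \<xi> then c \<xi> else 0)"
    by (intro infsum_cong) (auto simp: fourier_coeff_of_test_exp)
  also have "\<dots> = c \<xi>" by (subst infsum_single[of \<xi>]) auto
  finally show ?thesis .
qed

section \<open>Fourier multipliers of the operations on distributions\<close>

lemma fourier_coeff_simps [simp]: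
  "fourier_coeff 0 \<xi> = 0"
  "fourier_coeff (u + v) \<xi> = fourier_coeff u \<xi> + fourier_coeff v \<xi>"
  "fourier_coeff (u - v) \<xi> = fourier_coeff u \<xi> - fourier_coeff v \<xi>"
  "fourier_coeff (- u) \<xi> = - fourier_coeff u \<xi>"
  "fourier_coeff (r *\<^sub>R u) \<xi> = of_real r * fourier_coeff u \<xi>"
  "fourier_coeff (c *\<^sub>C u) \<xi> = c * fourier_coeff u \<xi>"
  by (simp_all add: fourier_coeff_def zero_torus_distr.rep_eq plus_torus_distr.rep_eq minus_torus_distr.rep_eq
      uminus_torus_distr.rep_eq scaleR_torus_distr.rep_eq scaleC.rep_eq)

lemma fourier_coeff_sum [simp]: "fourier_coeff (sum f A) \<xi> = (\<Sum>a\<in>A. fourier_coeff (f a) \<xi>)"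
  by (induction A rule: infinite_finite_induct) auto

text \<open>Two signs cancel: the one of the transposed derivative and the one in the exponent of
  \<open>test_exp\<close>.\<close>

lemma fourier_coeff_distr_partial [simp]:
  "fourier_coeff (distr_partial j u) \<xi> = \<i> * of_int (\<xi> $ j) * fourier_coeff u \<xi>"
proof -
  have "test_deriv j (test_exp \<xi>) = test_scale (- (\<i> * of_int (\<xi> $ j))) (test_exp \<xi>)"
    using vector_derivative_at[OF exp_inner_has_deriv[of "-1" _ j "ivec \<xi>"]]
    by (simp add: test_apply_inject[symmetric] test_deriv.rep_eq test_scale.rep_eq test_exp.rep_eq fun_eq_iff partial_def)
  then show ?thesis
    by (simp add: fourier_coeff_def distr_partial.rep_eq pairing_scale)
qed

text \<open>The Laplacian has the multiplier \<open>- |\<xi>|^2\<close>, which turns the leading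
  term of the operator into \<open>+ a2 |\<xi>|^2\<close>. In
  \<open>y' = \<i> * (f - symbol * y)\<close> a nonpositive imaginary part of \<open>a2\<close> is
  therefore the damping sign.\<close>

definition symbol :: "complex \<Rightarrow> ('n::finite \<Rightarrow> complex) \<Rightarrow> complex \<Rightarrow> int^'n \<Rightarrow> complex" where
  "symbol a2 a1 a0 \<xi> = a2 * complex_of_real ((norm (ivec \<xi>))\<^sup>2) + (\<Sum>j\<in>UNIV. a1 j * of_int (\<xi> $ j)) + a0"

lemma fourier_coeff_spatial_op:
  "fourier_coeff (spatial_op a2 a1 a0 u) \<xi> = symbol a2 a1 a0 \<xi> * fourier_coeff u \<xi>"
proof -
  have "(norm (ivec \<xi>))\<^sup>2 = (\<Sum>j\<in>UNIV. (real_of_int (\<xi> $ j))\<^sup>2)"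
    by (simp add: norm_vec_def L2_set_def sum_nonneg)
  then have n: "complex_of_real ((norm (ivec \<xi>))\<^sup>2) = (\<Sum>j\<in>UNIV. (of_int (\<xi> $ j))\<^sup>2)" by simp
  have lap: "fourier_coeff (laplacian u) \<xi> = - complex_of_real ((norm (ivec \<xi>))\<^sup>2) * fourier_coeff u \<xi>"
    unfolding laplacian_def n
    by (simp add: sum_distrib_left power2_eq_square sum_negf mult_ac)
  have "fourier_coeff (\<Sum>j\<in>UNIV. a1 j *\<^sub>C D_x j u) \<xi> = (\<Sum>j\<in>UNIV. a1 j * of_int (\<xi> $ j)) * fourier_coeff u \<xi>"
    by (simp add: D_x_def sum_distrib_right mult.assoc)
  then show ?thesis
    unfolding spatial_op_def symbol_def by (simp add: lap algebra_simps)
qed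

section \<open>Sobolev spaces\<close>

lemma bracket_neq_0 [simp]: "bracket \<xi> \<noteq> 0"
  using bracket_pos[of \<xi>] by linarith

lemma sobolev_term_bracket: "sobolev_term r u \<xi> = (cmod (fourier_coeff u \<xi>))\<^sup>2 * bracket \<xi> powr (2 * r)"
  by (simp add: sobolev_term_def bracket_def)

lemma sobolev_term_nonneg: "0 \<le> sobolev_term r u \<xi>"
  by (simp add: sobolev_term_def)

lemma sobolev_term_square: "sobolev_term r u \<xi> = (cmod (fourier_coeff u \<xi>) * bracket \<xi> powr r)\<^sup>2"
  by (simp add: sobolev_term_bracket power_mult_distrib power2_eq_square[of "_ powr _"] powr_add[symmetric])

lemma sobolevI:
  assumes "\<And>S. finite S \<Longrightarrow> sum (sobolev_term r u) S \<le> B"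
  shows "u \<in> sobolev r"
  unfolding sobolev_def mem_Collect_eq
  by (rule nonneg_bdd_above_summable_on) (use assms in \<open>auto intro!: sobolev_term_nonneg bdd_aboveI2\<close>)

lemma sobolev_sum_le:
  assumes "u \<in> sobolev r" "finite S"
  shows "sum (sobolev_term r u) S \<le> (sobolev_norm r u)\<^sup>2"
proof -
  have "sum (sobolev_term r u) S \<le> infsum (sobolev_term r u) UNIV"
    using assms by (intro finite_sum_le_infsum) (auto simp: sobolev_def sobolev_term_nonneg)
  then show ?thesis by (simp add: sobolev_norm_def infsum_nonneg sobolev_term_nonneg)
qed

lemma sobolev_norm_nonneg: "0 \<le> sobolev_norm r u"
  by (simp add: sobolev_norm_def infsum_nonneg sobolev_term_nonneg)

lemma sobolev_norm_le:
  assumes "\<And>S. finite S \<Longrightarrow> sum (sobolev_term r u) S \<le> B\<^sup>2" and "B \<ge> 0"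
  shows "sobolev_norm r u \<le> B"
proof -
  have "u \<in> sobolev r" by (rule sobolevI) (rule assms)
  then have "infsum (sobolev_term r u) UNIV \<le> B\<^sup>2"
    using assms by (intro infsum_le_finite_sums) (auto simp: sobolev_def)
  then show ?thesis unfolding sobolev_norm_def by (rule real_le_lsqrt[OF assms(2)])
qed

lemma coeff_le_sobolev_norm:
  assumes "u \<in> sobolev r"
  shows "cmod (fourier_coeff u \<xi>) \<le> sobolev_norm r u * bracket \<xi> powr (- r)"
proof -
  have "(cmod (fourier_coeff u \<xi>) * bracket \<xi> powr r)\<^sup>2 \<le> (sobolev_norm r u)\<^sup>2"
    using sobolev_sum_le[OF assms, of "{\<xi>}"] by (simp add: sobolev_term_square)
  then have "cmod (fourier_coeff u \<xi>) * bracket \<xi> powr r \<le> sobolev_norm r u"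
    by (rule power2_le_imp_le) (rule sobolev_norm_nonneg)
  then show ?thesis by (simp add: powr_minus divide_inverse[symmetric] pos_le_divide_eq)
qed

text \<open>Minkowski's inequality over each finite set of frequencies, with a bound that is
  independent of the set.\<close>

lemma sobolev_triangle:
  assumes u: "u \<in> sobolev r" and v: "v \<in> sobolev r"
  shows "u + v \<in> sobolev r" and "sobolev_norm r (u + v) \<le> sobolev_norm r u + sobolev_norm r v"
proof -
  have le: "sum (sobolev_term r (u + v)) S \<le> (sobolev_norm r u + sobolev_norm r v)\<^sup>2" if S: "finite S" for S
  proof -
    let ?g = "\<lambda>u \<xi>. cmod (fourier_coeff u \<xi>) * bracket \<xi> powr r"
    have L: "L2_set (?g u) S \<le> sobolev_norm r u" if "u \<in> sobolev r" for u
      unfolding L2_set_def using sobolev_sum_le[OF that S] sobolev_norm_nonneg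
      by (intro real_le_lsqrt) (auto simp: sobolev_term_square)
    have "L2_set (?g (u + v)) S \<le> L2_set (\<lambda>\<xi>. ?g u \<xi> + ?g v \<xi>) S"
      by (intro L2_set_mono)
        (auto simp: distrib_right[symmetric] intro!: mult_right_mono norm_triangle_ineq)
    also have "\<dots> \<le> L2_set (?g u) S + L2_set (?g v) S" by (rule L2_set_triangle_ineq)
    also have "\<dots> \<le> sobolev_norm r u + sobolev_norm r v" by (intro add_mono L u v)
    finally have "(L2_set (?g (u + v)) S)\<^sup>2 \<le> (sobolev_norm r u + sobolev_norm r v)\<^sup>2"
      by (intro power_mono L2_set_nonneg)
    then show ?thesis by (simp add: L2_set_def sum_nonneg sobolev_term_square)
  qed
  show "u + v \<in> sobolev r" by (rule sobolevI) (rule le)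
  show "sobolev_norm r (u + v) \<le> sobolev_norm r u + sobolev_norm r v"
    by (rule sobolev_norm_le[OF le]) (auto intro: add_nonneg_nonneg sobolev_norm_nonneg)
qed

lemma sobolev_scaleC:
  assumes "u \<in> sobolev r"
  shows "c *\<^sub>C u \<in> sobolev r"
proof -
  have "sobolev_term r (c *\<^sub>C u) = (\<lambda>\<xi>. (cmod c)\<^sup>2 * sobolev_term r u \<xi>)"
    by (simp add: fun_eq_iff sobolev_term_def norm_mult power_mult_distrib)
  then show ?thesis using assms by (simp add: sobolev_def summable_on_cmult_right)
qed

lemma scaleR_eq_scaleC: "a *\<^sub>R u = complex_of_real a *\<^sub>C u"
  by (rule distr_eqI) simp

lemma sobolev_scaleR: "u \<in> sobolev r \<Longrightarrow> a *\<^sub>R u \<in> sobolev r"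
  unfolding scaleR_eq_scaleC by (rule sobolev_scaleC)

lemma sobolev_diff: "u \<in> sobolev r \<Longrightarrow> v \<in> sobolev r \<Longrightarrow> u - v \<in> sobolev r"
  using sobolev_triangle(1)[of u r "(- 1) *\<^sub>R v"] sobolev_scaleR[of v r "- 1"] by simp

lemma sobolev_norm_minus_commute: "sobolev_norm r (u - v) = sobolev_norm r (v - u)"
  by (simp add: sobolev_norm_def sobolev_term_def norm_minus_commute)

text \<open>The topology in \<open>sobolev_topology\<close> is described by its metric only once the
  metric axioms hold; definiteness comes from the fact that a distribution with vanishing
  coefficients is zero.\<close>

interpretation sobolev: Metric_space "sobolev r" "\<lambda>u v. sobolev_norm r (u - v)" for r
proof
  show "0 \<le> sobolev_norm r (u - v)" for u v :: "'a torus_distr" by (rule sobolev_norm_nonneg)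
  show "sobolev_norm r (u - v) = sobolev_norm r (v - u)" for u v :: "'a torus_distr"
    by (rule sobolev_norm_minus_commute)
  show "(sobolev_norm r (u - v) = 0) = (u = v)" if "u \<in> sobolev r" "v \<in> sobolev r" for u v :: "'a torus_distr"
  proof
    assume "sobolev_norm r (u - v) = 0"
    then have "fourier_coeff (u - v) \<xi> = 0" for \<xi>
      using coeff_le_sobolev_norm[OF sobolev_diff[OF that], of \<xi>] by simp
    then show "u = v" by (intro distr_eqI) simp
  qed (simp add: sobolev_norm_def sobolev_term_def)
  show "sobolev_norm r (u - w) \<le> sobolev_norm r (u - v) + sobolev_norm r (v - w)"
    if "u \<in> sobolev r" "v \<in> sobolev r" "w \<in> sobolev r" for u v w :: "'a torus_distr"
    using sobolev_triangle(2)[OF sobolev_diff[OF that(1,2)] sobolev_diff[OF that(2,3)]] by simp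
qed

lemma topspace_sobolev [simp]: "topspace (sobolev_topology r) = sobolev r"
  by (simp add: sobolev_topology_def)

lemma limitin_sobolev:
  "limitin (sobolev_topology r) v l F \<longleftrightarrow>
     l \<in> sobolev r \<and> (\<forall>\<epsilon>>0. \<forall>\<^sub>F i in F. v i \<in> sobolev r \<and> sobolev_norm r (v i - l) < \<epsilon>)"
  unfolding sobolev_topology_def by (rule sobolev.limitin_metric)

lemma limitin_sobolev_coeff:
  assumes "limitin (sobolev_topology r) v l F"
  shows "((\<lambda>i. fourier_coeff (v i) \<xi>) \<longlongrightarrow> fourier_coeff l \<xi>) F"
proof (rule tendstoI)
  fix e :: real
  assume "e > 0"
  then have "e * bracket \<xi> powr r > 0" by simp
  then have "\<forall>\<^sub>F i in F. v i \<in> sobolev r \<and> sobolev_norm r (v i - l) < e * bracket \<xi> powr r"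
    using assms unfolding limitin_sobolev by blast
  then show "\<forall>\<^sub>F i in F. dist (fourier_coeff (v i) \<xi>) (fourier_coeff l \<xi>) < e"
  proof eventually_elim
    case (elim i)
    have "l \<in> sobolev r" using assms by (simp add: limitin_sobolev)
    then have "cmod (fourier_coeff (v i) \<xi> - fourier_coeff l \<xi>) \<le> sobolev_norm r (v i - l) * bracket \<xi> powr (- r)"
      using coeff_le_sobolev_norm[OF sobolev_diff, of "v i" r l \<xi>] elim by simp
    also have "\<dots> < (e * bracket \<xi> powr r) * bracket \<xi> powr (- r)"
      using elim by (intro mult_strict_right_mono) auto
    also have "\<dots> = e" by (simp add: powr_minus)
    finally show ?case by (simp add: dist_norm)
  qed
qed

lemma powr_le_power_nat: "(x::real) \<ge> 1 \<Longrightarrow> x powr a \<le> x ^ nat \<lceil>\<bar>a\<bar>\<rceil>"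
proof -
  assume x: "x \<ge> 1"
  have "a \<le> real (nat \<lceil>\<bar>a\<bar>\<rceil>)" by linarith
  then have "x powr a \<le> x powr real (nat \<lceil>\<bar>a\<bar>\<rceil>)" using x by (intro powr_mono) auto
  then show ?thesis using x powr_realpow[of x "nat \<lceil>\<bar>a\<bar>\<rceil>"] by linarith
qed

text \<open>The coefficients of a test function decay fast enough to pay for
  \<open>bracket \<xi> powr (- r)\<close>, so pairing is bounded by the Sobolev norm for every real
  \<open>r\<close>. This is the bridge from limits in \<open>H^r\<close> to the scalar limits of the
  weak formulation.\<close>

lemma limitin_sobolev_pairing:
  assumes lim: "limitin (sobolev_topology r) v l F"
  shows "((\<lambda>i. pairing (v i) \<psi>) \<longlongrightarrow> pairing l \<psi>) F"
proof -
  let ?a = "fourier_coeff (of_test \<psi>)"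
  define k where "k = nat \<lceil>\<bar>- r\<bar>\<rceil>"
  define K where "K = (\<Sum>\<^sub>\<infinity>\<xi>. cmod (?a \<xi>) * bracket \<xi> ^ k)"
  have s: "(\<lambda>\<xi>. cmod (?a \<xi>) * bracket \<xi> ^ k) summable_on UNIV"
    by (rule rapidD[OF rapid_fourier_coeff_of_test])
  have K0: "K \<ge> 0" unfolding K_def by (intro infsum_nonneg) (auto simp: less_imp_le)
  have le: "cmod (pairing w \<psi>) \<le> sobolev_norm r w * K" if w: "w \<in> sobolev r" for w
  proof -
    have le1: "cmod (?a \<xi> * fourier_coeff w (- \<xi>)) \<le> sobolev_norm r w * (cmod (?a \<xi>) * bracket \<xi> ^ k)" for \<xi>
    proof -
      have "cmod (fourier_coeff w (- \<xi>)) \<le> sobolev_norm r w * bracket \<xi> powr (- r)"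
        using coeff_le_sobolev_norm[OF w, of "- \<xi>"] by simp
      also have "\<dots> \<le> sobolev_norm r w * bracket \<xi> ^ k"
        unfolding k_def by (intro mult_left_mono powr_le_power_nat bracket_ge_1 sobolev_norm_nonneg)
      finally show ?thesis
        using mult_left_mono[of _ _ "cmod (?a \<xi>)"] by (fastforce simp: norm_mult mult_ac)
    qed
    have s1: "(\<lambda>\<xi>. sobolev_norm r w * (cmod (?a \<xi>) * bracket \<xi> ^ k)) summable_on UNIV"
      by (rule summable_on_cmult_right[OF s])
    have s2: "(\<lambda>\<xi>. cmod (?a \<xi> * fourier_coeff w (- \<xi>))) summable_on UNIV"
      by (rule summable_on_comparison_test[OF s1 le1]) auto
    have "cmod (pairing w \<psi>) \<le> (\<Sum>\<^sub>\<infinity>\<xi>. cmod (?a \<xi> * fourier_coeff w (- \<xi>)))"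
      using norm_infsum_bound[OF s2] infsumI[OF pairing_has_sum[of \<psi> w]] by simp
    also have "\<dots> \<le> (\<Sum>\<^sub>\<infinity>\<xi>. sobolev_norm r w * (cmod (?a \<xi>) * bracket \<xi> ^ k))"
      by (rule infsum_mono[OF s2 s1 le1])
    finally show ?thesis by (simp add: infsum_cmult_right' K_def)
  qed
  show ?thesis
  proof (rule tendstoI)
    fix e :: real
    assume "e > 0"
    then have "e / (K + 1) > 0" using K0 by simp
    then have "\<forall>\<^sub>F i in F. v i \<in> sobolev r \<and> sobolev_norm r (v i - l) < e / (K + 1)"
      using lim unfolding limitin_sobolev by blast
    then show "\<forall>\<^sub>F i in F. dist (pairing (v i) \<psi>) (pairing l \<psi>) < e"
    proof eventually_elim
      case (elim i)
      have "l \<in> sobolev r" using lim by (simp add: limitin_sobolev)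
      then have "cmod (pairing (v i - l) \<psi>) \<le> sobolev_norm r (v i - l) * K"
        using elim by (intro le sobolev_diff) auto
      also have "\<dots> \<le> (e / (K + 1)) * K"
        using elim K0 by (intro mult_right_mono) auto
      also have "\<dots> < e" using \<open>e > 0\<close> K0 by (simp add: field_simps)
      finally show ?case by (simp add: dist_norm minus_torus_distr.rep_eq)
    qed
  qed
qed

section \<open>Continuity in time and uniform tails\<close>

lemma atin_within_euclidean: "atin_within euclidean a S = at a within S"
  by (rule filter_eqI) (auto simp: eventually_atin_within eventually_at_topological)

text \<open>Continuity as a limit at every point is the form in which convergence of the
  coefficients and tail bounds are combined.\<close>

lemma C0_maps_iff:
  "u \<in> C0_maps T X \<longleftrightarrow> u \<in> extensional {0..T} \<and> (\<forall>t\<in>{0..T}. limitin X u (u t) (at t within {0..T}))"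
  unfolding C0_maps_def continuous_map_atin
  by (auto simp: atin_subtopology_within atin_within_euclidean)

text \<open>Only finite sums enter, so that sums never have to be interchanged with limits or integrals.\<close>

definition l2_tails :: "real \<Rightarrow> 'i set \<Rightarrow> ('i \<Rightarrow> int^'n::finite \<Rightarrow> complex) \<Rightarrow> bool" where
  "l2_tails r A c \<longleftrightarrow> (\<forall>\<epsilon>>0. \<exists>F. finite F \<and> (\<forall>i\<in>A. \<forall>S. finite S \<and> S \<inter> F = {} \<longrightarrow>
     (\<Sum>\<xi>\<in>S. (cmod (c i \<xi>))\<^sup>2 * bracket \<xi> powr (2 * r)) \<le> \<epsilon>))"

lemma sobolev_tails:
  assumes "u \<in> sobolev r" "\<epsilon> > 0"
  obtains F where "finite F" "\<And>S. finite S \<Longrightarrow> S \<inter> F = {} \<Longrightarrow> sum (sobolev_term r u) S \<le> \<epsilon>"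
proof -
  let ?L = "infsum (sobolev_term r u) UNIV"
  have sm: "sobolev_term r u summable_on UNIV" using assms by (simp add: sobolev_def)
  have "(sum (sobolev_term r u) \<longlongrightarrow> ?L) (finite_subsets_at_top UNIV)"
    using has_sum_infsum[OF sm] by (simp add: has_sum_def)
  then have "\<forall>\<^sub>F F in finite_subsets_at_top UNIV. dist (sum (sobolev_term r u) F) ?L < \<epsilon>"
    using assms(2) by (rule tendstoD)
  then obtain F where F: "finite F" "dist (sum (sobolev_term r u) F) ?L < \<epsilon>"
    unfolding eventually_finite_subsets_at_top by blast
  show ?thesis
  proof (rule that[OF F(1)])
    fix S :: "(int^'a) set"
    assume S: "finite S" "S \<inter> F = {}"
    have "sum (sobolev_term r u) S + sum (sobolev_term r u) F = sum (sobolev_term r u) (S \<union> F)"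
      using S F(1) by (simp add: sum.union_disjoint)
    also have "\<dots> \<le> ?L" using S F sm by (intro finite_sum_le_infsum) (auto simp: sobolev_term_nonneg)
    finally show "sum (sobolev_term r u) S \<le> \<epsilon>" using F(2) by (simp add: dist_real_def)
  qed
qed

lemma norm_diff_square_le: "(cmod (a - b))\<^sup>2 \<le> 2 * (cmod a)\<^sup>2 + 2 * (cmod b)\<^sup>2"
proof -
  have "(cmod (a - b))\<^sup>2 \<le> (cmod a + cmod b)\<^sup>2"
    by (intro power_mono norm_triangle_ineq4) auto
  then show ?thesis using sum_squares_bound[of "cmod a" "cmod b"] by (simp add: power2_sum)
qed

text \<open>Finitely many frequencies converge by hypothesis, and the rest is small uniformly in
  \<open>i\<close>. The index set \<open>A\<close> carries the uniform bounds and has to capture the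
  filter eventually.\<close>

lemma limitin_sobolevI:
  fixes l :: "'n::finite torus_distr"
  assumes l: "l \<in> sobolev r" and A: "\<forall>\<^sub>F i in F. i \<in> A" and v: "\<And>i. i \<in> A \<Longrightarrow> v i \<in> sobolev r"
    and tails: "l2_tails r A (\<lambda>i. fourier_coeff (v i))"
    and lim: "\<And>\<xi>. ((\<lambda>i. fourier_coeff (v i) \<xi>) \<longlongrightarrow> fourier_coeff l \<xi>) F"
  shows "limitin (sobolev_topology r) v l F"
  unfolding limitin_sobolev
proof (intro conjI allI impI l)
  fix \<epsilon> :: real
  assume "\<epsilon> > 0"
  \<comment> \<open>Five such portions make \<open>(\<epsilon> / 2)^2\<close>: one from the finite
    set \<open>G\<close>, and two each from the tails of \<open>v i\<close> and of \<open>l\<close>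
    after squaring their difference.\<close>
  define \<delta> where "\<delta> = \<epsilon>\<^sup>2 / 20"
  have "\<delta> > 0" using \<open>\<epsilon> > 0\<close> by (simp add: \<delta>_def)
  obtain F1 where "finite F1" and F1': "\<forall>i\<in>A. \<forall>S. finite S \<and> S \<inter> F1 = {} \<longrightarrow>
      (\<Sum>\<xi>\<in>S. (cmod (fourier_coeff (v i) \<xi>))\<^sup>2 * bracket \<xi> powr (2 * r)) \<le> \<delta>"
    using tails[unfolded l2_tails_def, rule_format, OF \<open>\<delta> > 0\<close>] by blast
  have F1: "finite F1" "\<And>i S. i \<in> A \<Longrightarrow> finite S \<Longrightarrow> S \<inter> F1 = {} \<Longrightarrow>
      (\<Sum>\<xi>\<in>S. (cmod (fourier_coeff (v i) \<xi>))\<^sup>2 * bracket \<xi> powr (2 * r)) \<le> \<delta>"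
    by (rule \<open>finite F1\<close>) (rule F1'[rule_format], auto)
  obtain F2 where F2: "finite F2" "\<And>S. finite S \<Longrightarrow> S \<inter> F2 = {} \<Longrightarrow> sum (sobolev_term r l) S \<le> \<delta>"
    using sobolev_tails[OF l \<open>\<delta> > 0\<close>] by metis
  define G where "G = F1 \<union> F2"
  have "((\<lambda>i. \<Sum>\<xi>\<in>G. (cmod (fourier_coeff (v i) \<xi> - fourier_coeff l \<xi>))\<^sup>2 * bracket \<xi> powr (2 * r))
      \<longlongrightarrow> (\<Sum>\<xi>\<in>G. (cmod (fourier_coeff l \<xi> - fourier_coeff l \<xi>))\<^sup>2 * bracket \<xi> powr (2 * r))) F"
    by (intro tendsto_intros lim)
  then have "((\<lambda>i. \<Sum>\<xi>\<in>G. sobolev_term r (v i - l) \<xi>) \<longlongrightarrow> 0) F"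
    by (simp add: sobolev_term_bracket)
  then have "\<forall>\<^sub>F i in F. dist (\<Sum>\<xi>\<in>G. sobolev_term r (v i - l) \<xi>) 0 < \<delta>"
    using \<open>\<delta> > 0\<close> by (rule tendstoD)
  then show "\<forall>\<^sub>F i in F. v i \<in> sobolev r \<and> sobolev_norm r (v i - l) < \<epsilon>"
    using A
  proof eventually_elim
    case (elim i)
    have "sobolev_norm r (v i - l) \<le> \<epsilon> / 2"
    proof (rule sobolev_norm_le)
      fix S :: "(int^'n) set"
      assume S: "finite S"
      have "sum (sobolev_term r (v i - l)) S = sum (sobolev_term r (v i - l)) (S \<inter> G) + sum (sobolev_term r (v i - l)) (S - G)"
        by (rule sum.Int_Diff[OF S])
      moreover have "sum (sobolev_term r (v i - l)) (S \<inter> G) \<le> \<delta>"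
      proof -
        have "sum (sobolev_term r (v i - l)) (S \<inter> G) \<le> sum (sobolev_term r (v i - l)) G"
          using F1(1) F2(1) by (intro sum_mono2) (auto simp: G_def sobolev_term_nonneg)
        then show ?thesis using elim by simp
      qed
      moreover have "sum (sobolev_term r (v i - l)) (S - G) \<le> 2 * \<delta> + 2 * \<delta>"
      proof -
        have "sum (sobolev_term r (v i - l)) (S - G)
            \<le> (\<Sum>\<xi>\<in>S - G. 2 * ((cmod (fourier_coeff (v i) \<xi>))\<^sup>2 * bracket \<xi> powr (2 * r)) + 2 * sobolev_term r l \<xi>)"
        proof (rule sum_mono)
          fix \<xi>
          show "sobolev_term r (v i - l) \<xi> \<le> 2 * ((cmod (fourier_coeff (v i) \<xi>))\<^sup>2 * bracket \<xi> powr (2 * r)) + 2 * sobolev_term r l \<xi>"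
            using mult_right_mono[OF norm_diff_square_le[of "fourier_coeff (v i) \<xi>" "fourier_coeff l \<xi>"], of "bracket \<xi> powr (2 * r)"]
            by (simp add: sobolev_term_bracket algebra_simps)
        qed
        also have "\<dots> = 2 * (\<Sum>\<xi>\<in>S - G. (cmod (fourier_coeff (v i) \<xi>))\<^sup>2 * bracket \<xi> powr (2 * r)) + 2 * sum (sobolev_term r l) (S - G)"
          by (simp add: sum.distrib sum_distrib_left)
        also have "\<dots> \<le> 2 * \<delta> + 2 * \<delta>"
        proof (intro add_mono mult_left_mono)
          show "(\<Sum>\<xi>\<in>S - G. (cmod (fourier_coeff (v i) \<xi>))\<^sup>2 * bracket \<xi> powr (2 * r)) \<le> \<delta>"
            using elim S by (intro F1) (auto simp: G_def)
          show "sum (sobolev_term r l) (S - G) \<le> \<delta>"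
            using S by (intro F2) (auto simp: G_def)
        qed auto
        finally show ?thesis .
      qed
      ultimately have "sum (sobolev_term r (v i - l)) S \<le> 5 * \<delta>" by linarith
      then show "sum (sobolev_term r (v i - l)) S \<le> (\<epsilon> / 2)\<^sup>2" by (simp add: \<delta>_def power_divide)
    qed (use \<open>\<epsilon> > 0\<close> in simp)
    then have "sobolev_norm r (v i - l) < \<epsilon>" using \<open>\<epsilon> > 0\<close> by linarith
    then show ?case using v[OF elim(2)] by (rule conjI[rotated])
  qed
qed

text \<open>Compactness as an induction principle: finitely many of the local neighbourhoods cover
  \<open>K\<close>, and the property is inherited by their union.\<close>

lemma compact_local_to_global:
  assumes K: "compact K"
    and local: "\<And>t. t \<in> K \<Longrightarrow> \<exists>U. open U \<and> t \<in> U \<and> Q (U \<inter> K)"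
    and empty: "Q {}" and Un: "\<And>A B. Q A \<Longrightarrow> Q B \<Longrightarrow> Q (A \<union> B)"
  shows "Q K"
proof -
  obtain U where U: "\<And>t. t \<in> K \<Longrightarrow> open (U t) \<and> t \<in> U t \<and> Q (U t \<inter> K)"
    using local by metis
  obtain D where D: "D \<subseteq> K" "finite D" "K \<subseteq> (\<Union>t\<in>D. U t)"
    using compactE_image[OF K, of K U] U by blast
  have "Q (\<Union>t\<in>D. U t \<inter> K)"
    using D(2,1) by (induction rule: finite_induct) (auto intro: empty Un simp: U)
  moreover have "(\<Union>t\<in>D. U t \<inter> K) = K" using D(3) by auto
  ultimately show ?thesis by simp
qed

text \<open>Near \<open>t\<close> the finite set that captures \<open>u t\<close> also captures
  \<open>u \<tau>\<close>: the tail of \<open>u \<tau>\<close> is at most twice the tail of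
  \<open>u t\<close> plus twice the squared distance, and each of the two is at most
  \<open>\<epsilon> / 4\<close>.\<close>

lemma sobolev_continuous_tails:
  assumes K: "compact K"
    and lim: "\<And>t. t \<in> K \<Longrightarrow> limitin (sobolev_topology r) u (u t) (at t within K)"
  shows "l2_tails r K (\<lambda>t. fourier_coeff (u t))"
  unfolding l2_tails_def
proof (intro allI impI)
  fix \<epsilon> :: real
  assume "\<epsilon> > 0"
  define Q where "Q A \<longleftrightarrow> (\<exists>F. finite F \<and> (\<forall>i\<in>A. \<forall>S. finite S \<and> S \<inter> F = {} \<longrightarrow>
     (\<Sum>\<xi>\<in>S. (cmod (fourier_coeff (u i) \<xi>))\<^sup>2 * bracket \<xi> powr (2 * r)) \<le> \<epsilon>))" for A
  have Q_empty: "Q {}" unfolding Q_def by (rule exI[of _ "{}"]) simp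
  have Q_Un: "Q (A \<union> B)" if A: "Q A" and B: "Q B" for A B
  proof -
    obtain F where F: "finite F" "\<forall>i\<in>A. \<forall>S. finite S \<and> S \<inter> F = {} \<longrightarrow>
       (\<Sum>\<xi>\<in>S. (cmod (fourier_coeff (u i) \<xi>))\<^sup>2 * bracket \<xi> powr (2 * r)) \<le> \<epsilon>"
      using A unfolding Q_def by blast
    obtain G where G: "finite G" "\<forall>i\<in>B. \<forall>S. finite S \<and> S \<inter> G = {} \<longrightarrow>
       (\<Sum>\<xi>\<in>S. (cmod (fourier_coeff (u i) \<xi>))\<^sup>2 * bracket \<xi> powr (2 * r)) \<le> \<epsilon>"
      using B unfolding Q_def by blast
    have "(\<Sum>\<xi>\<in>S. (cmod (fourier_coeff (u i) \<xi>))\<^sup>2 * bracket \<xi> powr (2 * r)) \<le> \<epsilon>"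
      if "i \<in> A \<union> B" "finite S" "S \<inter> (F \<union> G) = {}" for i S
      using F(2)[rule_format, of i S] G(2)[rule_format, of i S] that by blast
    then show ?thesis unfolding Q_def using F(1) G(1) by blast
  qed
  have "Q K"
  proof (rule compact_local_to_global[OF K, where Q = Q])
    show "Q {}" by (rule Q_empty)
    show "Q (A \<union> B)" if "Q A" "Q B" for A B using that by (rule Q_Un)
  next
    fix t
    assume t: "t \<in> K"
    have ut: "u t \<in> sobolev r" using lim[OF t] by (simp add: limitin_sobolev)
    obtain F where F: "finite F" "\<And>S. finite S \<Longrightarrow> S \<inter> F = {} \<Longrightarrow> sum (sobolev_term r (u t)) S \<le> \<epsilon> / 4"
      using sobolev_tails[OF ut, of "\<epsilon> / 4"] \<open>\<epsilon> > 0\<close> by auto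
    have "sqrt (\<epsilon> / 4) > 0" using \<open>\<epsilon> > 0\<close> by simp
    then have "\<forall>\<^sub>F \<tau> in at t within K. u \<tau> \<in> sobolev r \<and> sobolev_norm r (u \<tau> - u t) < sqrt (\<epsilon> / 4)"
      using lim[OF t] unfolding limitin_sobolev by blast
    then obtain U where U: "open U" "t \<in> U"
      "\<And>\<tau>. \<tau> \<in> U \<Longrightarrow> \<tau> \<noteq> t \<Longrightarrow> \<tau> \<in> K \<Longrightarrow> u \<tau> \<in> sobolev r \<and> sobolev_norm r (u \<tau> - u t) < sqrt (\<epsilon> / 4)"
      unfolding eventually_at_topological by blast
    have "(\<Sum>\<xi>\<in>S. (cmod (fourier_coeff (u \<tau>) \<xi>))\<^sup>2 * bracket \<xi> powr (2 * r)) \<le> \<epsilon>"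
      if \<tau>: "\<tau> \<in> U \<inter> K" and S: "finite S" "S \<inter> F = {}" for \<tau> S
    proof -
      \<comment> \<open>The filter \<open>at t within K\<close> leaves out \<open>t\<close> itself,
        so the case \<open>\<tau> = t\<close> is separate.\<close>
      have 1: "u \<tau> \<in> sobolev r" "sobolev_norm r (u \<tau> - u t) \<le> sqrt (\<epsilon> / 4)"
      proof -
        show "u \<tau> \<in> sobolev r" using U(3)[of \<tau>] \<tau> ut by (cases "\<tau> = t") blast+
        show "sobolev_norm r (u \<tau> - u t) \<le> sqrt (\<epsilon> / 4)"
        proof (cases "\<tau> = t")
          case True
          then show ?thesis using \<open>\<epsilon> > 0\<close> by (simp add: sobolev_norm_def sobolev_term_def)
        next
          case False
          then have "sobolev_norm r (u \<tau> - u t) < sqrt (\<epsilon> / 4)" using U(3)[of \<tau>] \<tau> by blast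
          then show ?thesis by (rule less_imp_le)
        qed
      qed
      have "sum (sobolev_term r (u \<tau> - u t)) S \<le> (sobolev_norm r (u \<tau> - u t))\<^sup>2"
        by (intro sobolev_sum_le sobolev_diff 1 ut S)
      also have "\<dots> \<le> (sqrt (\<epsilon> / 4))\<^sup>2" by (intro power_mono 1 sobolev_norm_nonneg)
      also have "\<dots> = \<epsilon> / 4" using \<open>\<epsilon> > 0\<close> by simp
      finally have 2: "sum (sobolev_term r (u \<tau> - u t)) S \<le> \<epsilon> / 4" .
      have "(\<Sum>\<xi>\<in>S. (cmod (fourier_coeff (u \<tau>) \<xi>))\<^sup>2 * bracket \<xi> powr (2 * r))
          \<le> (\<Sum>\<xi>\<in>S. 2 * sobolev_term r (u \<tau> - u t) \<xi> + 2 * sobolev_term r (u t) \<xi>)"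
      proof (rule sum_mono)
        fix \<xi>
        have "(cmod (fourier_coeff (u \<tau>) \<xi>))\<^sup>2 \<le> 2 * (cmod (fourier_coeff (u \<tau> - u t) \<xi>))\<^sup>2 + 2 * (cmod (fourier_coeff (u t) \<xi>))\<^sup>2"
          using norm_diff_square_le[of "fourier_coeff (u \<tau> - u t) \<xi>" "- fourier_coeff (u t) \<xi>"] by simp
        from mult_right_mono[OF this, of "bracket \<xi> powr (2 * r)"]
        show "(cmod (fourier_coeff (u \<tau>) \<xi>))\<^sup>2 * bracket \<xi> powr (2 * r)
            \<le> 2 * sobolev_term r (u \<tau> - u t) \<xi> + 2 * sobolev_term r (u t) \<xi>"
          by (simp add: sobolev_term_bracket algebra_simps)
      qed
      also have "\<dots> = 2 * sum (sobolev_term r (u \<tau> - u t)) S + 2 * sum (sobolev_term r (u t)) S"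
        by (simp add: sum.distrib sum_distrib_left)
      also have "\<dots> \<le> \<epsilon>" using 2 F(2)[OF S] by linarith
      finally show ?thesis .
    qed
    then have "Q (U \<inter> K)" unfolding Q_def using F(1) by blast
    then show "\<exists>U. open U \<and> t \<in> U \<and> Q (U \<inter> K)" using U(1,2) by blast
  qed
  then show "\<exists>F. finite F \<and> (\<forall>i\<in>K. \<forall>S. finite S \<and> S \<inter> F = {} \<longrightarrow>
     (\<Sum>\<xi>\<in>S. (cmod (fourier_coeff (u i) \<xi>))\<^sup>2 * bracket \<xi> powr (2 * r)) \<le> \<epsilon>)"
    unfolding Q_def .
qed

lemma fourier_distr_sobolev:
  fixes c :: "int^'n::finite \<Rightarrow> complex"
  assumes B: "\<And>S. finite S \<Longrightarrow> (\<Sum>\<xi>\<in>S. (cmod (c \<xi>))\<^sup>2 * bracket \<xi> powr (2 * r)) \<le> B"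
  shows "temperate c" and "fourier_distr c \<in> sobolev r"
proof -
  have "cmod (c \<xi>) \<le> sqrt B * bracket \<xi> ^ nat \<lceil>\<bar>- r\<bar>\<rceil>" for \<xi>
  proof -
    have "(cmod (c \<xi>) * bracket \<xi> powr r)\<^sup>2 \<le> B"
      using B[of "{\<xi>}"] by (simp add: power_mult_distrib power2_eq_square[of "_ powr _"] powr_add[symmetric])
    then have "cmod (c \<xi>) * bracket \<xi> powr r \<le> sqrt B" by (rule real_le_rsqrt)
    then have "cmod (c \<xi>) \<le> sqrt B * bracket \<xi> powr (- r)"
      by (simp add: powr_minus divide_inverse[symmetric] pos_le_divide_eq)
    also have "\<dots> \<le> sqrt B * bracket \<xi> ^ nat \<lceil>\<bar>- r\<bar>\<rceil>"
      using B[of "{}"] by (intro mult_left_mono powr_le_power_nat bracket_ge_1) auto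
    finally show ?thesis .
  qed
  then show t: "temperate c" unfolding temperate_def by blast
  show "fourier_distr c \<in> sobolev r"
    by (rule sobolevI[of _ _ B]) (simp add: sobolev_term_bracket fourier_coeff_fourier_distr[OF t] B)
qed

section \<open>Smooth functions\<close>

text \<open>A Sobolev-open set intersected with \<open>Cinf\<close> is one of the generating open
  sets, so the projective limit topology is finer than each of the Sobolev topologies.\<close>

lemma Cinf_limitinD:
  fixes v :: "'i \<Rightarrow> 'a::finite torus_distr"
  assumes "limitin Cinf_topology v l F"
  shows "limitin (sobolev_topology r) v l F"
proof -
  have op: "openin Cinf_topology (U \<inter> Cinf)" if "openin (sobolev_topology s) U" for U :: "'a torus_distr set" and s
    unfolding Cinf_topology_def by (rule topology_generated_by_Basis) (use that in blast)
  have ts: "topspace Cinf_topology \<subseteq> (Cinf :: 'a torus_distr set)"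
    unfolding Cinf_topology_def topology_generated_by_topspace by auto
  have l: "l \<in> Cinf" using assms ts by (auto simp: limitin_def)
  show ?thesis unfolding limitin_def
  proof (intro conjI allI impI)
    show "l \<in> topspace (sobolev_topology r)" using l by (simp add: Cinf_def)
    fix U
    assume U: "openin (sobolev_topology r) U \<and> l \<in> U"
    then have "\<forall>\<^sub>F x in F. v x \<in> U \<inter> Cinf"
      using op[of r U] l by (intro limitinD[OF assms]) auto
    then show "\<forall>\<^sub>F x in F. v x \<in> U" by (rule eventually_mono) auto
  qed
qed

lemma topspace_Cinf [simp]: "topspace Cinf_topology = Cinf"
proof -
  have "sobolev 0 \<inter> Cinf = (Cinf :: 'a torus_distr set)" by (auto simp: Cinf_def)
  moreover have "openin (sobolev_topology 0) (sobolev 0 :: 'a torus_distr set)"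
    using openin_topspace[of "sobolev_topology 0 :: 'a torus_distr topology"] by simp
  ultimately have "Cinf \<in> {U \<inter> Cinf |U r. openin (sobolev_topology r) (U :: 'a torus_distr set)}" by blast
  then show ?thesis
    unfolding Cinf_topology_def topology_generated_by_topspace by auto
qed

text \<open>Open sets arise from the generating ones by finite intersections and arbitrary unions,
  so convergence is checked by induction over this generation. Membership in \<open>Cinf\<close> is
  a separate assumption, since the Sobolev limits place \<open>v i\<close> in each space only from a
  point on that may depend on \<open>r\<close>.\<close>

lemma Cinf_limitinI:
  assumes lim: "\<And>r. limitin (sobolev_topology r) v l F" and ev: "\<forall>\<^sub>F i in F. v i \<in> Cinf"
  shows "limitin Cinf_topology v l F"
  unfolding limitin_def
proof (intro conjI allI impI)
  show "l \<in> topspace Cinf_topology" using lim by (simp add: Cinf_def limitin_sobolev)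
  fix U
  assume U: "openin Cinf_topology U \<and> l \<in> U"
  then have "generate_topology_on {U \<inter> Cinf |U r. openin (sobolev_topology r) U} U"
    unfolding Cinf_topology_def by (simp add: openin_topology_generated_by)
  then have "l \<in> U \<longrightarrow> (\<forall>\<^sub>F i in F. v i \<in> U)"
  proof induction
    case (Int a b)
    then show ?case by (auto intro: eventually_conj elim: eventually_mono)
  next
    case (UN K)
    show ?case
    proof
      assume "l \<in> \<Union>K"
      then obtain k where "k \<in> K" "l \<in> k" by blast
      then have "\<forall>\<^sub>F i in F. v i \<in> k" using UN by blast
      then show "\<forall>\<^sub>F i in F. v i \<in> \<Union>K" using \<open>k \<in> K\<close> by (auto elim: eventually_mono)
    qed
  next
    case (Basis s)
    then obtain V r where V: "s = V \<inter> Cinf" "openin (sobolev_topology r) V" by blast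
    show ?case
    proof
      assume "l \<in> s"
      then have "\<forall>\<^sub>F i in F. v i \<in> V" using limitinD[OF lim V(2)] V(1) by blast
      then show "\<forall>\<^sub>F i in F. v i \<in> s" using ev by eventually_elim (simp add: V(1))
    qed
  qed simp
  then show "\<forall>\<^sub>F i in F. v i \<in> U" using U by blast
qed

section \<open>Gevrey spaces\<close>

text \<open>Decay of the coefficients at this rate for some positive \<open>\<delta>\<close>
  characterizes Gevrey functions of order \<open>s\<close>; a smaller \<open>\<delta>\<close> goes
  with a larger \<open>h\<close>. Since \<open>0 powr (1 / s) = 0\<close>, the weight is 1 at
  frequency 0.\<close>

definition gevrey_weight :: "real \<Rightarrow> real \<Rightarrow> int^'n::finite \<Rightarrow> real" where
  "gevrey_weight s \<delta> \<xi> = exp (- \<delta> * norm (ivec \<xi>) powr (1 / s))"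

lemma gevrey_weight_pos [simp]: "0 < gevrey_weight s \<delta> \<xi>"
  by (simp add: gevrey_weight_def)

lemma gevrey_weight_neq_0 [simp]: "gevrey_weight s \<delta> \<xi> \<noteq> 0"
  by (simp add: gevrey_weight_def)

lemma gevrey_weight_mono: "\<delta> \<le> \<delta>' \<Longrightarrow> gevrey_weight s \<delta>' \<xi> \<le> gevrey_weight s \<delta> \<xi>"
  by (simp add: gevrey_weight_def mult_right_mono)

lemma gevrey_weight_add: "gevrey_weight s (\<delta> + \<delta>') \<xi> = gevrey_weight s \<delta> \<xi> * gevrey_weight s \<delta>' \<xi>"
  by (simp add: gevrey_weight_def exp_add[symmetric] algebra_simps)

text \<open>A single term of the exponential series is at most its sum.\<close>

lemma power_le_fact_exp: "y \<ge> 0 \<Longrightarrow> y ^ m \<le> fact m * exp (y::real)"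
proof -
  assume y: "y \<ge> 0"
  have sm: "summable (\<lambda>n. y ^ n /\<^sub>R fact n)" by (rule summable_exp_generic)
  have "(\<Sum>n\<in>{m}. y ^ n /\<^sub>R fact n) \<le> exp y"
    unfolding exp_def using y by (intro sum_le_suminf sm) auto
  then show ?thesis by (simp add: field_simps)
qed

lemma power_powr_swap: "x > 0 \<Longrightarrow> (x ^ m) powr s = (x powr s) ^ m" for x s :: real
  by (simp add: powr_realpow[symmetric] powr_powr mult.commute)

text \<open>With \<open>|\<xi>| = y\<^sup>s\<close>, the bound is the \<open>s\<close>-th power of \<open>(\<delta> y / s)\<^sup>m \<le> m! exp (\<delta> y / s)\<close>.\<close>

lemma power_gevrey_weight_le:
  assumes s: "s > 0" and \<delta>: "\<delta> > 0"
  shows "norm (ivec \<xi>) ^ m * gevrey_weight s \<delta> \<xi> \<le> ((s / \<delta>) powr s) ^ m * fact m powr s"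
proof (cases "norm (ivec \<xi>) = 0")
  case True
  then show ?thesis
    by (cases m) (auto simp: gevrey_weight_def)
next
  case False
  define y where "y = norm (ivec \<xi>) powr (1 / s)"
  have "norm (ivec \<xi>) > 0" using False by simp
  then have y: "y > 0" "norm (ivec \<xi>) = y powr s" using s by (auto simp: y_def powr_powr)
  define z where "z = \<delta> / s * y"
  have z: "z > 0" using y s \<delta> by (simp add: z_def)
  have "z ^ m * exp (- z) \<le> fact m"
    using power_le_fact_exp[of z m] z by (simp add: exp_minus field_simps)
  then have "(z ^ m * exp (- z)) powr s \<le> fact m powr s"
    using z s by (intro powr_mono2) auto
  also have "(z ^ m * exp (- z)) powr s = (z ^ m) powr s * exp (- z) powr s"
    by (rule powr_mult)
  also have "(z ^ m) powr s = ((\<delta> / s) powr s) ^ m * norm (ivec \<xi>) ^ m"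
  proof -
    have "z powr s = (\<delta> / s) powr s * norm (ivec \<xi>)" unfolding z_def y(2) by (rule powr_mult)
    then show ?thesis by (simp only: power_powr_swap[OF z] power_mult_distrib)
  qed
  also have "exp (- z) powr s = gevrey_weight s \<delta> \<xi>"
    using s by (simp add: powr_def gevrey_weight_def z_def y_def)
  finally have "((\<delta> / s) powr s) ^ m * (norm (ivec \<xi>) ^ m * gevrey_weight s \<delta> \<xi>) \<le> fact m powr s"
    by (simp only: mult.assoc)
  then have "((s / \<delta>) powr s) ^ m * (((\<delta> / s) powr s) ^ m * (norm (ivec \<xi>) ^ m * gevrey_weight s \<delta> \<xi>))
      \<le> ((s / \<delta>) powr s) ^ m * fact m powr s"
    by (intro mult_left_mono) auto
  moreover have "((s / \<delta>) powr s) ^ m * ((\<delta> / s) powr s) ^ m = 1"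
    using s \<delta> unfolding power_mult_distrib[symmetric] by (subst powr_mult[symmetric]) auto
  ultimately show ?thesis by (simp only: mult.assoc[symmetric] mult_1_left)
qed

lemma bracket_gevrey_weight_bounded:
  assumes "s > 0" "\<delta> > 0"
  shows "\<exists>M\<ge>0. \<forall>\<xi>::int^'n::finite. bracket \<xi> ^ m * gevrey_weight s \<delta> \<xi> \<le> M"
proof (intro exI conjI allI)
  let ?M = "2 ^ m * (1 + ((s / \<delta>) powr s) ^ m * fact m powr s)"
  show "?M \<ge> 0" by (intro mult_nonneg_nonneg add_nonneg_nonneg) auto
  fix \<xi> :: "int^'n"
  have "bracket \<xi> ^ m \<le> (2 * max 1 (norm (ivec \<xi>))) ^ m"
    by (intro power_mono) (auto simp: bracket_def)
  also have "\<dots> \<le> 2 ^ m * (1 + norm (ivec \<xi>) ^ m)"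
    by (auto simp: power_mult_distrib max_def)
  finally have "bracket \<xi> ^ m * gevrey_weight s \<delta> \<xi> \<le> 2 ^ m * (1 + norm (ivec \<xi>) ^ m) * gevrey_weight s \<delta> \<xi>"
    by (intro mult_right_mono) (auto simp: less_imp_le)
  also have "\<dots> = 2 ^ m * (gevrey_weight s \<delta> \<xi> + norm (ivec \<xi>) ^ m * gevrey_weight s \<delta> \<xi>)"
    by (simp add: algebra_simps)
  also have "\<dots> \<le> ?M"
    using power_gevrey_weight_le[OF assms, of \<xi> m] assms
    by (intro mult_left_mono add_mono) (auto simp: gevrey_weight_def)
  finally show "bracket \<xi> ^ m * gevrey_weight s \<delta> \<xi> \<le> ?M" .
qed

lemma gevrey_weight_summable:
  assumes "s > 0" "\<delta> > 0"
  shows "(gevrey_weight s \<delta> :: int^'n::finite \<Rightarrow> real) summable_on UNIV"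
proof -
  obtain M where M: "M \<ge> 0" "\<And>\<xi>::int^'n. bracket \<xi> ^ (2 * CARD('n)) * gevrey_weight s \<delta> \<xi> \<le> M"
    using bracket_gevrey_weight_bounded[OF assms, of "2 * CARD('n)"] by blast
  have "(\<lambda>\<xi>::int^'n. norm (gevrey_weight s \<delta> \<xi>)) summable_on UNIV"
    by (rule summable_on_bracket_decay[where M = M]) (use M in \<open>simp add: mult.commute less_imp_le\<close>)
  then show ?thesis by (simp add: less_imp_le)
qed

text \<open>Half of the exponent absorbs the polynomial weight, the other half provides
  summability.\<close>

lemma rapid_gevrey:
  fixes c :: "int^'n::finite \<Rightarrow> complex"
  assumes "s > 0" "\<delta> > 0" and le: "\<And>\<xi>. cmod (c \<xi>) \<le> C * gevrey_weight s \<delta> \<xi>"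
  shows "rapid c"
  unfolding rapid_def
proof
  fix k
  have \<delta>2: "\<delta> / 2 > 0" using assms by simp
  obtain M where M: "M \<ge> 0" "\<And>\<xi>::int^'n. bracket \<xi> ^ k * gevrey_weight s (\<delta> / 2) \<xi> \<le> M"
    using bracket_gevrey_weight_bounded[OF assms(1) \<delta>2, of k] by blast
  have C0: "C \<ge> 0" using order_trans[OF norm_ge_zero le[of 0]] by (simp add: gevrey_weight_def)
  show "(\<lambda>\<xi>. cmod (c \<xi>) * bracket \<xi> ^ k) summable_on UNIV"
  proof (rule summable_on_comparison_test)
    show "(\<lambda>\<xi>::int^'n. C * M * gevrey_weight s (\<delta> / 2) \<xi>) summable_on UNIV"
      by (intro summable_on_cmult_right gevrey_weight_summable assms \<delta>2)
    fix \<xi>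
    have "cmod (c \<xi>) * bracket \<xi> ^ k \<le> C * gevrey_weight s (\<delta> / 2 + \<delta> / 2) \<xi> * bracket \<xi> ^ k"
      using le[of \<xi>] by (intro mult_right_mono) (auto simp: less_imp_le)
    also have "\<dots> = C * ((bracket \<xi> ^ k * gevrey_weight s (\<delta> / 2) \<xi>) * gevrey_weight s (\<delta> / 2) \<xi>)"
      by (simp only: gevrey_weight_add mult_ac)
    also have "\<dots> \<le> C * (M * gevrey_weight s (\<delta> / 2) \<xi>)"
      by (intro mult_left_mono mult_right_mono M C0) (auto simp: less_imp_le)
    finally show "cmod (c \<xi>) * bracket \<xi> ^ k \<le> C * M * gevrey_weight s (\<delta> / 2) \<xi>" by (simp add: mult.assoc)
  qed (auto simp: less_imp_le)
qed

section \<open>Gevrey estimates and exponential decay of the coefficients\<close>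

lemma coord_enum_props: "distinct (coord_enum :: 'n::finite list)" "set (coord_enum :: 'n list) = UNIV"
proof -
  have "\<exists>js :: 'n list. distinct js \<and> set js = UNIV"
    using finite_distinct_list[of "UNIV :: 'n set"] by auto
  then have "distinct (coord_enum :: 'n list) \<and> set (coord_enum :: 'n list) = UNIV"
    unfolding coord_enum_def by (rule someI_ex)
  then show "distinct (coord_enum :: 'n list)" "set (coord_enum :: 'n list) = UNIV" by auto
qed

text \<open>A multi-index spelled out as a list of directions, so that the results on iterated
  derivatives along lists apply.\<close>

definition multi_list :: "nat^'n::finite \<Rightarrow> 'n list" where
  "multi_list \<alpha> = concat (map (\<lambda>j. replicate (\<alpha> $ j) j) coord_enum)"

lemma length_multi_list: "length (multi_list \<alpha>) = multi_abs \<alpha>"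
proof -
  have "length (multi_list \<alpha>) = sum_list (map (\<lambda>j. \<alpha> $ j) coord_enum)"
    by (simp add: multi_list_def length_concat o_def)
  also have "\<dots> = (\<Sum>j\<in>UNIV. \<alpha> $ j)"
    by (simp only: sum_list_distinct_conv_sum_set[OF coord_enum_props(1)] coord_enum_props(2))
  finally show ?thesis by (simp add: multi_abs_def)
qed

lemma norm_multi_D: "cmod (multi_D \<alpha> F x) = cmod (test_apply (foldr test_deriv (multi_list \<alpha>) F) x)"
proof -
  have "foldr (\<lambda>j. test_deriv j ^^ (\<alpha> $ j)) js G = foldr test_deriv (concat (map (\<lambda>j. replicate (\<alpha> $ j) j) js)) G"
    for js and G :: "'a torus_test"
  proof (induction js)
    case (Cons j js)
    have "(test_deriv j ^^ m) H = foldr test_deriv (replicate m j) H" for m and H :: "'a torus_test"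
      by (induction m) auto
    then show ?case using Cons by simp
  qed simp
  then show ?thesis by (simp add: multi_D_def multi_list_def norm_mult norm_power norm_divide)
qed

text \<open>Summing the coefficient bounds \<open>|\<xi>\<^sub>j|\<^sup>m |c(\<xi>)| \<le> C h\<^sup>m m!\<^sup>s\<close>, raised to the power \<open>1/s\<close> and
  weighted by \<open>2\<^sup>-\<^sup>m\<close>, produces the exponential without any optimization in \<open>m\<close>.\<close>

lemma gevrey_decay_from_moments:
  fixes x z :: real
  assumes s: "s > 0" and h: "h > 0" and C: "C > 0" and x: "x \<ge> 0" and z: "z \<ge> 0"
    and le: "\<And>m. x ^ m * z \<le> C * h ^ m * fact m powr s"
  shows "z \<le> C * 2 powr s * exp (- (s / (2 * h powr (1 / s))) * x powr (1 / s))"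
proof (cases "z = 0")
  case False
  then have z: "z > 0" using z by simp
  \<comment> \<open>Scaled so that the \<open>1 / s\<close>-th power of the moment bound reads
    \<open>y ^ m / fact m \<le> q\<close> for every \<open>m\<close>.\<close>
  define y where "y = x powr (1 / s) / h powr (1 / s)"
  define q where "q = (C / z) powr (1 / s)"
  have q: "q > 0" using C z by (simp add: q_def)
  have y: "y \<ge> 0" using h by (simp add: y_def)
  have qm: "y ^ m / fact m \<le> q" for m
  proof -
    have "(x ^ m / h ^ m / fact m powr s) powr (1 / s) \<le> (C / z) powr (1 / s)"
      using le[of m] h z s x by (intro powr_mono2) (auto simp: field_simps)
    also have "(x ^ m / h ^ m / fact m powr s) powr (1 / s) = y ^ m / fact m"
    proof (cases "x = 0")
      case True
      then show ?thesis using s h by (cases m) (auto simp: y_def powr_divide powr_powr)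
    next
      case False
      then have "x > 0" using x by simp
      then have y0: "y > 0" using h by (simp add: y_def)
      have "y powr s = x / h"
        using \<open>x > 0\<close> h s unfolding y_def by (subst powr_divide) (auto simp: powr_powr)
      moreover have "(y ^ m) powr s = (y powr s) ^ m"
        by (rule power_powr_swap[OF y0])
      ultimately have "(y ^ m / fact m) powr s = x ^ m / h ^ m / fact m powr s"
        using y0 by (subst powr_divide) (auto simp: power_divide)
      then have "(x ^ m / h ^ m / fact m powr s) powr (1 / s) = ((y ^ m / fact m) powr s) powr (1 / s)" by simp
      then show ?thesis using s y0 by (simp add: powr_powr)
    qed
    finally show ?thesis by (simp add: q_def)
  qed
  have "exp (y / 2) \<le> 2 * q"
  proof -
    have sums: "(\<lambda>m. (y / 2) ^ m /\<^sub>R fact m) sums exp (y / 2)" by (rule exp_converges)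
    have geo: "(\<lambda>m. q * (1 / 2) ^ m) sums (q * (1 / (1 - 1 / 2)))"
      by (intro sums_mult geometric_sums) auto
    have "(y / 2) ^ m /\<^sub>R fact m \<le> q * (1 / 2) ^ m" for m
      using mult_right_mono[OF qm[of m], of "(1 / 2) ^ m"] by (simp add: power_divide field_simps)
    from sums_le[OF this sums geo] show ?thesis by simp
  qed
  then have "exp (y / 2) powr s \<le> (2 * q) powr s" using s by (intro powr_mono2) auto
  also have "(2 * q) powr s = 2 powr s * (C / z)"
    using s C z q by (simp add: powr_mult q_def powr_powr)
  finally have "exp (s * y / 2) \<le> 2 powr s * C / z" by (simp add: powr_def)
  then have "z * exp (s * y / 2) \<le> C * 2 powr s" using z by (simp add: pos_le_divide_eq mult_ac)
  then have "z \<le> C * 2 powr s * exp (- (s * y / 2))" by (simp add: exp_minus field_simps)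
  then show ?thesis using h by (simp add: y_def field_simps)
qed (use C in simp)

text \<open>Pure derivatives along the largest coordinate of \<open>\<xi>\<close> suffice; passing
  from this coordinate to the norm costs a factor N per derivative, which is why \<open>h\<close>
  appears multiplied by \<open>CARD('n)\<close>. The rate depends on \<open>s\<close>,
  \<open>h\<close> and N only, and \<open>C\<close> enters linearly.\<close>

lemma gevrey_coeff_decay:
  fixes F :: "'n::finite torus_test"
  assumes s: "s > 0" and h: "h > 0" and C: "C > 0"
    and le: "\<And>\<alpha> x. cmod (multi_D \<alpha> F x) \<le> C * h ^ multi_abs \<alpha> * fact (multi_abs \<alpha>) powr s"
  shows "cmod (fourier_coeff (of_test F) \<xi>)
    \<le> C * 2 powr s * gevrey_weight s (s / (2 * (real CARD('n) * h) powr (1 / s))) \<xi>"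
proof -
  define b where "b = Max (range (\<lambda>j. \<bar>real_of_int (\<xi> $ j)\<bar>))"
  have "b \<in> range (\<lambda>j. \<bar>real_of_int (\<xi> $ j)\<bar>)" unfolding b_def by (intro Max_in) auto
  then obtain j where j: "b = \<bar>real_of_int (\<xi> $ j)\<bar>" by blast
  have leb: "\<bar>real_of_int (\<xi> $ i)\<bar> \<le> b" for i unfolding b_def by (intro Max_ge) auto
  have "norm (ivec \<xi>) \<le> (\<Sum>i\<in>(UNIV::'n set). b)"
    by (rule order_trans[OF norm_ivec_le_sum sum_mono[OF leb]])
  then have nb: "norm (ivec \<xi>) \<le> real CARD('n) * b" by simp
  have "norm (ivec \<xi>) ^ m * cmod (fourier_coeff (of_test F) \<xi>) \<le> C * (real CARD('n) * h) ^ m * fact m powr s" for m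
  proof -
    define \<alpha> :: "nat^'n" where "\<alpha> = (\<chi> i. if i = j then m else 0)"
    have abs: "multi_abs \<alpha> = m" by (simp add: multi_abs_def \<alpha>_def)
    have sym: "cmod (derivative_symbol (multi_list \<alpha>) \<xi>) = b ^ m"
    proof -
      \<comment> \<open>Generalized to arbitrary distinct lists for the induction; only the entry
        \<open>j\<close> contributes a factor.\<close>
      have "cmod (derivative_symbol (concat (map (\<lambda>i. replicate (\<alpha> $ i) i) js)) \<xi>) = (if j \<in> set js then b ^ m else 1)"
        if "distinct js" for js
        using that
      proof (induction js)
        case (Cons i js)
        have app: "derivative_symbol (as @ bs) \<xi> = derivative_symbol as \<xi> * derivative_symbol bs \<xi>" for as bs :: "'n list"
          by (simp add: derivative_symbol_def)
        show ?case using Cons by (auto simp: app norm_mult derivative_symbol_replicate j \<alpha>_def)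
      qed simp
      then show ?thesis unfolding multi_list_def using coord_enum_props[where 'n = 'n] by simp
    qed
    have "norm (ivec \<xi>) ^ m * cmod (fourier_coeff (of_test F) \<xi>) \<le> (real CARD('n) * b) ^ m * cmod (fourier_coeff (of_test F) \<xi>)"
      by (intro mult_right_mono power_mono nb) auto
    also have "\<dots> = real CARD('n) ^ m * cmod (fourier_coeff (of_test (foldr test_deriv (multi_list \<alpha>) F)) \<xi>)"
      by (simp add: fourier_coeff_of_test_derivs norm_mult sym power_mult_distrib)
    also have "\<dots> \<le> real CARD('n) ^ m * (C * h ^ m * fact m powr s)"
      using le[of \<alpha>] by (intro mult_left_mono norm_fourier_coeff_of_test_le) (auto simp: norm_multi_D abs)
    finally show ?thesis by (simp add: power_mult_distrib mult_ac)
  qed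
  then show ?thesis
    unfolding gevrey_weight_def using s h C by (intro gevrey_decay_from_moments) auto
qed

lemma gevrey_D:
  fixes u :: "'n::finite torus_distr"
  assumes "u \<in> gevrey s" "s > 0"
  obtains C \<delta> where "C > 0" "\<delta> > 0" "\<And>\<xi>. cmod (fourier_coeff u \<xi>) \<le> C * gevrey_weight s \<delta> \<xi>"
proof -
  obtain F C h where u: "u = of_test F" and "C > 0" "h > 0"
    and le: "\<And>\<alpha> x. cmod (multi_D \<alpha> F x) \<le> C * h ^ multi_abs \<alpha> * fact (multi_abs \<alpha>) powr s"
    using assms unfolding gevrey_def by blast
  show ?thesis
  proof (rule that)
    show "C * 2 powr s > 0" using \<open>C > 0\<close> by simp
    show "s / (2 * (real CARD('n) * h) powr (1 / s)) > 0" using assms \<open>h > 0\<close> by simp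
    show "cmod (fourier_coeff u \<xi>) \<le> C * 2 powr s * gevrey_weight s (s / (2 * (real CARD('n) * h) powr (1 / s))) \<xi>" for \<xi>
      unfolding u by (rule gevrey_coeff_decay[OF assms(2) \<open>h > 0\<close> \<open>C > 0\<close> le])
  qed
qed

text \<open>The step \<open>h\<close> depends on \<open>\<delta>\<close> only, and the constant is linear in the weighted \<open>\<ell>\<^sup>1\<close> norm of the
  coefficients; this is what convergence in the inductive limit topology requires.\<close>

lemma fourier_test_gevrey_bound:
  fixes c :: "int^'n::finite \<Rightarrow> complex"
  assumes s: "s > 0" and \<delta>: "\<delta> > 0" and c: "rapid c"
    and sm: "(\<lambda>\<xi>. cmod (c \<xi>) / gevrey_weight s \<delta> \<xi>) summable_on UNIV"
  shows "cmod (multi_D \<alpha> (fourier_test c) x)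
    \<le> (\<Sum>\<^sub>\<infinity>\<xi>. cmod (c \<xi>) / gevrey_weight s \<delta> \<xi>) * ((s / \<delta>) powr s) ^ multi_abs \<alpha> * fact (multi_abs \<alpha>) powr s"
proof -
  let ?js = "multi_list \<alpha>" and ?m = "multi_abs \<alpha>"
  let ?K = "((s / \<delta>) powr s) ^ ?m * fact ?m powr s"
  have r: "rapid (\<lambda>\<xi>. derivative_symbol ?js \<xi> * c \<xi>)" by (rule rapid_derivative_symbol[OF c])
  have le: "cmod (derivative_symbol ?js \<xi> * c \<xi>) \<le> cmod (c \<xi>) / gevrey_weight s \<delta> \<xi> * ?K" for \<xi>
  proof -
    have "cmod (derivative_symbol ?js \<xi>) \<le> norm (ivec \<xi>) ^ ?m"
      using norm_derivative_symbol_le[of ?js \<xi>] by (simp add: length_multi_list)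
    also have "\<dots> \<le> ?K / gevrey_weight s \<delta> \<xi>"
      using power_gevrey_weight_le[OF s \<delta>, of \<xi> ?m] by (simp add: pos_le_divide_eq)
    finally have "cmod (c \<xi>) * cmod (derivative_symbol ?js \<xi>) \<le> cmod (c \<xi>) * (?K / gevrey_weight s \<delta> \<xi>)"
      by (rule mult_left_mono) simp
    then show ?thesis by (simp add: norm_mult mult_ac)
  qed
  have "cmod (multi_D \<alpha> (fourier_test c) x) \<le> (\<Sum>\<^sub>\<infinity>\<xi>. cmod (derivative_symbol ?js \<xi> * c \<xi>))"
    unfolding norm_multi_D test_derivs_fourier_test[OF c] by (rule norm_fourier_sum_le[OF r])
  also have "\<dots> \<le> (\<Sum>\<^sub>\<infinity>\<xi>. cmod (c \<xi>) / gevrey_weight s \<delta> \<xi> * ?K)"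
    by (rule infsum_mono[OF rapid_norm_summable[OF r] summable_on_cmult_left[OF sm] le])
  also have "\<dots> = (\<Sum>\<^sub>\<infinity>\<xi>. cmod (c \<xi>) / gevrey_weight s \<delta> \<xi>) * ?K"
    by (rule infsum_cmult_left')
  finally show ?thesis by (simp add: mult.assoc)
qed

lemma of_test_in_Cinf: "of_test F \<in> Cinf"
  unfolding Cinf_def
proof
  fix r :: real
  define k where "k = nat \<lceil>\<bar>2 * r\<bar>\<rceil>"
  let ?c = "fourier_coeff (of_test F)"
  have "sobolev_term r (of_test F) summable_on UNIV"
  proof (rule summable_on_comparison_test)
    \<comment> \<open>One of the two factors of the squared coefficient is bounded by
      \<open>M\<close>, which leaves an absolutely convergent weighted series.\<close>
    define M where "M = infsum (\<lambda>\<xi>. cmod (?c \<xi>)) UNIV"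
    show "(\<lambda>\<xi>. M * (cmod (?c \<xi>) * bracket \<xi> ^ k)) summable_on UNIV"
      by (intro summable_on_cmult_right rapidD rapid_fourier_coeff_of_test)
    fix \<xi>
    have "cmod (?c \<xi>) \<le> M"
      using finite_sum_le_infsum[OF rapid_norm_summable[OF rapid_fourier_coeff_of_test[of F]], of "{\<xi>}"]
      by (simp add: M_def)
    moreover from this have "M \<ge> 0" using norm_ge_zero order_trans by blast
    ultimately have "cmod (?c \<xi>) * cmod (?c \<xi>) * bracket \<xi> powr (2 * r) \<le> M * cmod (?c \<xi>) * bracket \<xi> ^ k"
      unfolding k_def by (intro mult_mono powr_le_power_nat bracket_ge_1) auto
    then show "sobolev_term r (of_test F) \<xi> \<le> M * (cmod (?c \<xi>) * bracket \<xi> ^ k)"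
      by (simp add: sobolev_term_bracket power2_eq_square mult.assoc)
  qed (rule sobolev_term_nonneg)
  then show "of_test F \<in> sobolev r" by (simp add: sobolev_def)
qed

lemma of_test_fourier_test:
  assumes "rapid c" and "\<And>\<xi>. fourier_coeff u \<xi> = c \<xi>"
  shows "u = of_test (fourier_test c)"
  by (rule distr_eqI) (simp add: assms fourier_coeff_fourier_test)

text \<open>Half of the decay rate goes into the weight of the norm, and the remaining half makes
  the sum converge.\<close>

lemma gevrey_weighted_summable:
  fixes c :: "int^'n::finite \<Rightarrow> complex"
  assumes s: "s > 0" and \<delta>: "\<delta> > 0" and le: "\<And>\<xi>. cmod (c \<xi>) \<le> C * gevrey_weight s \<delta> \<xi>"
  shows "cmod (c \<xi>) / gevrey_weight s (\<delta> / 2) \<xi> \<le> C * gevrey_weight s (\<delta> / 2) \<xi>"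
    and "(\<lambda>\<xi>. cmod (c \<xi>) / gevrey_weight s (\<delta> / 2) \<xi>) summable_on UNIV"
proof -
  show le2: "cmod (c \<xi>) / gevrey_weight s (\<delta> / 2) \<xi> \<le> C * gevrey_weight s (\<delta> / 2) \<xi>" for \<xi>
    using le[of \<xi>] gevrey_weight_add[of s "\<delta> / 2" "\<delta> / 2" \<xi>] by (simp add: pos_divide_le_eq mult.assoc)
  have "\<delta> / 2 > 0" using \<delta> by simp
  from summable_on_cmult_right[OF gevrey_weight_summable[OF s this]]
  show "(\<lambda>\<xi>. cmod (c \<xi>) / gevrey_weight s (\<delta> / 2) \<xi>) summable_on UNIV"
    by (rule summable_on_comparison_test[OF _ le2]) (auto simp: less_imp_le)
qed

lemma gevreyI:
  fixes u :: "'n::finite torus_distr"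
  assumes s: "s > 0" and \<delta>: "\<delta> > 0" and le: "\<And>\<xi>. cmod (fourier_coeff u \<xi>) \<le> C * gevrey_weight s \<delta> \<xi>"
  shows "u \<in> gevrey s"
proof -
  let ?c = "fourier_coeff u"
  have r: "rapid ?c" by (rule rapid_gevrey[OF assms])
  have u: "u = of_test (fourier_test ?c)" by (rule of_test_fourier_test[OF r]) simp
  have \<delta>2: "\<delta> / 2 > 0" using \<delta> by simp
  define S where "S = (\<Sum>\<^sub>\<infinity>\<xi>. cmod (?c \<xi>) / gevrey_weight s (\<delta> / 2) \<xi>)"
  have S0: "S \<ge> 0" unfolding S_def by (intro infsum_nonneg) (auto simp: less_imp_le)
  \<comment> \<open>The definition asks for a strictly positive constant, and \<open>S\<close>
    vanishes for \<open>u = 0\<close>.\<close>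
  have b: "cmod (multi_D \<alpha> (fourier_test ?c) x) \<le> (S + 1) * ((s / (\<delta> / 2)) powr s) ^ multi_abs \<alpha> * fact (multi_abs \<alpha>) powr s" for \<alpha> x
  proof -
    have "cmod (multi_D \<alpha> (fourier_test ?c) x) \<le> S * ((s / (\<delta> / 2)) powr s) ^ multi_abs \<alpha> * fact (multi_abs \<alpha>) powr s"
      unfolding S_def by (rule fourier_test_gevrey_bound[OF s \<delta>2 r gevrey_weighted_summable(2)[OF s \<delta> le]])
    also have "\<dots> \<le> (S + 1) * ((s / (\<delta> / 2)) powr s) ^ multi_abs \<alpha> * fact (multi_abs \<alpha>) powr s"
      by (intro mult_right_mono) auto
    finally show ?thesis .
  qed
  have "S + 1 > 0" "(s / (\<delta> / 2)) powr s > 0" using S0 s \<delta> by auto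
  then have "\<exists>F. u = of_test F \<and> (\<exists>C>0. \<exists>h>0. \<forall>\<alpha> x. cmod (multi_D \<alpha> F x) \<le> C * h ^ multi_abs \<alpha> * fact (multi_abs \<alpha>) powr s)"
    using u b by blast
  moreover have "u \<in> Cinf" using u of_test_in_Cinf by metis
  ultimately show ?thesis unfolding gevrey_def by blast
qed

lemma gevrey_norm_leI:
  assumes h: "h > 0" and le: "\<And>\<alpha> x. cmod (multi_D \<alpha> F x) \<le> B * h ^ multi_abs \<alpha> * fact (multi_abs \<alpha>) powr s"
  shows "gevrey_norm h s F \<le> ennreal B"
  unfolding gevrey_norm_def
proof (rule SUP_least)
  fix \<alpha> :: "nat^'a"
  let ?w = "h ^ multi_abs \<alpha> * fact (multi_abs \<alpha>) powr s"
  have w: "?w > 0" using h by simp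
  have "(SUP x. ennreal (cmod (multi_D \<alpha> F x))) \<le> ennreal (B * ?w)"
    by (intro SUP_least ennreal_leI) (use le[of \<alpha>] in \<open>simp add: mult.assoc\<close>)
  then have "(SUP x. ennreal (cmod (multi_D \<alpha> F x))) / ennreal ?w \<le> ennreal (B * ?w) / ennreal ?w"
    by (rule divide_right_mono_ennreal)
  also have "\<dots> = ennreal B"
  proof -
    \<comment> \<open>The multi-index 0 shows that \<open>B\<close> is nonnegative, so that
      \<open>ennreal\<close> does not truncate it.\<close>
    have "B \<ge> 0"
      using order_trans[OF norm_ge_zero le[of 0 0]] by (simp add: multi_abs_def)
    then have "ennreal (B * ?w) / ennreal ?w = ennreal (B * ?w / ?w)"
      by (rule divide_ennreal[OF mult_nonneg_nonneg[OF _ less_imp_le[OF w]] w])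
    also have "B * ?w / ?w = B" using w by (intro nonzero_mult_div_cancel_right) linarith
    finally show ?thesis .
  qed
  finally show "(SUP x. ennreal (cmod (multi_D \<alpha> F x))) / ennreal ?w \<le> ennreal B" .
qed

lemma gevrey_norm_lessD:
  assumes h: "h > 0" and less: "gevrey_norm h s F < ennreal \<epsilon>"
  shows "cmod (multi_D \<alpha> F x) \<le> \<epsilon> * h ^ multi_abs \<alpha> * fact (multi_abs \<alpha>) powr s"
proof -
  let ?w = "h ^ multi_abs \<alpha> * fact (multi_abs \<alpha>) powr s"
  have w: "?w > 0" using h by simp
  have \<epsilon>: "\<epsilon> > 0" using less by (metis ennreal_less_zero_iff not_less_zero order_le_less_trans zero_le)
  have "ennreal (cmod (multi_D \<alpha> F x) / ?w) = ennreal (cmod (multi_D \<alpha> F x)) / ennreal ?w"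
    using w by (simp add: divide_ennreal)
  also have "\<dots> \<le> (SUP x. ennreal (cmod (multi_D \<alpha> F x))) / ennreal ?w"
    by (intro divide_right_mono_ennreal SUP_upper) auto
  also have "\<dots> \<le> gevrey_norm h s F" unfolding gevrey_norm_def by (rule SUP_upper2[of \<alpha>]) auto
  also have "\<dots> \<le> ennreal \<epsilon>" using less by simp
  finally have "cmod (multi_D \<alpha> F x) / ?w \<le> \<epsilon>" using \<epsilon> by (simp add: ennreal_le_iff)
  then show ?thesis using w by (simp add: pos_divide_le_eq mult.assoc)
qed

section \<open>Seminorms and convergence in the Gevrey inductive limit\<close>

lemma gevrey_linear:
  fixes u v :: "'n::finite torus_distr"
  assumes s: "s > 0" and u: "u \<in> gevrey s" and v: "v \<in> gevrey s"
  shows "a *\<^sub>C u + b *\<^sub>C v \<in> gevrey s"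
proof -
  obtain C \<delta> where C: "C > 0" "\<delta> > 0" "\<And>\<xi>. cmod (fourier_coeff u \<xi>) \<le> C * gevrey_weight s \<delta> \<xi>"
    using gevrey_D[OF u s] by blast
  obtain C' \<delta>' where C': "C' > 0" "\<delta>' > 0" "\<And>\<xi>. cmod (fourier_coeff v \<xi>) \<le> C' * gevrey_weight s \<delta>' \<xi>"
    using gevrey_D[OF v s] by blast
  define d where "d = min \<delta> \<delta>'"
  show ?thesis
  proof (rule gevreyI[OF s])
    show "d > 0" using C C' by (simp add: d_def)
    fix \<xi> :: "int^'n"
    have "C * gevrey_weight s \<delta> \<xi> \<le> C * gevrey_weight s d \<xi>" "C' * gevrey_weight s \<delta>' \<xi> \<le> C' * gevrey_weight s d \<xi>"
      using C C' by (auto intro!: mult_left_mono gevrey_weight_mono simp: d_def)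
    then have "cmod (fourier_coeff u \<xi>) \<le> C * gevrey_weight s d \<xi>" "cmod (fourier_coeff v \<xi>) \<le> C' * gevrey_weight s d \<xi>"
      using C(3)[of \<xi>] C'(3)[of \<xi>] by linarith+
    then have "cmod a * cmod (fourier_coeff u \<xi>) + cmod b * cmod (fourier_coeff v \<xi>)
        \<le> cmod a * (C * gevrey_weight s d \<xi>) + cmod b * (C' * gevrey_weight s d \<xi>)"
      by (intro add_mono mult_left_mono) auto
    then show "cmod (fourier_coeff (a *\<^sub>C u + b *\<^sub>C v) \<xi>) \<le> (cmod a * C + cmod b * C') * gevrey_weight s d \<xi>"
      using norm_triangle_ineq[of "a * fourier_coeff u \<xi>" "b * fourier_coeff v \<xi>"]
      by (simp add: norm_mult algebra_simps)
  qed
qed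

text \<open>For these weights the supremum over \<open>i\<close> of
  \<open>a i * cmod (fourier_coeff v (\<xi> i))\<close> is a continuous seminorm on the inductive
  limit, because they grow more slowly than every exponential rate. The index is kept apart from the
  frequency, so that one notion covers a single coefficient as well as a sequence of frequencies
  with repetitions.\<close>

definition subexponential :: "real \<Rightarrow> ('i \<Rightarrow> real) \<Rightarrow> ('i \<Rightarrow> int^'n::finite) \<Rightarrow> bool" where
  "subexponential s a \<xi> \<longleftrightarrow> (\<forall>i. 0 \<le> a i) \<and> (\<forall>\<delta>>0. \<exists>M. \<forall>i. a i * gevrey_weight s \<delta> (\<xi> i) \<le> M)"

text \<open>On the step with parameter \<open>h\<close> the coefficients decay at a rate
  \<open>\<delta>\<close> determined by \<open>h\<close>, and at this rate the weights are bounded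
  by some \<open>M\<close>. This yields a radius for each \<open>h\<close> separately, which is what
  the inductive limit asks for.\<close>

lemma gevrey_zero_nhd_weighted:
  fixes \<xi> :: "'i \<Rightarrow> int^'n::finite"
  assumes s: "s > 0" and sub: "subexponential s a \<xi>" and \<kappa>: "\<kappa> > 0"
  shows "gevrey_zero_nhd s {v \<in> gevrey s. \<forall>i. a i * cmod (fourier_coeff v (\<xi> i)) \<le> \<kappa>}"
proof -
  let ?V = "{v \<in> gevrey s. \<forall>i. a i * cmod (fourier_coeff v (\<xi> i)) \<le> \<kappa>}"
  have a: "0 \<le> a i" for i using sub by (simp add: subexponential_def)
  have "convex ?V"
  proof (rule convexI)
    fix u v :: "'n torus_distr" and p q :: real
    assume u: "u \<in> ?V" and v: "v \<in> ?V" and pq: "0 \<le> p" "0 \<le> q" "p + q = 1"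
    have "p *\<^sub>R u + q *\<^sub>R v \<in> gevrey s"
      unfolding scaleR_eq_scaleC using u v by (intro gevrey_linear[OF s]) auto
    moreover have "a i * cmod (fourier_coeff (p *\<^sub>R u + q *\<^sub>R v) (\<xi> i)) \<le> \<kappa>" for i
    proof -
      have "a i * cmod (fourier_coeff (p *\<^sub>R u + q *\<^sub>R v) (\<xi> i))
          \<le> a i * (p * cmod (fourier_coeff u (\<xi> i)) + q * cmod (fourier_coeff v (\<xi> i)))"
        using norm_triangle_ineq[of "of_real p * fourier_coeff u (\<xi> i)" "of_real q * fourier_coeff v (\<xi> i)"] pq
        by (intro mult_left_mono a) (simp add: norm_mult)
      also have "\<dots> = p * (a i * cmod (fourier_coeff u (\<xi> i))) + q * (a i * cmod (fourier_coeff v (\<xi> i)))"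
        by (simp add: algebra_simps)
      also have "\<dots> \<le> p * \<kappa> + q * \<kappa>" using u v pq by (intro add_mono mult_left_mono) auto
      also have "\<dots> = \<kappa>" using pq(3) by (simp add: distrib_right[symmetric])
      finally show ?thesis .
    qed
    ultimately show "p *\<^sub>R u + q *\<^sub>R v \<in> ?V" by simp
  qed
  moreover have "c *\<^sub>C v \<in> ?V" if v: "v \<in> ?V" and c: "cmod c \<le> 1" for c v
  proof -
    have "c *\<^sub>C v = c *\<^sub>C v + 0 *\<^sub>C v" by (rule distr_eqI) simp
    then have "c *\<^sub>C v \<in> gevrey s" using v gevrey_linear[OF s, of v v c 0] by simp
    moreover have "a i * cmod (fourier_coeff (c *\<^sub>C v) (\<xi> i)) \<le> \<kappa>" for i
    proof -
      have "cmod c * (a i * cmod (fourier_coeff v (\<xi> i))) \<le> 1 * (a i * cmod (fourier_coeff v (\<xi> i)))"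
        using c a by (intro mult_right_mono mult_nonneg_nonneg) auto
      also have "\<dots> \<le> \<kappa>" using v by simp
      finally show ?thesis by (simp add: norm_mult mult.left_commute)
    qed
    ultimately show ?thesis by simp
  qed
  moreover have "\<exists>\<epsilon>>0. \<forall>F. gevrey_norm h s F < ennreal \<epsilon> \<longrightarrow> of_test F \<in> ?V" if h: "h > 0" for h
  proof -
    define \<delta> where "\<delta> = s / (2 * (real CARD('n) * h) powr (1 / s))"
    have \<delta>: "\<delta> > 0" using s h by (simp add: \<delta>_def)
    obtain M where M: "\<And>i. a i * gevrey_weight s \<delta> (\<xi> i) \<le> M"
      using sub \<delta> unfolding subexponential_def by blast
    \<comment> \<open>The factor \<open>2 powr s\<close> comes from the coefficient estimate, and
      \<open>\<bar>M\<bar> + 1\<close> is a positive bound for the weighted exponentials.\<close>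
    define b where "b = 2 powr s * (\<bar>M\<bar> + 1)"
    have b: "b > 0" by (simp add: b_def add_nonneg_pos)
    define \<epsilon> where "\<epsilon> = \<kappa> / b"
    have \<epsilon>: "\<epsilon> > 0" using \<kappa> b by (simp add: \<epsilon>_def)
    have "of_test F \<in> ?V" if F: "gevrey_norm h s F < ennreal \<epsilon>" for F :: "'n torus_test"
    proof -
      have le: "cmod (fourier_coeff (of_test F) \<eta>) \<le> \<epsilon> * 2 powr s * gevrey_weight s \<delta> \<eta>" for \<eta>
        unfolding \<delta>_def by (rule gevrey_coeff_decay[OF s h \<epsilon>]) (rule gevrey_norm_lessD[OF h F])
      have "a i * cmod (fourier_coeff (of_test F) (\<xi> i)) \<le> \<kappa>" for i
      proof -
        have "a i * cmod (fourier_coeff (of_test F) (\<xi> i)) \<le> a i * (\<epsilon> * 2 powr s * gevrey_weight s \<delta> (\<xi> i))"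
          by (intro mult_left_mono le a)
        also have "\<dots> = \<epsilon> * 2 powr s * (a i * gevrey_weight s \<delta> (\<xi> i))" by (simp add: mult_ac)
        also have "\<dots> \<le> \<epsilon> * 2 powr s * (\<bar>M\<bar> + 1)"
          using M[of i] \<epsilon> by (intro mult_left_mono) auto
        also have "\<dots> = \<epsilon> * b" by (simp only: b_def mult.assoc)
        also have "\<dots> = \<kappa>" using b by (simp add: \<epsilon>_def)
        finally show ?thesis .
      qed
      moreover have "of_test F \<in> gevrey s" by (rule gevreyI[OF s \<delta> le])
      ultimately show ?thesis by simp
    qed
    then show ?thesis using \<epsilon> by blast
  qed
  ultimately show ?thesis unfolding gevrey_zero_nhd_def by blast
qed

text \<open>An open ball of the weighted sup seminorm around \<open>z\<close>; the margin
  \<open>\<theta> < \<kappa>\<close> expresses a strict bound on the supremum without forming it,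
  and half of the gap is the size of the admissible perturbation.\<close>

lemma gevrey_open_weighted:
  fixes \<xi> :: "'i \<Rightarrow> int^'n::finite"
  assumes s: "s > 0" and sub: "subexponential s a \<xi>"
  shows "openin (gevrey_topology s) {v \<in> gevrey s. \<exists>\<theta><\<kappa>. \<forall>i. a i * cmod (fourier_coeff v (\<xi> i) - z i) \<le> \<theta>}"
    (is "openin _ ?U")
  unfolding openin_gevrey_topology
proof (intro conjI ballI)
  have a: "0 \<le> a i" for i using sub by (simp add: subexponential_def)
  show "?U \<subseteq> gevrey s" by blast
  fix u
  assume "u \<in> ?U"
  then obtain \<theta> where u: "u \<in> gevrey s" "\<theta> < \<kappa>" "\<And>i. a i * cmod (fourier_coeff u (\<xi> i) - z i) \<le> \<theta>" by blast
  define \<epsilon> where "\<epsilon> = (\<kappa> - \<theta>) / 2"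
  have \<epsilon>: "\<epsilon> > 0" using u by (simp add: \<epsilon>_def)
  let ?V = "{v \<in> gevrey s. \<forall>i. a i * cmod (fourier_coeff v (\<xi> i)) \<le> \<epsilon>}"
  have "u + v \<in> ?U" if v: "v \<in> ?V" for v
  proof -
    have eq: "u + v = 1 *\<^sub>C u + 1 *\<^sub>C v" by (rule distr_eqI) simp
    have "u + v \<in> gevrey s" unfolding eq using u v by (intro gevrey_linear[OF s]) auto
    moreover have "a i * cmod (fourier_coeff (u + v) (\<xi> i) - z i) \<le> \<theta> + \<epsilon>" for i
    proof -
      have "a i * cmod (fourier_coeff (u + v) (\<xi> i) - z i)
          \<le> a i * (cmod (fourier_coeff u (\<xi> i) - z i) + cmod (fourier_coeff v (\<xi> i)))"
        using norm_triangle_ineq[of "fourier_coeff u (\<xi> i) - z i" "fourier_coeff v (\<xi> i)"]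
        by (intro mult_left_mono a) (simp add: algebra_simps)
      also have "\<dots> = a i * cmod (fourier_coeff u (\<xi> i) - z i) + a i * cmod (fourier_coeff v (\<xi> i))"
        by (rule distrib_left)
      also have "\<dots> \<le> \<theta> + \<epsilon>" using u(3)[of i] v by (intro add_mono) auto
      finally show ?thesis .
    qed
    moreover have "\<theta> + \<epsilon> < \<kappa>" using u by (simp add: \<epsilon>_def field_simps)
    ultimately show ?thesis by blast
  qed
  then have "(\<lambda>v. u + v) ` ?V \<subseteq> ?U" by blast
  then show "\<exists>V. gevrey_zero_nhd s V \<and> (\<lambda>v. u + v) ` V \<subseteq> ?U"
    using gevrey_zero_nhd_weighted[OF s sub \<epsilon>] by blast
qed

text \<open>The weight zero imposes no condition, so the whole space is one of the open balls
  above.\<close>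

lemma topspace_gevrey:
  assumes "s > 0"
  shows "topspace (gevrey_topology s) = (gevrey s :: 'n::finite torus_distr set)"
proof
  have "openin (gevrey_topology s) (topspace (gevrey_topology s) :: 'n torus_distr set)" by simp
  then show "topspace (gevrey_topology s) \<subseteq> (gevrey s :: 'n torus_distr set)"
    unfolding openin_gevrey_topology by blast
  have "subexponential s (\<lambda>i::unit. 0) (\<lambda>i. 0 :: int^'n)" by (auto simp: subexponential_def)
  from gevrey_open_weighted[OF assms this, of 1]
  have "openin (gevrey_topology s) {v :: 'n torus_distr. v \<in> gevrey s \<and> (\<exists>\<theta><(1::real). 0 \<le> \<theta>)}" by simp
  moreover have "\<exists>\<theta><(1::real). 0 \<le> \<theta>" by (rule exI[of _ 0]) simp
  ultimately have "openin (gevrey_topology s) (gevrey s :: 'n torus_distr set)" by simp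
  then show "gevrey s \<subseteq> topspace (gevrey_topology s :: 'n torus_distr topology)" by (rule openin_subset)
qed

lemma limitin_gevrey_coeff:
  fixes l :: "'n::finite torus_distr"
  assumes s: "s > 0" and lim: "limitin (gevrey_topology s) v l F"
  shows "((\<lambda>i. fourier_coeff (v i) \<xi>) \<longlongrightarrow> fourier_coeff l \<xi>) F"
proof (rule tendstoI)
  fix e :: real
  assume e: "e > 0"
  have l: "l \<in> gevrey s" using lim topspace_gevrey[OF s] by (auto simp: limitin_def)
  have "gevrey_weight s \<delta> \<xi> \<le> 1" if "\<delta> > 0" for \<delta> using that by (simp add: gevrey_weight_def)
  \<comment> \<open>A single coefficient is the case of one index with weight 1.\<close>
  then have sub: "subexponential s (\<lambda>i::unit. 1) (\<lambda>i. \<xi>)" unfolding subexponential_def by auto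
  let ?U = "{v \<in> gevrey s. \<exists>\<theta><e. \<forall>i::unit. 1 * cmod (fourier_coeff v \<xi> - fourier_coeff l \<xi>) \<le> \<theta>}"
  have "openin (gevrey_topology s) ?U" by (rule gevrey_open_weighted[OF s sub])
  moreover have "l \<in> ?U" using l e by auto
  ultimately have "\<forall>\<^sub>F i in F. v i \<in> ?U" by (rule limitinD[OF lim])
  then show "\<forall>\<^sub>F i in F. dist (fourier_coeff (v i) \<xi>) (fourier_coeff l \<xi>) < e"
    by (rule eventually_mono) (auto simp: dist_norm)
qed

text \<open>The counterpart of \<open>l2_tails\<close>: the family is bounded in one common step of
  the inductive limit, with \<open>C\<close> and \<open>\<delta>\<close> independent of the
  index.\<close>

definition gevrey_tails :: "real \<Rightarrow> 'i set \<Rightarrow> ('i \<Rightarrow> int^'n::finite \<Rightarrow> complex) \<Rightarrow> bool" where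
  "gevrey_tails s A c \<longleftrightarrow> (\<exists>C>0. \<exists>\<delta>>0. \<forall>i\<in>A. \<forall>\<xi>. cmod (c i \<xi>) \<le> C * gevrey_weight s \<delta> \<xi>)"

text \<open>If no pair \<open>(C, \<delta>)\<close> works, violations with \<open>C = n\<close> and \<open>\<delta> = 1/n\<close> give weights that define a
  continuous seminorm which is unbounded on the compact image of \<open>u\<close>.\<close>

lemma gevrey_continuous_tails:
  fixes u :: "real \<Rightarrow> 'n::finite torus_distr"
  assumes s: "s > 0" and K: "compact K"
    and lim: "\<And>t. t \<in> K \<Longrightarrow> limitin (gevrey_topology s) u (u t) (at t within K)"
  shows "gevrey_tails s K (\<lambda>t. fourier_coeff (u t))"
proof (rule ccontr)
  assume "\<not> ?thesis"
  then have "\<exists>t\<in>K. \<exists>\<xi>. cmod (fourier_coeff (u t) \<xi>) > real (Suc n) * gevrey_weight s (1 / real (Suc n)) \<xi>" for n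
    unfolding gevrey_tails_def by (metis not_le of_nat_0_less_iff zero_less_Suc zero_less_divide_1_iff)
  then obtain \<tau> \<xi> where \<tau>: "\<And>n. \<tau> n \<in> K"
    and viol: "\<And>n. cmod (fourier_coeff (u (\<tau> n)) (\<xi> n)) > real (Suc n) * gevrey_weight s (1 / real (Suc n)) (\<xi> n)"
    by metis
  define a where "a n = 1 / gevrey_weight s (1 / real (Suc n)) (\<xi> n)" for n
  have sub: "subexponential s a \<xi>" unfolding subexponential_def
  proof (intro conjI allI impI)
    show "0 \<le> a n" for n by (simp add: a_def less_imp_le)
    fix \<delta> :: real
    assume \<delta>: "\<delta> > 0"
    \<comment> \<open>For \<open>n > m\<close> the rate \<open>1 / (n + 1)\<close> is below
      \<open>\<delta>\<close> and the product is at most 1; the finitely many remaining weights are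
      bounded by their sum.\<close>
    obtain m where m: "1 / real (Suc m) < \<delta>" using \<delta> reals_Archimedean[of \<delta>] by (auto simp: inverse_eq_divide)
    have "a n * gevrey_weight s \<delta> (\<xi> n) \<le> 1 + (\<Sum>k\<le>m. a k)" for n
    proof (cases "n \<le> m")
      case True
      have "a n * gevrey_weight s \<delta> (\<xi> n) \<le> a n * 1"
        using \<delta> by (intro mult_left_mono) (auto simp: a_def gevrey_weight_def)
      also have "a n * 1 \<le> (\<Sum>k\<le>m. a k)"
        using True member_le_sum[of n "{..m}" a] by (simp add: a_def less_imp_le)
      finally show ?thesis by simp
    next
      case False
      then have "1 / real (Suc n) \<le> 1 / real (Suc m)" by (simp add: frac_le)
      then have "1 / real (Suc n) \<le> \<delta>" using m by linarith
      then have "a n * gevrey_weight s \<delta> (\<xi> n) \<le> 1"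
        using gevrey_weight_mono[of "1 / real (Suc n)" \<delta> s "\<xi> n"] by (simp add: a_def pos_divide_le_eq)
      moreover have "0 \<le> (\<Sum>k\<le>m. a k)" by (intro sum_nonneg) (simp add: a_def less_imp_le)
      ultimately show ?thesis by simp
    qed
    then show "\<exists>M. \<forall>n. a n * gevrey_weight s \<delta> (\<xi> n) \<le> M" by blast
  qed
  define Q where "Q A \<longleftrightarrow> (\<exists>M. \<forall>t\<in>A. \<forall>n. a n * cmod (fourier_coeff (u t) (\<xi> n)) \<le> M)" for A
  have Q_empty: "Q {}" by (simp add: Q_def)
  have Q_Un: "Q (A \<union> B)" if A: "Q A" and B: "Q B" for A B
  proof -
    obtain M where M: "\<forall>t\<in>A. \<forall>n. a n * cmod (fourier_coeff (u t) (\<xi> n)) \<le> M" using A unfolding Q_def by blast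
    obtain M' where M': "\<forall>t\<in>B. \<forall>n. a n * cmod (fourier_coeff (u t) (\<xi> n)) \<le> M'" using B unfolding Q_def by blast
    have "\<forall>t\<in>A \<union> B. \<forall>n. a n * cmod (fourier_coeff (u t) (\<xi> n)) \<le> max M M'"
      using M M' by (auto simp: le_max_iff_disj)
    then show ?thesis unfolding Q_def by blast
  qed
  have "Q K"
  proof (rule compact_local_to_global[OF K, where Q = Q])
    show "Q {}" by (rule Q_empty)
    show "Q (A \<union> B)" if "Q A" "Q B" for A B using that by (rule Q_Un)
    fix t
    assume t: "t \<in> K"
    have ut: "u t \<in> gevrey s" using lim[OF t] topspace_gevrey[OF s] by (auto simp: limitin_def)
    obtain C \<delta> where C: "C > 0" "\<delta> > 0" "\<And>\<eta>. cmod (fourier_coeff (u t) \<eta>) \<le> C * gevrey_weight s \<delta> \<eta>"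
      using gevrey_D[OF ut s] by blast
    obtain M where M: "\<And>n. a n * gevrey_weight s \<delta> (\<xi> n) \<le> M"
      using sub C(2) unfolding subexponential_def by blast
    have bnd: "a n * cmod (fourier_coeff (u t) (\<xi> n) - 0) \<le> C * M" for n
    proof -
      have "a n * cmod (fourier_coeff (u t) (\<xi> n)) \<le> a n * (C * gevrey_weight s \<delta> (\<xi> n))"
        by (intro mult_left_mono C) (simp add: a_def less_imp_le)
      also have "\<dots> = C * (a n * gevrey_weight s \<delta> (\<xi> n))" by (simp add: mult_ac)
      also have "\<dots> \<le> C * M" using C(1) M by (intro mult_left_mono) auto
      finally show ?thesis by simp
    qed
    \<comment> \<open>The seminorm of \<open>u t\<close> is at most \<open>C * M\<close>, so raising
      the threshold by 1 gives an open neighbourhood on which it stays bounded.\<close>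
    let ?U = "{v \<in> gevrey s. \<exists>\<theta><C * M + 1. \<forall>n. a n * cmod (fourier_coeff v (\<xi> n) - 0) \<le> \<theta>}"
    have "openin (gevrey_topology s) ?U" by (rule gevrey_open_weighted[OF s sub])
    moreover have utU: "u t \<in> ?U" using ut bnd by (auto intro!: exI[of _ "C * M"])
    ultimately have "\<forall>\<^sub>F \<tau> in at t within K. u \<tau> \<in> ?U" by (rule limitinD[OF lim[OF t]])
    then obtain W where W: "open W" "t \<in> W" "\<forall>\<tau>\<in>W. \<tau> \<noteq> t \<longrightarrow> \<tau> \<in> K \<longrightarrow> u \<tau> \<in> ?U"
      unfolding eventually_at_topological by blast
    have "\<forall>\<tau>\<in>W \<inter> K. \<forall>n. a n * cmod (fourier_coeff (u \<tau>) (\<xi> n)) \<le> C * M + 1"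
    proof (intro ballI allI)
      fix \<tau> n
      assume "\<tau> \<in> W \<inter> K"
      then have "u \<tau> \<in> ?U" using W(3) utU by (cases "\<tau> = t") auto
      then obtain \<theta> where \<theta>: "\<theta> < C * M + 1" "\<forall>n. a n * cmod (fourier_coeff (u \<tau>) (\<xi> n) - 0) \<le> \<theta>" by blast
      have "a n * cmod (fourier_coeff (u \<tau>) (\<xi> n) - 0) \<le> \<theta>" using \<theta>(2) by blast
      then show "a n * cmod (fourier_coeff (u \<tau>) (\<xi> n)) \<le> C * M + 1" using \<theta>(1) by simp
    qed
    then have "Q (W \<inter> K)" unfolding Q_def by blast
    then show "\<exists>U. open U \<and> t \<in> U \<and> Q (U \<inter> K)" using W(1,2) by blast
  qed
  then obtain M where M: "\<forall>t\<in>K. \<forall>n. a n * cmod (fourier_coeff (u t) (\<xi> n)) \<le> M" unfolding Q_def by blast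
  obtain n :: nat where n: "M < real n" using reals_Archimedean2 by blast
  \<comment> \<open>By the choice of the weights, each violation says that the \<open>n\<close>-th
    weighted coefficient exceeds \<open>n + 1\<close>, which no common \<open>M\<close>
    allows.\<close>
  have "real (Suc n) < a n * cmod (fourier_coeff (u (\<tau> n)) (\<xi> n))"
    using viol[of n] by (simp add: a_def pos_less_divide_eq)
  also have "\<dots> \<le> M" using M \<tau> by blast
  finally show False using n by simp
qed

text \<open>The weighted \<open>l^1\<close> norm with rate \<open>\<delta>\<close> dominates the
  norm of the step with \<open>h = (s / \<delta>) powr s\<close>. Every zero neighbourhood contains
  a ball of that step, so convergence in this one norm suffices.\<close>

lemma gevrey_limit_weighted:
  fixes v :: "'i \<Rightarrow> 'n::finite torus_distr"
  assumes s: "s > 0" and \<delta>: "\<delta> > 0" and l: "l \<in> gevrey s"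
    and A: "\<forall>\<^sub>F i in F. i \<in> A"
    and r: "\<And>i. i \<in> A \<Longrightarrow> rapid (fourier_coeff (v i - l))"
    and sm: "\<And>i. i \<in> A \<Longrightarrow> (\<lambda>\<xi>. cmod (fourier_coeff (v i - l) \<xi>) / gevrey_weight s \<delta> \<xi>) summable_on UNIV"
    and lim: "((\<lambda>i. \<Sum>\<^sub>\<infinity>\<xi>. cmod (fourier_coeff (v i - l) \<xi>) / gevrey_weight s \<delta> \<xi>) \<longlongrightarrow> 0) F"
  shows "limitin (gevrey_topology s) v l F"
  unfolding limitin_def
proof (intro conjI allI impI)
  show "l \<in> topspace (gevrey_topology s)" using l topspace_gevrey[OF s] by blast
  fix U
  assume "openin (gevrey_topology s) U \<and> l \<in> U"
  then obtain V where V: "gevrey_zero_nhd s V" "(\<lambda>v. l + v) ` V \<subseteq> U"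
    unfolding openin_gevrey_topology by blast
  define h where "h = (s / \<delta>) powr s"
  have h: "h > 0" using s \<delta> by (simp add: h_def)
  obtain \<epsilon> where \<epsilon>: "\<epsilon> > 0" "\<And>F. gevrey_norm h s F < ennreal \<epsilon> \<Longrightarrow> of_test F \<in> V"
    using V(1) h unfolding gevrey_zero_nhd_def by blast
  have "\<forall>\<^sub>F i in F. dist (\<Sum>\<^sub>\<infinity>\<xi>. cmod (fourier_coeff (v i - l) \<xi>) / gevrey_weight s \<delta> \<xi>) 0 < \<epsilon>"
    using lim \<epsilon>(1) by (rule tendstoD)
  then show "\<forall>\<^sub>F i in F. v i \<in> U"
    using A
  proof eventually_elim
    case (elim i)
    let ?c = "fourier_coeff (v i - l)"
    let ?S = "\<Sum>\<^sub>\<infinity>\<xi>. cmod (?c \<xi>) / gevrey_weight s \<delta> \<xi>"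
    have "gevrey_norm h s (fourier_test ?c) \<le> ennreal ?S"
      unfolding h_def by (rule gevrey_norm_leI[OF h[unfolded h_def] fourier_test_gevrey_bound[OF s \<delta> r[OF elim(2)] sm[OF elim(2)]]])
    also have "\<dots> < ennreal \<epsilon>"
      using elim(1) \<epsilon>(1) by (intro ennreal_lessI) (auto simp: dist_real_def)
    finally have "of_test (fourier_test ?c) \<in> V" by (rule \<epsilon>(2))
    moreover have "v i - l = of_test (fourier_test ?c)" by (rule of_test_fourier_test[OF r[OF elim(2)]]) simp
    ultimately have "l + (v i - l) \<in> U" using V(2) by (metis image_subset_iff)
    then show ?case by simp
  qed
qed

text \<open>Dominated convergence over the frequencies with majorant
  \<open>C * gevrey_weight s (\<delta> / 2) \<xi>\<close>: half of the common rate goes into the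
  norm, the other half sums the tail.\<close>

lemma limitin_gevreyI:
  fixes v :: "'i \<Rightarrow> 'n::finite torus_distr"
  assumes s: "s > 0" and l: "l \<in> gevrey s" and A: "\<forall>\<^sub>F i in F. i \<in> A"
    and tails: "gevrey_tails s A (\<lambda>i. fourier_coeff (v i))"
    and lim: "\<And>\<xi>. ((\<lambda>i. fourier_coeff (v i) \<xi>) \<longlongrightarrow> fourier_coeff l \<xi>) F"
  shows "limitin (gevrey_topology s) v l F"
proof -
  obtain C' \<delta>' where C': "C' > 0" "\<delta>' > 0" "\<And>i \<xi>. i \<in> A \<Longrightarrow> cmod (fourier_coeff (v i) \<xi>) \<le> C' * gevrey_weight s \<delta>' \<xi>"
    using tails unfolding gevrey_tails_def by blast
  obtain C'' \<delta>'' where C'': "C'' > 0" "\<delta>'' > 0" "\<And>\<xi>. cmod (fourier_coeff l \<xi>) \<le> C'' * gevrey_weight s \<delta>'' \<xi>"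
    using gevrey_D[OF l s] by blast
  define \<delta> where "\<delta> = min \<delta>' \<delta>''"
  define C where "C = C' + C''"
  have \<delta>: "\<delta> > 0" and C: "C > 0" using C' C'' by (auto simp: \<delta>_def C_def)
  have le: "cmod (fourier_coeff (v i - l) \<xi>) \<le> C * gevrey_weight s \<delta> \<xi>" if "i \<in> A" for i \<xi>
  proof -
    have "C' * gevrey_weight s \<delta>' \<xi> \<le> C' * gevrey_weight s \<delta> \<xi>" "C'' * gevrey_weight s \<delta>'' \<xi> \<le> C'' * gevrey_weight s \<delta> \<xi>"
      using C' C'' by (auto intro!: mult_left_mono gevrey_weight_mono simp: \<delta>_def)
    then show ?thesis
      using C'(3)[OF that, of \<xi>] C''(3)[of \<xi>] norm_triangle_ineq4[of "fourier_coeff (v i) \<xi>" "fourier_coeff l \<xi>"]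
      by (simp add: C_def distrib_right)
  qed
  let ?g = "\<lambda>i \<xi>. cmod (fourier_coeff (v i - l) \<xi>) / gevrey_weight s (\<delta> / 2) \<xi>"
  have \<delta>2: "\<delta> / 2 > 0" using \<delta> by simp
  have sm: "?g i summable_on UNIV" and gle: "?g i \<xi> \<le> C * gevrey_weight s (\<delta> / 2) \<xi>" if "i \<in> A" for i \<xi>
    using gevrey_weighted_summable[OF s \<delta> le[OF that]] by auto
  have smw: "(\<lambda>\<xi>::int^'n. C * gevrey_weight s (\<delta> / 2) \<xi>) summable_on UNIV"
    by (intro summable_on_cmult_right gevrey_weight_summable s \<delta>2)
  show ?thesis
  proof (rule gevrey_limit_weighted[OF s \<delta>2 l A rapid_gevrey[OF s \<delta> le] sm])
    show "((\<lambda>i. infsum (?g i) UNIV) \<longlongrightarrow> 0) F"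
    proof (rule tendstoI)
      fix e :: real
      assume e: "e > 0"
      define W where "W = infsum (\<lambda>\<xi>::int^'n. C * gevrey_weight s (\<delta> / 2) \<xi>) UNIV"
      have "(sum (\<lambda>\<xi>::int^'n. C * gevrey_weight s (\<delta> / 2) \<xi>) \<longlongrightarrow> W) (finite_subsets_at_top UNIV)"
        using has_sum_infsum[OF smw] by (simp add: has_sum_def W_def)
      then have "\<forall>\<^sub>F G in finite_subsets_at_top UNIV. dist (\<Sum>\<xi>\<in>G. C * gevrey_weight s (\<delta> / 2) (\<xi>::int^'n)) W < e / 2"
        using e by (intro tendstoD) auto
      \<comment> \<open>\<open>G\<close> carries all but \<open>e / 2\<close> of the mass of the
        majorant; the other \<open>e / 2\<close> is left for the convergence on
        \<open>G\<close>.\<close>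
      then obtain G where G: "finite G" "dist (\<Sum>\<xi>\<in>G. C * gevrey_weight s (\<delta> / 2) (\<xi>::int^'n)) W < e / 2"
        unfolding eventually_finite_subsets_at_top by blast
      have "((\<lambda>i. \<Sum>\<xi>\<in>G. cmod (fourier_coeff (v i) \<xi> - fourier_coeff l \<xi>) / gevrey_weight s (\<delta> / 2) \<xi>)
          \<longlongrightarrow> (\<Sum>\<xi>\<in>G. cmod (fourier_coeff l \<xi> - fourier_coeff l \<xi>) / gevrey_weight s (\<delta> / 2) \<xi>)) F"
        by (intro tendsto_intros lim gevrey_weight_neq_0)
      then have "((\<lambda>i. \<Sum>\<xi>\<in>G. ?g i \<xi>) \<longlongrightarrow> 0) F" by simp
      then have "\<forall>\<^sub>F i in F. dist (\<Sum>\<xi>\<in>G. ?g i \<xi>) 0 < e / 2" using e by (intro tendstoD) auto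
      then show "\<forall>\<^sub>F i in F. dist (infsum (?g i) UNIV) 0 < e"
        using A
      proof eventually_elim
        case (elim i)
        have "infsum (?g i) (UNIV - G) \<le> infsum (\<lambda>\<xi>. C * gevrey_weight s (\<delta> / 2) \<xi>) (UNIV - G)"
        proof (rule infsum_mono)
          show "?g i summable_on UNIV - G" by (rule summable_on_subset_banach[OF sm[OF elim(2)]]) auto
          show "(\<lambda>\<xi>. C * gevrey_weight s (\<delta> / 2) \<xi>) summable_on UNIV - G" by (rule summable_on_subset_banach[OF smw]) auto
        qed (rule gle[OF elim(2)])
        moreover have "infsum (?g i) (UNIV - G) = infsum (?g i) UNIV - infsum (?g i) G"
          by (rule infsum_Diff[OF sm[OF elim(2)] summable_on_finite[OF G(1)] subset_UNIV])
        moreover have "infsum (\<lambda>\<xi>::int^'n. C * gevrey_weight s (\<delta> / 2) \<xi>) (UNIV - G) = W - infsum (\<lambda>\<xi>. C * gevrey_weight s (\<delta> / 2) \<xi>) G"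
          unfolding W_def by (rule infsum_Diff[OF smw summable_on_finite[OF G(1)] subset_UNIV])
        ultimately have "infsum (?g i) UNIV \<le> (\<Sum>\<xi>\<in>G. ?g i \<xi>) + (W - (\<Sum>\<xi>\<in>G. C * gevrey_weight s (\<delta> / 2) \<xi>))"
          using G(1) by (simp only: infsum_finite)
        also have "\<dots> < e / 2 + e / 2"
          using elim(1) G(2) unfolding dist_real_def by linarith
        finally have "infsum (?g i) UNIV < e" by simp
        moreover have "infsum (?g i) UNIV \<ge> 0" by (intro infsum_nonneg) (simp add: less_imp_le)
        ultimately show ?case by (simp add: dist_real_def)
      qed
    qed
  qed
qed

section \<open>Weak derivatives in time\<close>

text \<open>The case \<open>k = 0\<close> is the classical smooth function that is flat at the
  origin; the powers in the denominator make the span of the family closed under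
  differentiation.\<close>

definition flat :: "nat \<Rightarrow> real \<Rightarrow> real" where
  "flat k x = (if x > 0 then exp (- 1 / x) / x ^ k else 0)"

lemma flat_has_vector_derivative:
  "(flat k has_vector_derivative flat (k + 2) x - real k * flat (k + 1) x) (at x)"
proof -
  consider "x > 0" | "x < 0" | "x = 0" by linarith
  then show ?thesis
  proof cases
    case 1
    have "((\<lambda>x. exp (- 1 / x) / x ^ k) has_real_derivative flat (k + 2) x - real k * flat (k + 1) x) (at x)"
      using 1 by (auto intro!: derivative_eq_intros simp: flat_def field_simps power2_eq_square power_add)
        (cases k; simp add: field_simps)
    then have "(flat k has_real_derivative flat (k + 2) x - real k * flat (k + 1) x) (at x)"
      by (rule has_field_derivative_transform_within_open[of _ _ _ "{0<..}"]) (use 1 in \<open>auto simp: flat_def\<close>)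
    then show ?thesis by (simp add: has_real_derivative_iff_has_vector_derivative)
  next
    case 2
    have "((\<lambda>x. 0) has_real_derivative 0) (at x)" by simp
    then have "(flat k has_real_derivative 0) (at x)"
      by (rule has_field_derivative_transform_within_open[of _ _ _ "{..<0}"]) (use 2 in \<open>auto simp: flat_def\<close>)
    then show ?thesis using 2 by (simp add: has_real_derivative_iff_has_vector_derivative flat_def)
  next
    case 3
    \<comment> \<open>At the origin value and derivative vanish, and \<open>exp (1 / t)\<close>
      dominates \<open>(1 / t) ^ (k + 2)\<close> up to a constant, which leaves a bound of order
      \<open>t^2\<close>.\<close>
    have "norm (flat k t - flat k 0 - t *\<^sub>R (flat (k + 2) x - real k * flat (k + 1) x)) \<le> fact (k + 2) * t\<^sup>2" for t
    proof (cases "t > 0")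
      case True
      have "(1 / t) ^ (k + 2) \<le> fact (k + 2) * exp (1 / t)"
        using True by (intro power_le_fact_exp) auto
      then have "exp (- 1 / t) / t ^ k \<le> fact (k + 2) * t\<^sup>2"
        using True by (simp add: exp_minus power_add power2_eq_square field_simps)
      then show ?thesis using True 3 by (simp add: flat_def)
    qed (simp add: flat_def 3)
    then show ?thesis unfolding 3 by (rule has_vector_derivative_quadratic)
  qed
qed

text \<open>A class of functions that is closed under differentiation, so that all iterated derivatives exist;
  the last rule adds antiderivatives, which are needed for compactly supported steps.\<close>

inductive elementary_smooth :: "(real \<Rightarrow> complex) \<Rightarrow> bool" where
  flat: "elementary_smooth (\<lambda>t. of_real (flat k (\<sigma> * (t - s))))"
| scale: "elementary_smooth f \<Longrightarrow> elementary_smooth (\<lambda>t. c * f t)"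
| add: "elementary_smooth f \<Longrightarrow> elementary_smooth g \<Longrightarrow> elementary_smooth (\<lambda>t. f t + g t)"
| mult: "elementary_smooth f \<Longrightarrow> elementary_smooth g \<Longrightarrow> elementary_smooth (\<lambda>t. f t * g t)"
| primitive: "elementary_smooth f \<Longrightarrow> (\<And>t. (g has_vector_derivative f t) (at t)) \<Longrightarrow> elementary_smooth g"

lemma elementary_smooth_deriv:
  "elementary_smooth f \<Longrightarrow> \<exists>f'. elementary_smooth f' \<and> (\<forall>t. (f has_vector_derivative f' t) (at t))"
proof (induction rule: elementary_smooth.induct)
  case (flat k \<sigma> s)
  let ?x = "\<lambda>t. \<sigma> * (t - s)"
  have "((\<lambda>t. complex_of_real (flat k (?x t))) has_vector_derivative
      of_real \<sigma> * (of_real (flat (k + 2) (?x t)) + of_real (- real k) * of_real (flat (k + 1) (?x t)))) (at t)" for t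
  proof -
    have "(?x has_vector_derivative \<sigma>) (at t)" by (auto intro!: derivative_eq_intros)
    from vector_diff_chain_at[OF this flat_has_vector_derivative[of k "?x t"]]
    have "((\<lambda>t. flat k (?x t)) has_vector_derivative \<sigma> * (flat (k + 2) (?x t) - real k * flat (k + 1) (?x t))) (at t)"
      by (simp add: o_def)
    from has_vector_derivative_of_real[OF this[folded has_real_derivative_iff_has_vector_derivative]] show ?thesis by simp
  qed
  moreover have "elementary_smooth (\<lambda>t. of_real \<sigma> * (of_real (flat (k + 2) (?x t)) + of_real (- real k) * of_real (flat (k + 1) (?x t))))"
    by (intro elementary_smooth.scale elementary_smooth.add elementary_smooth.flat)
  ultimately show ?case by blast
next
  case (scale f c)
  then obtain f' where "elementary_smooth f'" "\<And>t. (f has_vector_derivative f' t) (at t)" by blast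
  then show ?case by (intro exI[of _ "\<lambda>t. c * f' t"]) (auto intro: elementary_smooth.scale has_vector_derivative_mult_right)
next
  case (add f g)
  then obtain f' g' where "elementary_smooth f'" "\<And>t. (f has_vector_derivative f' t) (at t)"
    "elementary_smooth g'" "\<And>t. (g has_vector_derivative g' t) (at t)" by blast
  then show ?case by (intro exI[of _ "\<lambda>t. f' t + g' t"]) (auto intro: elementary_smooth.add has_vector_derivative_add)
next
  case (mult f g)
  then obtain f' g' where *: "elementary_smooth f'" "\<And>t. (f has_vector_derivative f' t) (at t)"
    "elementary_smooth g'" "\<And>t. (g has_vector_derivative g' t) (at t)" by blast
  have "elementary_smooth (\<lambda>t. f t * g' t + f' t * g t)"
    using * mult.hyps by (intro elementary_smooth.add elementary_smooth.mult)
  moreover have "((\<lambda>t. f t * g t) has_vector_derivative f t * g' t + f' t * g t) (at t)" for t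
    by (rule has_vector_derivative_mult[OF *(2,4)])
  ultimately show ?case by blast
qed blast

lemma elementary_smooth_time_deriv:
  assumes "elementary_smooth f"
  shows "(time_deriv ^^ n) f differentiable (at t)"
proof -
  have "elementary_smooth ((time_deriv ^^ n) f)"
  proof (induction n)
    case (Suc n)
    then obtain f' where "elementary_smooth f'" "\<And>t. ((time_deriv ^^ n) f has_vector_derivative f' t) (at t)"
      using elementary_smooth_deriv by blast
    moreover from this have "time_deriv ((time_deriv ^^ n) f) = f'"
      by (auto simp: time_deriv_def fun_eq_iff intro: vector_derivative_at)
    ultimately show ?case by simp
  qed (use assms in simp)
  then show ?thesis using elementary_smooth_deriv differentiableI_vector by blast
qed

lemma time_test_props:
  assumes "\<phi> \<in> time_test T"
  shows "(\<phi> has_vector_derivative time_deriv \<phi> t) (at t)" and "continuous_on S \<phi>"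
    and "continuous_on S (time_deriv \<phi>)" and "\<phi> 0 = 0" and "\<phi> T = 0"
proof -
  have d: "(time_deriv ^^ n) \<phi> differentiable (at t)" for n t
    using assms by (simp add: time_test_def)
  show "(\<phi> has_vector_derivative time_deriv \<phi> t) (at t)"
    using d[of 0 t] by (simp add: time_deriv_def vector_derivative_works)
  show "continuous_on S \<phi>" "continuous_on S (time_deriv \<phi>)"
    using d[of 0] d[of 1] by (auto intro!: continuous_at_imp_continuous_on differentiable_imp_continuous_within)
  have "{t. \<phi> t \<noteq> 0} \<subseteq> {0<..<T}"
    using assms closure_subset[of "{t. \<phi> t \<noteq> 0}"] by (auto simp: time_test_def)
  then show "\<phi> 0 = 0" "\<phi> T = 0" by auto
qed

lemma time_test_by_parts:
  assumes \<phi>: "\<phi> \<in> time_test T" and T: "T > 0"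
    and p: "\<And>t. t \<in> {0..T} \<Longrightarrow> (p has_vector_derivative p' t) (at t within {0..T})"
    and p': "continuous_on {0..T} p'"
  shows "integral {0..T} (\<lambda>t. time_deriv \<phi> t * p t) = - integral {0..T} (\<lambda>t. \<phi> t * p' t)"
proof -
  have cp: "continuous_on {0..T} p"
    unfolding continuous_on_eq_continuous_within using p has_vector_derivative_continuous by blast
  have i: "(\<lambda>t. \<phi> t * p' t) integrable_on {0..T}" "(\<lambda>t. time_deriv \<phi> t * p t) integrable_on {0..T}"
    by (intro integrable_continuous_interval continuous_intros time_test_props[OF \<phi>] cp p')+
  have "((\<lambda>t. \<phi> t * p' t + time_deriv \<phi> t * p t) has_integral \<phi> T * p T - \<phi> 0 * p 0) {0..T}"
    using T by (intro fundamental_theorem_of_calculus has_vector_derivative_mult p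
        has_vector_derivative_at_within[OF time_test_props(1)[OF \<phi>]]) auto
  then have "integral {0..T} (\<lambda>t. \<phi> t * p' t) + integral {0..T} (\<lambda>t. time_deriv \<phi> t * p t) = 0"
    using integral_add[OF i] time_test_props(4,5)[OF \<phi>] by (simp add: integral_unique)
  then show ?thesis by (simp add: eq_neg_iff_add_eq_0 add.commute)
qed

section \<open>Smooth steps and the lemma of du Bois-Reymond\<close>

definition bump :: "real \<Rightarrow> real \<Rightarrow> real" where
  "bump \<epsilon> x = flat 0 x * flat 0 (\<epsilon> - x)"

text \<open>For negative \<open>x\<close> the interval is empty and the value is 0, so for positive
  \<open>\<epsilon>\<close> this is a smooth step that rises on \<open>[0, \<epsilon>]\<close> and
  is constant afterwards.\<close>

definition bump_step :: "real \<Rightarrow> real \<Rightarrow> real" where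
  "bump_step \<epsilon> x = integral {0..x} (bump \<epsilon>)"

lemma bump_nonneg: "0 \<le> bump \<epsilon> x"
  by (simp add: bump_def flat_def)

lemma bump_pos: "0 < x \<Longrightarrow> x < \<epsilon> \<Longrightarrow> 0 < bump \<epsilon> x"
  by (simp add: bump_def flat_def)

lemma bump_zero: "x \<le> 0 \<or> \<epsilon> \<le> x \<Longrightarrow> bump \<epsilon> x = 0"
  by (auto simp: bump_def flat_def)

lemma bump_continuous: "continuous_on S (bump \<epsilon>)"
proof -
  have c: "continuous_on S (flat 0)" for S
    by (rule continuous_at_imp_continuous_on) (use has_vector_derivative_continuous[OF flat_has_vector_derivative] in blast)
  show ?thesis unfolding bump_def
    by (intro continuous_intros continuous_on_compose2[OF c[of UNIV]] c) auto
qed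

text \<open>Moving the base point to \<open>- M\<close> leaves the integral unchanged because the
  bump vanishes on the negative axis, and it makes \<open>x\<close> an interior point also when
  \<open>x \<le> 0\<close>.\<close>

lemma bump_step_has_vector_derivative:
  "(bump_step \<epsilon> has_vector_derivative bump \<epsilon> x) (at x)"
proof -
  define M where "M = \<bar>x\<bar> + 1"
  have eq: "integral {- M..y} (bump \<epsilon>) = bump_step \<epsilon> y" if y: "y \<in> {- M<..<M}" for y
  proof (cases "y \<ge> 0")
    case True
    have "integral {- M..0} (bump \<epsilon>) + integral {0..y} (bump \<epsilon>) = integral {- M..y} (bump \<epsilon>)"
      using True by (intro Henstock_Kurzweil_Integration.integral_combine integrable_continuous_interval bump_continuous)
        (auto simp: M_def)
    moreover have "integral {- M..0} (bump \<epsilon>) = 0"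
      by (rule integral_unique, rule has_integral_is_0) (simp add: bump_zero)
    ultimately show ?thesis by (simp add: bump_step_def)
  next
    case False
    have "integral {- M..y} (bump \<epsilon>) = 0"
      by (rule integral_unique, rule has_integral_is_0) (use False in \<open>simp add: bump_zero\<close>)
    then show ?thesis using False by (simp add: bump_step_def)
  qed
  have "((\<lambda>y. integral {- M..y} (bump \<epsilon>)) has_vector_derivative bump \<epsilon> x) (at x within {- M..M})"
    by (intro integral_has_vector_derivative bump_continuous) (auto simp: M_def)
  then have "((\<lambda>y. integral {- M..y} (bump \<epsilon>)) has_vector_derivative bump \<epsilon> x) (at x)"
    by (subst (asm) at_within_Icc_at) (auto simp: M_def)
  then show ?thesis
    by (rule has_vector_derivative_transform_within_open[of _ _ _ "{- M<..<M}"]) (use eq in \<open>auto simp: M_def\<close>)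
qed

lemma bump_step_left: "x \<le> 0 \<Longrightarrow> bump_step \<epsilon> x = 0"
  by (cases "x = 0") (auto simp: bump_step_def)

lemma bump_step_right:
  assumes "\<epsilon> > 0" "x \<ge> \<epsilon>"
  shows "bump_step \<epsilon> x = bump_step \<epsilon> \<epsilon>"
proof -
  have "integral {0..\<epsilon>} (bump \<epsilon>) + integral {\<epsilon>..x} (bump \<epsilon>) = integral {0..x} (bump \<epsilon>)"
    using assms by (intro Henstock_Kurzweil_Integration.integral_combine integrable_continuous_interval bump_continuous) auto
  moreover have "integral {\<epsilon>..x} (bump \<epsilon>) = 0"
    by (rule integral_unique, rule has_integral_is_0) (simp add: bump_zero)
  ultimately show ?thesis by (simp add: bump_step_def)
qed

lemma bump_step_pos:
  assumes "\<epsilon> > 0"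
  shows "bump_step \<epsilon> \<epsilon> > 0"
proof -
  have "\<exists>z>0. z < \<epsilon> \<and> bump_step \<epsilon> \<epsilon> - bump_step \<epsilon> 0 = (\<epsilon> - 0) * bump \<epsilon> z"
    using assms bump_step_has_vector_derivative
    by (intro MVT2) (auto simp: has_real_derivative_iff_has_vector_derivative)
  then obtain z where z: "0 < z" "z < \<epsilon>" "bump_step \<epsilon> \<epsilon> = \<epsilon> * bump \<epsilon> z"
    by (auto simp: bump_step_left)
  then show ?thesis using assms bump_pos[of z \<epsilon>] by simp
qed

lemma shifted_bump_has_integral:
  assumes "\<epsilon> > 0" "0 \<le> s" "s + \<epsilon> \<le> T"
  shows "((\<lambda>t. bump \<epsilon> (t - s)) has_integral bump_step \<epsilon> \<epsilon>) {0..T}"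
proof -
  have "((\<lambda>t. bump_step \<epsilon> (t - s)) has_vector_derivative bump \<epsilon> (t - s)) (at t within {0..T})" for t
  proof -
    have "((\<lambda>t. t - s) has_vector_derivative 1) (at t)" by (auto intro!: derivative_eq_intros)
    from vector_diff_chain_at[OF this bump_step_has_vector_derivative[of \<epsilon> "t - s"]]
    show ?thesis by (simp add: o_def has_vector_derivative_at_within)
  qed
  then have "((\<lambda>t. bump \<epsilon> (t - s)) has_integral bump_step \<epsilon> (T - s) - bump_step \<epsilon> (0 - s)) {0..T}"
    using assms by (intro fundamental_theorem_of_calculus) auto
  moreover have "bump_step \<epsilon> (T - s) = bump_step \<epsilon> \<epsilon>" "bump_step \<epsilon> (0 - s) = 0"
    using assms by (auto intro!: bump_step_right bump_step_left)
  ultimately show ?thesis by simp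
qed

text \<open>A narrow bump starting at \<open>s\<close> acts, up to its total mass, as an approximate
  evaluation at \<open>s\<close>.\<close>

lemma bump_average_close:
  fixes e :: "real \<Rightarrow> complex"
  assumes e: "continuous_on {0..T} e" and \<epsilon>: "\<epsilon> > 0" "0 \<le> s" "s + \<epsilon> \<le> T"
    and close: "\<And>t. s < t \<Longrightarrow> t < s + \<epsilon> \<Longrightarrow> cmod (e t - e s) \<le> \<kappa>"
  shows "cmod (integral {0..T} (\<lambda>t. of_real (bump \<epsilon> (t - s)) * e t) - of_real (bump_step \<epsilon> \<epsilon>) * e s)
    \<le> bump_step \<epsilon> \<epsilon> * \<kappa>"
proof -
  have cb: "continuous_on {0..T} (\<lambda>t. bump \<epsilon> (t - s))"
    by (intro continuous_on_compose2[OF bump_continuous[of UNIV]] continuous_intros) auto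
  note hi = shifted_bump_has_integral[OF \<epsilon>]
  have i1: "((\<lambda>t. of_real (bump \<epsilon> (t - s)) * e s) has_integral of_real (bump_step \<epsilon> \<epsilon>) * e s) {0..T}"
    using has_integral_linear[OF hi, of "\<lambda>x. complex_of_real x * e s"]
    by (simp add: o_def bounded_linear_mult_left bounded_linear_compose[OF bounded_linear_mult_left bounded_linear_of_real])
  have i2: "(\<lambda>t. of_real (bump \<epsilon> (t - s)) * e t) integrable_on {0..T}"
    by (intro integrable_continuous_interval continuous_intros cb e)
  have "((\<lambda>t. of_real (bump \<epsilon> (t - s)) * e t - of_real (bump \<epsilon> (t - s)) * e s) has_integral
      integral {0..T} (\<lambda>t. of_real (bump \<epsilon> (t - s)) * e t) - of_real (bump_step \<epsilon> \<epsilon>) * e s) {0..T}"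
    by (intro has_integral_diff integrable_integral i1 i2)
  moreover have "((\<lambda>t. bump \<epsilon> (t - s) * \<kappa>) has_integral bump_step \<epsilon> \<epsilon> * \<kappa>) {0..T}"
    by (rule has_integral_mult_left[OF hi])
  moreover have "cmod (of_real (bump \<epsilon> (t - s)) * e t - of_real (bump \<epsilon> (t - s)) * e s) \<le> bump \<epsilon> (t - s) * \<kappa>" for t
  proof (cases "s < t \<and> t < s + \<epsilon>")
    case True
    then show ?thesis
      using mult_left_mono[OF close[of t] bump_nonneg[of \<epsilon> "t - s"]]
      by (simp add: right_diff_distrib[symmetric] norm_mult bump_nonneg)
  next
    case False
    then show ?thesis by (auto simp: bump_zero)
  qed
  ultimately show ?thesis
    using integral_norm_bound_integral by (metis (no_types, lifting) has_integral_iff)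
qed

text \<open>The test function is the difference of two smooth steps starting at \<open>s\<close> and
  \<open>t\<close>. Both reach the same height, so its support is compact, while its derivative
  compares averages of \<open>e\<close> near \<open>s\<close> and near \<open>t\<close>.\<close>

lemma du_Bois_Reymond:
  fixes e :: "real \<Rightarrow> complex"
  assumes e: "continuous_on {0..T} e"
    and weak: "\<And>\<phi>. \<phi> \<in> time_test T \<Longrightarrow> integral {0..T} (\<lambda>t. time_deriv \<phi> t * e t) = 0"
    and s: "s \<in> {0<..<T}" and t: "t \<in> {0<..<T}"
  shows "e s = e t"
proof (rule ccontr)
  assume ne: "e s \<noteq> e t"
  \<comment> \<open>A third of the gap: each of the two averages is off by at most
    \<open>\<kappa>\<close>, which cannot bridge a distance of \<open>3 * \<kappa>\<close>.\<close>
  define \<kappa> where "\<kappa> = cmod (e s - e t) / 3"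
  have \<kappa>: "\<kappa> > 0" using ne by (simp add: \<kappa>_def)
  have near: "\<exists>\<delta>>0. \<forall>x. r < x \<and> x < r + \<delta> \<longrightarrow> cmod (e x - e r) \<le> \<kappa>" if r: "r \<in> {0<..<T}" for r
  proof -
    obtain d where d: "d > 0" "\<And>x. x \<in> {0..T} \<Longrightarrow> dist x r < d \<Longrightarrow> dist (e x) (e r) < \<kappa>"
      using e[unfolded continuous_on_iff, rule_format, of r \<kappa>] r \<kappa> by auto
    show ?thesis
    proof (intro exI[of _ "min d (T - r)"] conjI allI impI)
      show "0 < min d (T - r)" using d(1) r by simp
      fix x
      assume "r < x \<and> x < r + min d (T - r)"
      then have "dist (e x) (e r) < \<kappa>" using r by (intro d(2)) (auto simp: dist_real_def)
      then show "cmod (e x - e r) \<le> \<kappa>" by (simp add: dist_norm)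
    qed
  qed
  obtain d1 where d1: "d1 > 0" "\<forall>x. s < x \<and> x < s + d1 \<longrightarrow> cmod (e x - e s) \<le> \<kappa>" using near[OF s] by blast
  obtain d2 where d2: "d2 > 0" "\<forall>x. t < x \<and> x < t + d2 \<longrightarrow> cmod (e x - e t) \<le> \<kappa>" using near[OF t] by blast
  \<comment> \<open>The bumps have to fit into the neighbourhoods just found and to end before
    \<open>T\<close>.\<close>
  define \<epsilon> where "\<epsilon> = min (min d1 d2) (min ((T - s) / 2) ((T - t) / 2))"
  have "\<epsilon> > 0" using d1(1) d2(1) s t by (simp add: \<epsilon>_def)
  moreover have "\<epsilon> \<le> d1" "\<epsilon> \<le> d2" "\<epsilon> \<le> (T - s) / 2" "\<epsilon> \<le> (T - t) / 2"
    unfolding \<epsilon>_def by linarith+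
  ultimately have \<epsilon>: "\<epsilon> > 0" "\<epsilon> \<le> d1" "\<epsilon> \<le> d2" "\<epsilon> \<le> (T - s) / 2" "\<epsilon> \<le> (T - t) / 2" by blast+
  then have \<epsilon>T: "s + \<epsilon> < T" "t + \<epsilon> < T" using s t by (auto simp: field_simps)
  let ?c = "bump_step \<epsilon> \<epsilon>"
  define \<phi> where "\<phi> x = complex_of_real (bump_step \<epsilon> (x - s) - bump_step \<epsilon> (x - t))" for x
  have der: "(\<phi> has_vector_derivative of_real (bump \<epsilon> (x - s)) + (- 1) * of_real (bump \<epsilon> (x - t))) (at x)" for x
  proof -
    have sh: "((\<lambda>x. bump_step \<epsilon> (x - r)) has_vector_derivative bump \<epsilon> (x - r)) (at x)" for r
    proof -
      have "((\<lambda>t. t - r) has_vector_derivative 1) (at x)" by (auto intro!: derivative_eq_intros)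
      from vector_diff_chain_at[OF this bump_step_has_vector_derivative[of \<epsilon> "x - r"]]
      show ?thesis by (simp add: o_def)
    qed
    from has_vector_derivative_of_real[OF has_vector_derivative_diff[OF sh[of s] sh[of t], folded has_real_derivative_iff_has_vector_derivative]]
    show ?thesis unfolding \<phi>_def by simp
  qed
  then have td: "time_deriv \<phi> = (\<lambda>x. of_real (bump \<epsilon> (x - s)) + (- 1) * of_real (bump \<epsilon> (x - t)))"
    unfolding time_deriv_def by (intro ext vector_derivative_at)
  have "elementary_smooth (\<lambda>x. of_real (bump \<epsilon> (x - r)))" for r
  proof -
    have "(\<lambda>x. complex_of_real (bump \<epsilon> (x - r))) = (\<lambda>x. of_real (flat 0 (1 * (x - r))) * of_real (flat 0 ((- 1) * (x - (r + \<epsilon>)))))"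
      by (simp add: bump_def fun_eq_iff algebra_simps)
    then show ?thesis by (simp only: elementary_smooth.mult elementary_smooth.flat)
  qed
  then have "elementary_smooth \<phi>"
    by (intro elementary_smooth.primitive[OF _ der] elementary_smooth.add elementary_smooth.scale)
  moreover have "closure {x. \<phi> x \<noteq> 0} \<subseteq> {0<..<T}"
  proof -
    have "{x. \<phi> x \<noteq> 0} \<subseteq> {min s t..max s t + \<epsilon>}"
    proof
      fix x
      assume "x \<in> {x. \<phi> x \<noteq> 0}"
      then have x: "\<phi> x \<noteq> 0" by simp
      have "\<not> x < min s t" using x by (auto simp: \<phi>_def bump_step_left)
      moreover have "\<not> max s t + \<epsilon> < x"
      proof
        assume "max s t + \<epsilon> < x"
        then have "bump_step \<epsilon> (x - s) = ?c" "bump_step \<epsilon> (x - t) = ?c"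
          using \<epsilon>(1) by (auto intro!: bump_step_right)
        then show False using x by (simp add: \<phi>_def)
      qed
      ultimately show "x \<in> {min s t..max s t + \<epsilon>}" by (simp only: atLeastAtMost_iff not_less)
    qed
    then have "closure {x. \<phi> x \<noteq> 0} \<subseteq> {min s t..max s t + \<epsilon>}" by (rule closure_minimal) simp
    also have "\<dots> \<subseteq> {0<..<T}" using s t \<epsilon>T by auto
    finally show ?thesis .
  qed
  ultimately have "\<phi> \<in> time_test T" by (simp add: time_test_def elementary_smooth_time_deriv)
  from weak[OF this] have 0: "integral {0..T} (\<lambda>x. of_real (bump \<epsilon> (x - s)) * e x + (- 1) * (of_real (bump \<epsilon> (x - t)) * e x)) = 0"
    unfolding td by (simp add: algebra_simps)
  have cb: "continuous_on {0..T} (\<lambda>x. bump \<epsilon> (x - r))" for r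
    by (intro continuous_on_compose2[OF bump_continuous[of UNIV]] continuous_intros) auto
  define I where "I r = integral {0..T} (\<lambda>x. of_real (bump \<epsilon> (x - r)) * e x)" for r
  have "I s + (- 1) * I t = 0"
    using 0 unfolding I_def
    by (subst (asm) integral_add) (auto intro!: integrable_continuous_interval continuous_intros cb e)
  then have Ieq: "I s = I t" by simp
  have 1: "cmod (I s - of_real ?c * e s) \<le> ?c * \<kappa>" unfolding I_def
    by (rule bump_average_close[OF e \<epsilon>(1)]) (use s \<epsilon> \<epsilon>T d1 in auto)
  have 2: "cmod (I t - of_real ?c * e t) \<le> ?c * \<kappa>" unfolding I_def
    by (rule bump_average_close[OF e \<epsilon>(1)]) (use t \<epsilon> \<epsilon>T d2 in auto)
  have split: "of_real ?c * e s - of_real ?c * e t = (I t - of_real ?c * e t) - (I s - of_real ?c * e s)"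
    using Ieq by simp
  have "cmod (of_real ?c * e s - of_real ?c * e t) \<le> cmod (I t - of_real ?c * e t) + cmod (I s - of_real ?c * e s)"
    unfolding split by (rule norm_triangle_ineq4)
  then have "cmod (of_real ?c * e s - of_real ?c * e t) \<le> ?c * \<kappa> + ?c * \<kappa>"
    using 1 2 by linarith
  moreover have "cmod (of_real ?c * e s - of_real ?c * e t) = ?c * (3 * \<kappa>)"
    using bump_step_pos[OF \<epsilon>(1)] by (simp add: right_diff_distrib[symmetric] norm_mult \<kappa>_def)
  ultimately have "?c * \<kappa> \<le> 0" by (simp add: mult.commute)
  then show False using bump_step_pos[OF \<epsilon>(1)] \<kappa> by (simp add: mult_le_0_iff)
qed

text \<open>Subtracting a primitive of the right-hand side leaves a function with vanishing weak
  derivative, hence a constant. So \<open>d\<close> is differentiable, and an integrating factor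
  finishes the argument classically.\<close>

lemma weak_ode_unique:
  fixes d a :: "real \<Rightarrow> complex"
  assumes T: "T > 0" and d: "continuous_on {0..T} d" and a: "continuous_on {0..T} a" and d0: "d 0 = 0"
    and weak: "\<And>\<phi>. \<phi> \<in> time_test T \<Longrightarrow>
      integral {0..T} (\<lambda>t. time_deriv \<phi> t * d t) = \<i> * integral {0..T} (\<lambda>t. \<phi> t * (a t * d t))"
    and t: "t \<in> {0..T}"
  shows "d t = 0"
proof -
  \<comment> \<open>With this \<open>b\<close> the hypothesis says that \<open>d' = b\<close> holds
    weakly.\<close>
  define b where "b t = - \<i> * (a t * d t)" for t
  have cb: "continuous_on {0..T} b" unfolding b_def by (intro continuous_intros a d)
  define e where "e t = d t - integral {0..t} b" for t
  have p: "((\<lambda>t. integral {0..t} b) has_vector_derivative b t) (at t within {0..T})" if "t \<in> {0..T}" for t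
    by (rule integral_has_vector_derivative[OF cb that])
  have ci: "continuous_on {0..T} (\<lambda>t. integral {0..t} b)"
    unfolding continuous_on_eq_continuous_within using p has_vector_derivative_continuous by blast
  have ce: "continuous_on {0..T} e" unfolding e_def by (intro continuous_intros d ci)
  have "integral {0..T} (\<lambda>t. time_deriv \<phi> t * e t) = 0" if \<phi>: "\<phi> \<in> time_test T" for \<phi>
  proof -
    have "integral {0..T} (\<lambda>t. time_deriv \<phi> t * e t)
        = integral {0..T} (\<lambda>t. time_deriv \<phi> t * d t) - integral {0..T} (\<lambda>t. time_deriv \<phi> t * integral {0..t} b)"
      unfolding e_def right_diff_distrib
      by (intro integral_diff integrable_continuous_interval continuous_intros time_test_props[OF \<phi>] d ci)
    also have "\<dots> = \<i> * integral {0..T} (\<lambda>t. \<phi> t * (a t * d t)) + integral {0..T} (\<lambda>t. \<phi> t * b t)"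
      using weak[OF \<phi>] time_test_by_parts[OF \<phi> T p cb] by simp
    also have "integral {0..T} (\<lambda>t. \<phi> t * b t) = - \<i> * integral {0..T} (\<lambda>t. \<phi> t * (a t * d t))"
      unfolding b_def integral_mult_right[symmetric] by (simp add: mult_ac)
    finally show ?thesis by simp
  qed
  then have const: "e s = e t" if "s \<in> {0<..<T}" "t \<in> {0<..<T}" for s t
    using du_Bois_Reymond[OF ce] that by blast
  have cl: "closure {0<..<T} = {0..T}" using T by simp
  \<comment> \<open>Constancy extends from the open interval to its closure by continuity, and the
    value at 0 is known.\<close>
  have e0: "e t = 0" if "t \<in> {0..T}" for t
  proof -
    have c: "e x = e (T / 2)" if "x \<in> {0..T}" for x
    proof (rule continuous_constant_on_closure[of "{0<..<T}" e])
      show "continuous_on (closure {0<..<T}) e" unfolding cl by (rule ce)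
      show "x \<in> closure {0<..<T}" unfolding cl by (rule that)
      show "e y = e (T / 2)" if "y \<in> {0<..<T}" for y
        by (rule const[OF that]) (use T in simp)
    qed
    have "e 0 = 0" using d0 by (simp add: e_def)
    then show ?thesis using c[of 0] c[OF that] T by simp
  qed
  have deq: "d t = integral {0..t} b" if "t \<in> {0..T}" for t
    using e0[OF that] by (simp add: e_def)
  have dd: "(d has_vector_derivative b t) (at t within {0..T})" if "t \<in> {0..T}" for t
    by (rule has_vector_derivative_transform[OF that _ p[OF that]]) (rule deq)
  define A where "A t = integral {0..t} a" for t
  have Ad: "(A has_vector_derivative a t) (at t within {0..T})" if "t \<in> {0..T}" for t
    unfolding A_def by (rule integral_has_vector_derivative[OF a that])
  have deriv0: "((\<lambda>t. exp (\<i> * A t) * d t) has_vector_derivative 0) (at t within {0..T})" if "t \<in> {0..T}" for t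
  proof -
    have "((\<lambda>t. \<i> * A t) has_vector_derivative \<i> * a t) (at t within {0..T})"
      by (rule has_vector_derivative_mult_right[OF Ad[OF that]])
    from field_vector_diff_chain_within[OF this, of exp "exp (\<i> * A t)"]
    have "((\<lambda>t. exp (\<i> * A t)) has_vector_derivative (\<i> * a t) * exp (\<i> * A t)) (at t within {0..T})"
      by (simp add: o_def DERIV_exp has_field_derivative_at_within)
    from has_vector_derivative_mult[OF this dd[OF that]]
    show ?thesis by (simp add: b_def algebra_simps)
  qed
  show ?thesis
  proof (rule has_vector_derivative_zero_constant[of "{0..T}" "\<lambda>t. exp (\<i> * A t) * d t"])
    fix c
    assume c: "\<And>x. x \<in> {0..T} \<Longrightarrow> exp (\<i> * A x) * d x = c"
    have "exp (\<i> * A 0) * d 0 = c" by (rule c) (use T in simp)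
    then have "c = 0" unfolding d0 by (simp only: mult_zero_right)
    from trans[OF c[OF t] this] show "d t = 0"
      by (simp only: mult_eq_0_iff exp_not_eq_zero simp_thms)
  qed (rule convex_real_interval deriv0; assumption?)+
qed

section \<open>The ordinary differential equation for a Fourier coefficient\<close>

text \<open>Variation of constants for \<open>y' = \<i> * (f - a * y)\<close>, with the propagator
  split between \<open>t\<close> and \<open>\<tau>\<close> so that it can be differentiated as a
  product.\<close>

definition duhamel :: "(real \<Rightarrow> complex) \<Rightarrow> (real \<Rightarrow> complex) \<Rightarrow> complex \<Rightarrow> real \<Rightarrow> complex" where
  "duhamel a f c t = exp (- \<i> * integral {0..t} a) * (c + \<i> * integral {0..t} (\<lambda>\<tau>. exp (\<i> * integral {0..\<tau>} a) * f \<tau>))"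

lemma duhamel_0 [simp]: "duhamel a f c 0 = c"
  by (simp add: duhamel_def)

lemma exp_primitive_has_vector_derivative:
  fixes a :: "real \<Rightarrow> complex"
  assumes a: "continuous_on {0..T} a" and t: "t \<in> {0..T}"
  shows "((\<lambda>t. exp (k * integral {0..t} a)) has_vector_derivative (k * a t) * exp (k * integral {0..t} a)) (at t within {0..T})"
proof -
  have "((\<lambda>t. k * integral {0..t} a) has_vector_derivative k * a t) (at t within {0..T})"
    by (rule has_vector_derivative_mult_right[OF integral_has_vector_derivative[OF a t]])
  from field_vector_diff_chain_within[OF this, of exp "exp (k * integral {0..t} a)"]
  show ?thesis by (simp add: o_def DERIV_exp has_field_derivative_at_within)
qed

lemma exp_primitive_continuous:
  fixes a :: "real \<Rightarrow> complex"
  assumes a: "continuous_on {0..T} a"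
  shows "continuous_on {0..T} (\<lambda>t. exp (k * integral {0..t} a))"
  unfolding continuous_on_eq_continuous_within
  using exp_primitive_has_vector_derivative[OF a] has_vector_derivative_continuous by blast

lemma duhamel_has_vector_derivative:
  assumes a: "continuous_on {0..T} a" and f: "continuous_on {0..T} f" and t: "t \<in> {0..T}"
  shows "(duhamel a f c has_vector_derivative \<i> * (f t - a t * duhamel a f c t)) (at t within {0..T})"
proof -
  let ?E = "\<lambda>k t. exp (k * integral {0..t} a)"
  let ?J = "\<lambda>t. c + \<i> * integral {0..t} (\<lambda>\<tau>. ?E \<i> \<tau> * f \<tau>)"
  have "continuous_on {0..T} (\<lambda>\<tau>. ?E \<i> \<tau> * f \<tau>)"
    by (intro continuous_on_mult exp_primitive_continuous a f)
  from integral_has_vector_derivative[OF this t]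
  have "(?J has_vector_derivative \<i> * (?E \<i> t * f t)) (at t within {0..T})"
    by (auto intro!: derivative_eq_intros)
  from has_vector_derivative_mult[OF exp_primitive_has_vector_derivative[OF a t, of "- \<i>"] this]
  have "((\<lambda>t. ?E (- \<i>) t * ?J t) has_vector_derivative
      ?E (- \<i>) t * (\<i> * (?E \<i> t * f t)) + (- \<i> * a t) * ?E (- \<i>) t * ?J t) (at t within {0..T})" .
  moreover have "?E (- \<i>) t * (\<i> * (?E \<i> t * f t)) + (- \<i> * a t) * ?E (- \<i>) t * ?J t
      = \<i> * (f t - a t * (?E (- \<i>) t * ?J t))"
  proof -
    have "?E (- \<i>) t * ?E \<i> t = 1" by (simp add: exp_add[symmetric])
    then have "?E (- \<i>) t * (\<i> * (?E \<i> t * f t)) = \<i> * f t" by (simp add: mult.left_commute mult.assoc[symmetric])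
    then show ?thesis by (simp add: algebra_simps)
  qed
  ultimately show ?thesis by (simp add: duhamel_def[abs_def])
qed

text \<open>Under strong damping the exponential at \<open>\<tau>\<close> alone can be huge, so the
  two exponentials are recombined into the propagator from \<open>\<tau>\<close> to
  \<open>t\<close>. Its modulus is the exponential of the integral of \<open>Im a\<close> over the
  forward interval, for which an upper bound on \<open>Im a\<close> is enough.\<close>

lemma norm_duhamel_le:
  assumes a: "continuous_on {0..T} a" and f: "continuous_on {0..T} f" and t: "t \<in> {0..T}"
    and K: "K \<ge> 0" "\<And>\<tau>. \<tau> \<in> {0..T} \<Longrightarrow> Im (a \<tau>) \<le> K"
  shows "cmod (duhamel a f c t) \<le> exp (K * T) * (cmod c + integral {0..t} (\<lambda>\<tau>. cmod (f \<tau>)))"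
proof -
  let ?A = "\<lambda>t. integral {0..t} a"
  have sub: "{0..t} \<subseteq> {0..T}" using t by auto
  have ia: "a integrable_on {u..v}" if "{u..v} \<subseteq> {0..T}" for u v
    by (intro integrable_continuous_interval continuous_on_subset[OF a that])
  have propagator: "cmod (exp (- \<i> * (?A t - ?A \<tau>))) \<le> exp (K * T)" if \<tau>: "\<tau> \<in> {0..t}" for \<tau>
  proof -
    have s2: "{\<tau>..t} \<subseteq> {0..T}" using \<tau> t by auto
    have "?A \<tau> + integral {\<tau>..t} a = ?A t"
      using \<tau> by (intro Henstock_Kurzweil_Integration.integral_combine ia[OF sub]) auto
    then have eq: "?A t - ?A \<tau> = integral {\<tau>..t} a" by (simp add: algebra_simps)
    have "Im (integral {\<tau>..t} a) = integral {\<tau>..t} (\<lambda>x. Im (a x))"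
      using integral_linear[OF ia[OF s2] bounded_linear_Im] by (simp add: o_def)
    also have "\<dots> \<le> integral {\<tau>..t} (\<lambda>x. K)"
    proof (rule integral_le)
      show "(\<lambda>x. Im (a x)) integrable_on {\<tau>..t}"
        using integrable_linear[OF ia[OF s2] bounded_linear_Im] by (simp add: o_def)
      show "Im (a x) \<le> K" if "x \<in> {\<tau>..t}" for x using K(2) that s2 by blast
    qed auto
    also have "\<dots> = K * (t - \<tau>)" using \<tau> by simp
    also have "\<dots> \<le> K * T" using \<tau> t K by (intro mult_left_mono) auto
    finally show ?thesis by (simp add: eq)
  qed
  let ?h = "\<lambda>\<tau>. exp (- \<i> * (?A t - ?A \<tau>)) * f \<tau>"
  have h: "exp (- \<i> * ?A t) * (exp (\<i> * ?A \<tau>) * f \<tau>) = ?h \<tau>" for \<tau>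
    unfolding mult.assoc[symmetric] exp_add[symmetric] by (simp add: right_diff_distrib)
  \<comment> \<open>The initial value is propagated from time 0, where the primitive
    vanishes.\<close>
  have "duhamel a f c t = exp (- \<i> * (?A t - ?A 0)) * c + \<i> * integral {0..t} ?h"
    unfolding duhamel_def distrib_left h[symmetric] integral_mult_right by (simp add: mult_ac)
  then have "cmod (duhamel a f c t) \<le> cmod (exp (- \<i> * (?A t - ?A 0))) * cmod c + cmod (integral {0..t} ?h)"
    using norm_triangle_ineq[of "exp (- \<i> * (?A t - ?A 0)) * c" "\<i> * integral {0..t} ?h"]
    by (simp only: norm_mult norm_ii mult_1_left)
  also have "\<dots> \<le> exp (K * T) * cmod c + exp (K * T) * integral {0..t} (\<lambda>\<tau>. cmod (f \<tau>))"
  proof (intro add_mono mult_right_mono)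
    show "cmod (exp (- \<i> * (?A t - ?A 0))) \<le> exp (K * T)" using t by (intro propagator) auto
    have cf: "continuous_on {0..t} f" by (rule continuous_on_subset[OF f sub])
    have "cmod (integral {0..t} ?h) \<le> integral {0..t} (\<lambda>\<tau>. exp (K * T) * cmod (f \<tau>))"
    proof (rule integral_norm_bound_integral)
      have "continuous_on {0..t} (\<lambda>\<tau>. exp (- \<i> * ?A t) * (exp (\<i> * ?A \<tau>) * f \<tau>))"
        by (intro continuous_on_mult continuous_on_const cf continuous_on_subset[OF exp_primitive_continuous[OF a] sub])
      then show "?h integrable_on {0..t}" unfolding h by (rule integrable_continuous_interval)
      show "(\<lambda>\<tau>. exp (K * T) * cmod (f \<tau>)) integrable_on {0..t}"
        by (intro integrable_continuous_interval continuous_intros cf)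
      show "cmod (?h \<tau>) \<le> exp (K * T) * cmod (f \<tau>)" if "\<tau> \<in> {0..t}" for \<tau>
        unfolding norm_mult by (intro mult_right_mono propagator that) auto
    qed
    then show "cmod (integral {0..t} ?h) \<le> exp (K * T) * integral {0..t} (\<lambda>\<tau>. cmod (f \<tau>))" by simp
  qed simp
  finally show ?thesis unfolding distrib_left .
qed

text \<open>Cauchy-Schwarz from the nonnegativity of the integral of \<open>(g - m)^2\<close>, where
  \<open>m\<close> is the mean of \<open>g\<close>.\<close>

lemma integral_square_le:
  fixes g :: "real \<Rightarrow> real"
  assumes g: "continuous_on {a..b} g" and ab: "a \<le> b"
  shows "(integral {a..b} g)\<^sup>2 \<le> (b - a) * integral {a..b} (\<lambda>t. (g t)\<^sup>2)"
proof (cases "a = b")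
  case False
  then have L: "b - a > 0" using ab by simp
  define I where "I = integral {a..b} g"
  define m where "m = I / (b - a)"
  have i1: "((\<lambda>t. (g t)\<^sup>2) has_integral integral {a..b} (\<lambda>t. (g t)\<^sup>2)) {a..b}"
    by (intro integrable_integral integrable_continuous_interval continuous_intros g)
  have i2: "(g has_integral I) {a..b}" unfolding I_def
    by (intro integrable_integral integrable_continuous_interval g)
  have "((\<lambda>t. (g t)\<^sup>2 - 2 * m * g t + m\<^sup>2) has_integral
      integral {a..b} (\<lambda>t. (g t)\<^sup>2) - 2 * m * I + (b - a) * m\<^sup>2) {a..b}"
    using ab by (intro has_integral_add has_integral_diff has_integral_mult_right i1 i2)
      (use has_integral_const_real[of "m\<^sup>2" a b] in simp)
  moreover have "(g t)\<^sup>2 - 2 * m * g t + m\<^sup>2 \<ge> 0" for t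
    using zero_le_power2[of "g t - m"] by (simp add: power2_diff algebra_simps)
  ultimately have "0 \<le> integral {a..b} (\<lambda>t. (g t)\<^sup>2) - 2 * m * I + (b - a) * m\<^sup>2"
    by (rule has_integral_nonneg)
  also have "2 * m * I = 2 * (I\<^sup>2 / (b - a))" by (simp add: m_def power2_eq_square)
  also have "(b - a) * m\<^sup>2 = I\<^sup>2 / (b - a)" using L by (simp add: m_def power2_eq_square)
  finally have "I\<^sup>2 / (b - a) \<le> integral {a..b} (\<lambda>t. (g t)\<^sup>2)" by simp
  then show ?thesis using L by (simp add: I_def pos_divide_le_eq mult.commute)
qed simp

section \<open>Families of solutions\<close>

text \<open>Integration in time costs the squared length of the interval: one factor comes from
  Cauchy-Schwarz, the other from integrating the bound \<open>\<epsilon>\<close>.\<close>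

lemma integral_cmod_square_sum_le:
  fixes f :: "int^'n::finite \<Rightarrow> real \<Rightarrow> complex"
  assumes f: "\<And>\<xi>. continuous_on {a..b} (f \<xi>)" and ab: "a \<le> b"
    and S: "finite S" and w: "\<And>\<xi>. 0 \<le> w \<xi>"
    and le: "\<And>t. t \<in> {a..b} \<Longrightarrow> (\<Sum>\<xi>\<in>S. (cmod (f \<xi> t))\<^sup>2 * w \<xi>) \<le> \<epsilon>"
  shows "(\<Sum>\<xi>\<in>S. (integral {a..b} (\<lambda>t. cmod (f \<xi> t)))\<^sup>2 * w \<xi>) \<le> (b - a)\<^sup>2 * \<epsilon>"
proof -
  have c: "continuous_on {a..b} (\<lambda>t. cmod (f \<xi> t))" for \<xi> by (intro continuous_intros f)
  have i: "(\<lambda>t. (cmod (f \<xi> t))\<^sup>2 * w \<xi>) integrable_on {a..b}" for \<xi>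
    by (intro integrable_continuous_interval continuous_intros f)
  have "(\<Sum>\<xi>\<in>S. (integral {a..b} (\<lambda>t. cmod (f \<xi> t)))\<^sup>2 * w \<xi>)
      \<le> (\<Sum>\<xi>\<in>S. ((b - a) * integral {a..b} (\<lambda>t. (cmod (f \<xi> t))\<^sup>2)) * w \<xi>)"
    by (intro sum_mono mult_right_mono integral_square_le c ab w)
  also have "\<dots> = (b - a) * (\<Sum>\<xi>\<in>S. integral {a..b} (\<lambda>t. (cmod (f \<xi> t))\<^sup>2 * w \<xi>))"
    by (simp only: sum_distrib_left integral_mult_left mult.assoc)
  also have "(\<Sum>\<xi>\<in>S. integral {a..b} (\<lambda>t. (cmod (f \<xi> t))\<^sup>2 * w \<xi>))
      = integral {a..b} (\<lambda>t. \<Sum>\<xi>\<in>S. (cmod (f \<xi> t))\<^sup>2 * w \<xi>)"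
    by (rule integral_sum[symmetric, OF S i])
  also have "(b - a) * \<dots> \<le> (b - a) * integral {a..b} (\<lambda>t. \<epsilon>)"
  proof (rule mult_left_mono[OF integral_le])
    show "(\<lambda>t. \<Sum>\<xi>\<in>S. (cmod (f \<xi> t))\<^sup>2 * w \<xi>) integrable_on {a..b}"
      by (intro integrable_continuous_interval continuous_intros f)
  qed (use ab le in auto)
  also have "\<dots> = (b - a)\<^sup>2 * \<epsilon>" using ab by (simp add: power2_eq_square)
  finally show ?thesis .
qed

text \<open>The transfer principle for tails: an estimate over arbitrary finite sets of frequencies,
  with \<open>K\<close> independent of the set, keeps the same exceptional set \<open>F\<close>,
  even when index sets and Sobolev orders differ.\<close>

lemma l2_tails_dominated:
  fixes c :: "'i \<Rightarrow> int^'n::finite \<Rightarrow> complex"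
  assumes tails: "l2_tails r A c" and K: "K \<ge> 0"
    and le: "\<And>S \<epsilon> j. finite S \<Longrightarrow> j \<in> B \<Longrightarrow>
      (\<And>i. i \<in> A \<Longrightarrow> (\<Sum>\<xi>\<in>S. (cmod (c i \<xi>))\<^sup>2 * bracket \<xi> powr (2 * r)) \<le> \<epsilon>) \<Longrightarrow>
      (\<Sum>\<xi>\<in>S. (cmod (d j \<xi>))\<^sup>2 * bracket \<xi> powr (2 * r')) \<le> K * \<epsilon>"
  shows "l2_tails r' B d"
  unfolding l2_tails_def
proof (intro allI impI)
  fix \<epsilon> :: real
  assume \<epsilon>: "\<epsilon> > 0"
  \<comment> \<open>Dividing by \<open>K + 1\<close> also covers \<open>K = 0\<close>.\<close>
  then have "\<epsilon> / (K + 1) > 0" using K by simp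
  then obtain F where F: "finite F" "\<forall>i\<in>A. \<forall>S. finite S \<and> S \<inter> F = {} \<longrightarrow>
      (\<Sum>\<xi>\<in>S. (cmod (c i \<xi>))\<^sup>2 * bracket \<xi> powr (2 * r)) \<le> \<epsilon> / (K + 1)"
    using tails[unfolded l2_tails_def, rule_format, of "\<epsilon> / (K + 1)"] by blast
  have "(\<Sum>\<xi>\<in>S. (cmod (d j \<xi>))\<^sup>2 * bracket \<xi> powr (2 * r')) \<le> \<epsilon>"
    if "j \<in> B" "finite S" "S \<inter> F = {}" for j S
  proof -
    have "(\<Sum>\<xi>\<in>S. (cmod (d j \<xi>))\<^sup>2 * bracket \<xi> powr (2 * r')) \<le> K * (\<epsilon> / (K + 1))"
      by (rule le[OF that(2,1)]) (use F(2) that in blast)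
    also have "\<dots> \<le> \<epsilon>" using K \<epsilon> by (simp add: field_simps)
    finally show ?thesis .
  qed
  then show "\<exists>F. finite F \<and> (\<forall>i\<in>B. \<forall>S. finite S \<and> S \<inter> F = {} \<longrightarrow>
     (\<Sum>\<xi>\<in>S. (cmod (d i \<xi>))\<^sup>2 * bracket \<xi> powr (2 * r')) \<le> \<epsilon>)"
    using F(1) by blast
qed

lemma l2_tails_Un:
  assumes A: "l2_tails r A c" and B: "l2_tails r B c"
  shows "l2_tails r (A \<union> B) c"
  unfolding l2_tails_def
proof (intro allI impI)
  fix \<epsilon> :: real
  assume \<epsilon>: "\<epsilon> > 0"
  let ?s = "\<lambda>i S. \<Sum>\<xi>\<in>S. (cmod (c i \<xi>))\<^sup>2 * bracket \<xi> powr (2 * r)"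
  obtain F where F: "finite F" "\<forall>i\<in>A. \<forall>S. finite S \<and> S \<inter> F = {} \<longrightarrow> ?s i S \<le> \<epsilon>"
    using A[unfolded l2_tails_def, rule_format, OF \<epsilon>] by blast
  obtain G where G: "finite G" "\<forall>i\<in>B. \<forall>S. finite S \<and> S \<inter> G = {} \<longrightarrow> ?s i S \<le> \<epsilon>"
    using B[unfolded l2_tails_def, rule_format, OF \<epsilon>] by blast
  have "?s i S \<le> \<epsilon>" if "i \<in> A \<union> B" "finite S" "S \<inter> (F \<union> G) = {}" for i S
    using F(2)[rule_format, of i S] G(2)[rule_format, of i S] that by blast
  then show "\<exists>F. finite F \<and> (\<forall>i\<in>A \<union> B. \<forall>S. finite S \<and> S \<inter> F = {} \<longrightarrow> ?s i S \<le> \<epsilon>)"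
    using F(1) G(1) by blast
qed

lemma l2_tails_image: "l2_tails r A (\<lambda>i. c (h i)) \<Longrightarrow> l2_tails r (h ` A) c"
  by (simp add: l2_tails_def)

lemma l2_tails_imp_sobolev:
  fixes c :: "'i \<Rightarrow> int^'n::finite \<Rightarrow> complex"
  assumes "l2_tails r A c" "i \<in> A"
  shows "temperate (c i)" and "fourier_distr (c i) \<in> sobolev r"
proof -
  let ?s = "\<lambda>S. \<Sum>\<xi>\<in>S. (cmod (c i \<xi>))\<^sup>2 * bracket \<xi> powr (2 * r)"
  obtain F where F: "finite F" "\<forall>i\<in>A. \<forall>S. finite S \<and> S \<inter> F = {} \<longrightarrow>
      (\<Sum>\<xi>\<in>S. (cmod (c i \<xi>))\<^sup>2 * bracket \<xi> powr (2 * r)) \<le> 1"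
    using assms(1)[unfolded l2_tails_def, rule_format, of 1] by auto
  have "?s S \<le> ?s F + 1" if S: "finite S" for S
  proof -
    have "?s S = ?s (S \<inter> F) + ?s (S - F)" by (rule sum.Int_Diff[OF S])
    moreover have "?s (S \<inter> F) \<le> ?s F" using F(1) by (intro sum_mono2) auto
    moreover have "finite (S - F)" "(S - F) \<inter> F = {}" using S by auto
    then have "?s (S - F) \<le> 1" using F(2) assms(2) by blast
    ultimately show ?thesis by linarith
  qed
  then show "temperate (c i)" "fourier_distr (c i) \<in> sobolev r"
    using fourier_distr_sobolev[of "c i" r "?s F + 1"] by blast+
qed

text \<open>The quotient form matches the limit in \<open>C1_maps\<close> once a coefficient or a
  pairing has been taken.\<close>

lemma has_vector_derivative_iff_quotient:
  fixes y :: "real \<Rightarrow> complex"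
  shows "(y has_vector_derivative y') (at t within S)
    \<longleftrightarrow> ((\<lambda>\<tau>. (y \<tau> - y t) / of_real (\<tau> - t)) \<longlongrightarrow> y') (at t within S)"
proof -
  let ?r = "\<lambda>\<tau>. (1 / norm (\<tau> - t)) *\<^sub>R (y \<tau> - (y t + (\<tau> - t) *\<^sub>R y'))"
  let ?q = "\<lambda>\<tau>. (y \<tau> - y t) / of_real (\<tau> - t) - y'"
  have "norm (?r \<tau>) = norm (?q \<tau>)" if "\<tau> \<noteq> t" for \<tau>
  proof -
    have "?q \<tau> = (y \<tau> - (y t + (\<tau> - t) *\<^sub>R y')) / of_real (\<tau> - t)"
      using that by (simp add: scaleR_conv_of_real field_simps del: of_real_diff)
    then show ?thesis by (simp add: norm_divide del: of_real_diff)
  qed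
  then have ev: "\<forall>\<^sub>F \<tau> in at t within S. norm (?r \<tau>) = norm (?q \<tau>)"
    by (simp add: eventually_at_filter)
  have "(y has_vector_derivative y') (at t within S) \<longleftrightarrow> (?r \<longlongrightarrow> 0) (at t within S)"
    unfolding has_vector_derivative_def has_derivative_within using bounded_linear_scaleR_left by blast
  also have "\<dots> \<longleftrightarrow> ((\<lambda>\<tau>. norm (?r \<tau>)) \<longlongrightarrow> 0) (at t within S)" by (rule tendsto_norm_zero_iff[symmetric])
  also have "\<dots> \<longleftrightarrow> ((\<lambda>\<tau>. norm (?q \<tau>)) \<longlongrightarrow> 0) (at t within S)" by (rule tendsto_cong[OF ev])
  also have "\<dots> \<longleftrightarrow> (?q \<longlongrightarrow> 0) (at t within S)" by (rule tendsto_norm_zero_iff)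
  also have "\<dots> \<longleftrightarrow> ((\<lambda>\<tau>. (y \<tau> - y t) / of_real (\<tau> - t)) \<longlongrightarrow> y') (at t within S)" by (rule LIM_zero_iff)
  finally show ?thesis .
qed

section \<open>The symbol, the solution coefficients and their difference quotients\<close>

locale torus_cauchy =
  fixes T :: real and a2 a0 :: "real \<Rightarrow> complex" and a1 :: "'n::finite \<Rightarrow> real \<Rightarrow> complex"
  assumes T: "T > 0"
    and a2: "continuous_on {0..T} a2"
    and a1: "\<And>j. continuous_on {0..T} (a1 j)"
    and a0: "continuous_on {0..T} a0"
    and Im_a2: "\<And>t. t \<in> {0..T} \<Longrightarrow> Im (a2 t) \<le> 0"
    and Im_a1: "\<And>j t. t \<in> {0..T} \<Longrightarrow> Im (a1 j t) = 0"
begin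

abbreviation "symb t \<equiv> symbol (a2 t) (\<lambda>j. a1 j t) (a0 t)"

lemma sym_continuous: "continuous_on {0..T} (\<lambda>t. symb t \<xi>)"
  unfolding symbol_def by (intro continuous_intros a2 a1 a0)

lemma bounded_continuous_coeff:
  fixes g :: "real \<Rightarrow> complex"
  assumes "continuous_on {0..T} g"
  shows "\<exists>B\<ge>0. \<forall>t\<in>{0..T}. cmod (g t) \<le> B"
proof -
  have "compact (g ` {0..T})" by (rule compact_continuous_image[OF assms compact_Icc])
  then obtain B where B: "\<And>y. y \<in> g ` {0..T} \<Longrightarrow> cmod y \<le> B"
    using compact_imp_bounded bounded_iff by metis
  have "cmod (g 0) \<le> B" using B T by simp
  then have "B \<ge> 0" using norm_ge_zero order_trans by blast
  then show ?thesis using B by blast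
qed

text \<open>The second-order part has nonpositive imaginary part and the first-order part is real;
  what remains is \<open>a0\<close>, whose bound on the compact interval does not see the
  frequency.\<close>

lemma Im_sym_bounded: "\<exists>K\<ge>0. \<forall>\<xi>. \<forall>t\<in>{0..T}. Im (symb t \<xi>) \<le> K"
proof -
  obtain K where K: "K \<ge> 0" "\<And>t. t \<in> {0..T} \<Longrightarrow> cmod (a0 t) \<le> K"
    using bounded_continuous_coeff[OF a0] by blast
  have "Im (symb t \<xi>) \<le> K" if t: "t \<in> {0..T}" for t \<xi>
  proof -
    have "Im (a2 t * complex_of_real ((norm (ivec \<xi>))\<^sup>2)) \<le> 0"
      using mult_nonpos_nonneg[OF Im_a2[OF t], of "(norm (ivec \<xi>))\<^sup>2"] by (simp del: of_real_power)
    moreover have "Im (\<Sum>j\<in>UNIV. a1 j t * of_int (\<xi> $ j)) = 0"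
      using Im_a1[OF t] by simp
    moreover have "Im (a0 t) \<le> K" using K(2)[OF t] abs_Im_le_cmod[of "a0 t"] by linarith
    ultimately show ?thesis by (simp add: symbol_def)
  qed
  then show ?thesis using K(1) by blast
qed

text \<open>The quadratic growth is the source of the loss of two orders in the time
  derivative.\<close>

lemma norm_sym_bounded: "\<exists>B\<ge>0. \<forall>\<xi>. \<forall>t\<in>{0..T}. cmod (symb t \<xi>) \<le> B * (bracket \<xi>)\<^sup>2"
proof -
  obtain B2 where B2: "B2 \<ge> 0" "\<And>t. t \<in> {0..T} \<Longrightarrow> cmod (a2 t) \<le> B2"
    using bounded_continuous_coeff[OF a2] by blast
  obtain B0 where B0: "B0 \<ge> 0" "\<And>t. t \<in> {0..T} \<Longrightarrow> cmod (a0 t) \<le> B0"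
    using bounded_continuous_coeff[OF a0] by blast
  have "\<forall>j. \<exists>B\<ge>0. \<forall>t\<in>{0..T}. cmod (a1 j t) \<le> B" using bounded_continuous_coeff[OF a1] by blast
  then obtain B1 where B1: "\<And>j. B1 j \<ge> 0" "\<And>j t. t \<in> {0..T} \<Longrightarrow> cmod (a1 j t) \<le> B1 j"
    by metis
  have "cmod (symb t \<xi>) \<le> (B2 + (\<Sum>j\<in>UNIV. B1 j) + B0) * (bracket \<xi>)\<^sup>2" if t: "t \<in> {0..T}" for t \<xi>
  proof -
    have b: "1 \<le> (bracket \<xi>)\<^sup>2" "bracket \<xi> \<le> (bracket \<xi>)\<^sup>2" "(norm (ivec \<xi>))\<^sup>2 \<le> (bracket \<xi>)\<^sup>2"
      using bracket_ge_1[of \<xi>] self_le_power[of "bracket \<xi>" 2] by (auto simp: bracket_def intro!: power_mono)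
    have "cmod (symb t \<xi>) \<le> cmod (a2 t) * (norm (ivec \<xi>))\<^sup>2 + cmod (\<Sum>j\<in>UNIV. a1 j t * of_int (\<xi> $ j)) + cmod (a0 t)"
      unfolding symbol_def
      by (intro order_trans[OF norm_triangle_ineq] add_mono order_refl) (simp add: norm_mult norm_power)
    also have "\<dots> \<le> B2 * (bracket \<xi>)\<^sup>2 + (\<Sum>j\<in>UNIV. B1 j * (bracket \<xi>)\<^sup>2) + B0 * (bracket \<xi>)\<^sup>2"
    proof (intro add_mono)
      show "cmod (a2 t) * (norm (ivec \<xi>))\<^sup>2 \<le> B2 * (bracket \<xi>)\<^sup>2"
        using B2 t b by (intro mult_mono) auto
      have "cmod (a1 j t * of_int (\<xi> $ j)) \<le> B1 j * (bracket \<xi>)\<^sup>2" for j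
        unfolding norm_mult using B1 t b(2) abs_component_le_bracket[of \<xi> j] by (intro mult_mono) auto
      then show "cmod (\<Sum>j\<in>UNIV. a1 j t * of_int (\<xi> $ j)) \<le> (\<Sum>j\<in>UNIV. B1 j * (bracket \<xi>)\<^sup>2)"
        by (intro order_trans[OF norm_sum] sum_mono)
      have "cmod (a0 t) * 1 \<le> B0 * (bracket \<xi>)\<^sup>2" using B0 t b(1) by (intro mult_mono) auto
      then show "cmod (a0 t) \<le> B0 * (bracket \<xi>)\<^sup>2" by simp
    qed
    also have "\<dots> = (B2 + (\<Sum>j\<in>UNIV. B1 j) + B0) * (bracket \<xi>)\<^sup>2"
      by (simp add: distrib_right sum_distrib_right)
    finally show ?thesis .
  qed
  moreover have "B2 + (\<Sum>j\<in>UNIV. B1 j) + B0 \<ge> 0" using B2 B1 B0 by (intro add_nonneg_nonneg sum_nonneg) auto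
  ultimately show ?thesis by blast
qed

definition sol_coeff :: "(int^'n \<Rightarrow> real \<Rightarrow> complex) \<Rightarrow> (int^'n \<Rightarrow> complex) \<Rightarrow> real \<Rightarrow> int^'n \<Rightarrow> complex" where
  "sol_coeff f g t \<xi> = duhamel (\<lambda>t. symb t \<xi>) (f \<xi>) (g \<xi>) t"

text \<open>The time derivative as prescribed by the equation, so that its bounds follow from those
  of the source and of the solution.\<close>

definition sol_coeff' :: "(int^'n \<Rightarrow> real \<Rightarrow> complex) \<Rightarrow> (int^'n \<Rightarrow> complex) \<Rightarrow> real \<Rightarrow> int^'n \<Rightarrow> complex" where
  "sol_coeff' f g t \<xi> = \<i> * (f \<xi> t - symb t \<xi> * sol_coeff f g t \<xi>)"

lemma sol_coeff_deriv:
  assumes "continuous_on {0..T} (f \<xi>)" "t \<in> {0..T}"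
  shows "((\<lambda>t. sol_coeff f g t \<xi>) has_vector_derivative sol_coeff' f g t \<xi>) (at t within {0..T})"
  unfolding sol_coeff_def sol_coeff'_def using duhamel_has_vector_derivative[OF sym_continuous assms] by simp

lemma sol_coeff_continuous:
  assumes "continuous_on {0..T} (f \<xi>)"
  shows "continuous_on {0..T} (\<lambda>t. sol_coeff f g t \<xi>)"
  unfolding continuous_on_eq_continuous_within
  using sol_coeff_deriv[where f = f and \<xi> = \<xi>, OF assms] has_vector_derivative_continuous by blast

lemma sol_coeff'_continuous:
  assumes "continuous_on {0..T} (f \<xi>)"
  shows "continuous_on {0..T} (\<lambda>t. sol_coeff' f g t \<xi>)"
  unfolding sol_coeff'_def by (intro continuous_intros assms sym_continuous sol_coeff_continuous)

text \<open>\<open>M\<close> is chosen before \<open>f\<close>, \<open>g\<close> and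
  \<open>\<xi>\<close>, and the integral runs up to \<open>T\<close>, which makes the estimate
  uniform in frequency and time.\<close>

lemma norm_sol_coeff_le:
  "\<exists>M\<ge>0. \<forall>f g \<xi>. continuous_on {0..T} (f \<xi>) \<longrightarrow> (\<forall>t\<in>{0..T}.
     cmod (sol_coeff f g t \<xi>) \<le> M * (cmod (g \<xi>) + integral {0..T} (\<lambda>\<tau>. cmod (f \<xi> \<tau>))))"
proof -
  obtain K where K: "K \<ge> 0" "\<forall>\<xi>. \<forall>t\<in>{0..T}. Im (symb t \<xi>) \<le> K" using Im_sym_bounded by blast
  have "cmod (sol_coeff f g t \<xi>) \<le> exp (K * T) * (cmod (g \<xi>) + integral {0..T} (\<lambda>\<tau>. cmod (f \<xi> \<tau>)))"
    if f: "continuous_on {0..T} (f \<xi>)" and t: "t \<in> {0..T}" for f g \<xi> t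
  proof -
    have "cmod (sol_coeff f g t \<xi>) \<le> exp (K * T) * (cmod (g \<xi>) + integral {0..t} (\<lambda>\<tau>. cmod (f \<xi> \<tau>)))"
      unfolding sol_coeff_def by (rule norm_duhamel_le[OF sym_continuous f t K(1)]) (use K(2) in blast)
    also have "\<dots> \<le> exp (K * T) * (cmod (g \<xi>) + integral {0..T} (\<lambda>\<tau>. cmod (f \<xi> \<tau>)))"
    proof (intro mult_left_mono add_left_mono integral_subset_le)
      show "{0..t} \<subseteq> {0..T}" using t by auto
      then show "(\<lambda>\<tau>. cmod (f \<xi> \<tau>)) integrable_on {0..t}"
        by (intro integrable_continuous_interval continuous_intros continuous_on_subset[OF f])
      show "(\<lambda>\<tau>. cmod (f \<xi> \<tau>)) integrable_on {0..T}"
        by (intro integrable_continuous_interval continuous_intros f)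
    qed auto
    finally show ?thesis .
  qed
  then show ?thesis by (intro exI[of _ "exp (K * T)"]) auto
qed

text \<open>Both times vary in one index set, so that tail bounds for the quotients are uniform in
  the pair.\<close>

definition quotient_times :: "(real \<times> real) set" where
  "quotient_times = {(t, \<tau>). t \<in> {0..T} \<and> \<tau> \<in> {0..T} \<and> \<tau> \<noteq> t}"

definition sol_quotient :: "(int^'n \<Rightarrow> real \<Rightarrow> complex) \<Rightarrow> (int^'n \<Rightarrow> complex) \<Rightarrow> real \<times> real \<Rightarrow> int^'n \<Rightarrow> complex" where
  "sol_quotient f g = (\<lambda>(t, \<tau>) \<xi>. (sol_coeff f g \<tau> \<xi> - sol_coeff f g t \<xi>) / of_real (\<tau> - t))"

text \<open>A difference quotient is the mean of the derivative over the interval between the two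
  times, which may come in either order.\<close>

lemma norm_sol_quotient_le:
  assumes f: "continuous_on {0..T} (f \<xi>)" and "(t, \<tau>) \<in> quotient_times"
  shows "cmod (sol_quotient f g (t, \<tau>) \<xi>)
    \<le> integral {min t \<tau>..max t \<tau>} (\<lambda>x. cmod (sol_coeff' f g x \<xi>)) / \<bar>\<tau> - t\<bar>"
proof -
  let ?a = "min t \<tau>" and ?b = "max t \<tau>"
  have ab: "?a \<le> ?b" "{?a..?b} \<subseteq> {0..T}" "\<tau> \<noteq> t" using assms(2) by (auto simp: quotient_times_def)
  have c: "continuous_on {?a..?b} (\<lambda>x. sol_coeff' f g x \<xi>)"
    by (rule continuous_on_subset[OF sol_coeff'_continuous[of f, OF f] ab(2)])
  have "((\<lambda>x. sol_coeff' f g x \<xi>) has_integral sol_coeff f g ?b \<xi> - sol_coeff f g ?a \<xi>) {?a..?b}"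
    using ab by (intro fundamental_theorem_of_calculus has_vector_derivative_within_subset[OF sol_coeff_deriv[of f, OF f] ab(2)]) auto
  then have "sol_coeff f g ?b \<xi> - sol_coeff f g ?a \<xi> = integral {?a..?b} (\<lambda>x. sol_coeff' f g x \<xi>)"
    by (simp add: integral_unique)
  moreover have "cmod (integral {?a..?b} (\<lambda>x. sol_coeff' f g x \<xi>)) \<le> integral {?a..?b} (\<lambda>x. cmod (sol_coeff' f g x \<xi>))"
    by (intro integral_norm_bound_integral integrable_continuous_interval continuous_intros c) auto
  moreover have "cmod (sol_coeff f g ?b \<xi> - sol_coeff f g ?a \<xi>) = cmod (sol_coeff f g \<tau> \<xi> - sol_coeff f g t \<xi>)"
    by (cases "t \<le> \<tau>") (auto simp: min_def max_def norm_minus_commute)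
  ultimately have "cmod (sol_coeff f g \<tau> \<xi> - sol_coeff f g t \<xi>) \<le> integral {?a..?b} (\<lambda>x. cmod (sol_coeff' f g x \<xi>))"
    by simp
  then have "cmod (sol_coeff f g \<tau> \<xi> - sol_coeff f g t \<xi>) / \<bar>\<tau> - t\<bar> \<le> integral {?a..?b} (\<lambda>x. cmod (sol_coeff' f g x \<xi>)) / \<bar>\<tau> - t\<bar>"
    by (rule divide_right_mono) simp
  then show ?thesis unfolding sol_quotient_def by (simp add: norm_divide del: of_real_diff)
qed

lemma sol_quotient_tendsto:
  assumes f: "continuous_on {0..T} (f \<xi>)" and t: "t \<in> {0..T}"
  shows "((\<lambda>\<tau>. sol_quotient f g (t, \<tau>) \<xi>) \<longlongrightarrow> sol_coeff' f g t \<xi>) (at t within {0..T})"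
  using sol_coeff_deriv[of f, OF f t] unfolding has_vector_derivative_iff_quotient sol_quotient_def by simp

subsection \<open>Tail bounds for Sobolev data\<close>

lemma sol_l2_tails:
  assumes f: "\<And>\<xi>. continuous_on {0..T} (f \<xi>)" and ft: "l2_tails r {0..T} (\<lambda>t \<xi>. f \<xi> t)"
    and gt: "l2_tails r {()} (\<lambda>_. g)"
  shows "l2_tails r {0..T} (sol_coeff f g)"
proof -
  obtain M where M: "M \<ge> 0" "\<forall>f g \<xi>. continuous_on {0..T} (f \<xi>) \<longrightarrow> (\<forall>t\<in>{0..T}.
     cmod (sol_coeff f g t \<xi>) \<le> M * (cmod (g \<xi>) + integral {0..T} (\<lambda>\<tau>. cmod (f \<xi> \<tau>))))"
    using norm_sol_coeff_le by blast
  \<comment> \<open>The option type joins the single datum \<open>g\<close>, as \<open>None\<close>,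
    with the times of \<open>f\<close>, since the transfer principle takes one source
    family.\<close>
  define c :: "real option \<Rightarrow> int^'n \<Rightarrow> complex" where "c = case_option g (\<lambda>t \<xi>. f \<xi> t)"
  have "l2_tails r (Some ` {0..T} \<union> (\<lambda>_. None) ` {()}) c"
    by (intro l2_tails_Un l2_tails_image) (use ft gt in \<open>simp_all add: c_def\<close>)
  then have "l2_tails r (Some ` {0..T} \<union> {None}) c" by simp
  then show ?thesis
  \<comment> \<open>The constant collects the square of \<open>M\<close>, the inequality
    \<open>(x + y)^2 \<le> 2 * x^2 + 2 * y^2\<close>, and \<open>T^2\<close> from the time integral
    of \<open>f\<close>.\<close>
  proof (rule l2_tails_dominated[where K = "M\<^sup>2 * (2 + 2 * T\<^sup>2)"])
    show "0 \<le> M\<^sup>2 * (2 + 2 * T\<^sup>2)" by simp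
    fix S :: "(int^'n) set" and \<epsilon> t
    assume S: "finite S" and t: "t \<in> {0..T}"
      and le: "\<And>i. i \<in> Some ` {0..T} \<union> {None} \<Longrightarrow> (\<Sum>\<xi>\<in>S. (cmod (c i \<xi>))\<^sup>2 * bracket \<xi> powr (2 * r)) \<le> \<epsilon>"
    have lef: "(\<Sum>\<xi>\<in>S. (cmod (f \<xi> t))\<^sup>2 * bracket \<xi> powr (2 * r)) \<le> \<epsilon>" if "t \<in> {0..T}" for t
      using le[of "Some t"] that by (simp add: c_def)
    have leg: "(\<Sum>\<xi>\<in>S. (cmod (g \<xi>))\<^sup>2 * bracket \<xi> powr (2 * r)) \<le> \<epsilon>"
      using le[of None] by (simp add: c_def)
    let ?I = "\<lambda>\<xi>. integral {0..T} (\<lambda>\<tau>. cmod (f \<xi> \<tau>))"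
    have "(\<Sum>\<xi>\<in>S. (cmod (sol_coeff f g t \<xi>))\<^sup>2 * bracket \<xi> powr (2 * r))
        \<le> (\<Sum>\<xi>\<in>S. M\<^sup>2 * (2 * ((cmod (g \<xi>))\<^sup>2 * bracket \<xi> powr (2 * r)) + 2 * ((?I \<xi>)\<^sup>2 * bracket \<xi> powr (2 * r))))"
    proof (rule sum_mono)
      fix \<xi>
      have "cmod (sol_coeff f g t \<xi>) \<le> M * (cmod (g \<xi>) + ?I \<xi>)" using M(2) f t by blast
      then have "(cmod (sol_coeff f g t \<xi>))\<^sup>2 \<le> (M * (cmod (g \<xi>) + ?I \<xi>))\<^sup>2" by (rule power_mono) simp
      also have "\<dots> \<le> M\<^sup>2 * (2 * (cmod (g \<xi>))\<^sup>2 + 2 * (?I \<xi>)\<^sup>2)"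
        unfolding power_mult_distrib using sum_squares_bound[of "cmod (g \<xi>)" "?I \<xi>"]
        by (intro mult_left_mono) (auto simp: power2_sum)
      finally have "(cmod (sol_coeff f g t \<xi>))\<^sup>2 * bracket \<xi> powr (2 * r)
          \<le> M\<^sup>2 * (2 * (cmod (g \<xi>))\<^sup>2 + 2 * (?I \<xi>)\<^sup>2) * bracket \<xi> powr (2 * r)"
        by (rule mult_right_mono) simp
      then show "(cmod (sol_coeff f g t \<xi>))\<^sup>2 * bracket \<xi> powr (2 * r)
          \<le> M\<^sup>2 * (2 * ((cmod (g \<xi>))\<^sup>2 * bracket \<xi> powr (2 * r)) + 2 * ((?I \<xi>)\<^sup>2 * bracket \<xi> powr (2 * r)))"
        by (simp add: distrib_right mult.assoc)
    qed
    also have "\<dots> = M\<^sup>2 * (2 * (\<Sum>\<xi>\<in>S. (cmod (g \<xi>))\<^sup>2 * bracket \<xi> powr (2 * r)) + 2 * (\<Sum>\<xi>\<in>S. (?I \<xi>)\<^sup>2 * bracket \<xi> powr (2 * r)))"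
      by (simp only: sum.distrib sum_distrib_left[symmetric])
    also have "\<dots> \<le> M\<^sup>2 * (2 * \<epsilon> + 2 * ((T - 0)\<^sup>2 * \<epsilon>))"
      using T S by (intro mult_left_mono add_mono leg integral_cmod_square_sum_le f lef) auto
    also have "\<dots> = M\<^sup>2 * (2 + 2 * T\<^sup>2) * \<epsilon>" by (simp add: algebra_simps)
    finally show "(\<Sum>\<xi>\<in>S. (cmod (sol_coeff f g t \<xi>))\<^sup>2 * bracket \<xi> powr (2 * r)) \<le> M\<^sup>2 * (2 + 2 * T\<^sup>2) * \<epsilon>" .
  qed
qed

lemma sol'_l2_tails:
  assumes ft: "l2_tails r {0..T} (\<lambda>t \<xi>. f \<xi> t)" and yt: "l2_tails r {0..T} (sol_coeff f g)"
  shows "l2_tails (r - 2) {0..T} (sol_coeff' f g)"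
proof -
  obtain B where B: "B \<ge> 0" "\<forall>\<xi>. \<forall>t\<in>{0..T}. cmod (symb t \<xi>) \<le> B * (bracket \<xi>)\<^sup>2"
    using norm_sym_bounded by blast
  define c :: "real + real \<Rightarrow> int^'n \<Rightarrow> complex" where "c = case_sum (\<lambda>t \<xi>. f \<xi> t) (sol_coeff f g)"
  have "l2_tails r (Inl ` {0..T} \<union> Inr ` {0..T}) c"
    by (intro l2_tails_Un l2_tails_image) (use ft yt in \<open>simp_all add: c_def\<close>)
  then show ?thesis
  proof (rule l2_tails_dominated[where K = "2 + 2 * B\<^sup>2"])
    fix S :: "(int^'n) set" and \<epsilon> t
    assume S: "finite S" and t: "t \<in> {0..T}"
      and le: "\<And>i. i \<in> Inl ` {0..T} \<union> Inr ` {0..T} \<Longrightarrow> (\<Sum>\<xi>\<in>S. (cmod (c i \<xi>))\<^sup>2 * bracket \<xi> powr (2 * r)) \<le> \<epsilon>"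
    have lef: "(\<Sum>\<xi>\<in>S. (cmod (f \<xi> t))\<^sup>2 * bracket \<xi> powr (2 * r)) \<le> \<epsilon>"
      using le[of "Inl t"] t by (simp add: c_def)
    have ley: "(\<Sum>\<xi>\<in>S. (cmod (sol_coeff f g t \<xi>))\<^sup>2 * bracket \<xi> powr (2 * r)) \<le> \<epsilon>"
      using le[of "Inr t"] t by (simp add: c_def)
    have "(\<Sum>\<xi>\<in>S. (cmod (sol_coeff' f g t \<xi>))\<^sup>2 * bracket \<xi> powr (2 * (r - 2)))
        \<le> (\<Sum>\<xi>\<in>S. 2 * ((cmod (f \<xi> t))\<^sup>2 * bracket \<xi> powr (2 * r)) + 2 * B\<^sup>2 * ((cmod (sol_coeff f g t \<xi>))\<^sup>2 * bracket \<xi> powr (2 * r)))"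
    proof (rule sum_mono)
      fix \<xi> :: "int^'n"
      let ?w = "bracket \<xi> powr (2 * (r - 2))"
      \<comment> \<open>Lowering the order by 2 divides the weight by
        \<open>bracket \<xi> ^ 4\<close>, which is the square of the growth of the symbol.\<close>
      have w4: "bracket \<xi> powr (2 * r) = ?w * (bracket \<xi>) ^ 4"
        by (simp add: powr_add[symmetric] powr_realpow[symmetric])
      have w: "?w \<le> bracket \<xi> powr (2 * r)" by (intro powr_mono bracket_ge_1) auto
      have "(cmod (sol_coeff' f g t \<xi>))\<^sup>2 \<le> 2 * (cmod (f \<xi> t))\<^sup>2 + 2 * (cmod (symb t \<xi> * sol_coeff f g t \<xi>))\<^sup>2"
        unfolding sol_coeff'_def norm_mult[of \<i>] norm_ii mult_1_left by (rule norm_diff_square_le)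
      also have "(cmod (symb t \<xi> * sol_coeff f g t \<xi>))\<^sup>2 \<le> (B * (bracket \<xi>)\<^sup>2 * cmod (sol_coeff f g t \<xi>))\<^sup>2"
        unfolding norm_mult using B(2) t by (intro power_mono mult_right_mono) auto
      finally have "(cmod (sol_coeff' f g t \<xi>))\<^sup>2 \<le> 2 * (cmod (f \<xi> t))\<^sup>2 + 2 * (B * (bracket \<xi>)\<^sup>2 * cmod (sol_coeff f g t \<xi>))\<^sup>2"
        by simp
      then have "(cmod (sol_coeff' f g t \<xi>))\<^sup>2 * ?w
          \<le> (2 * (cmod (f \<xi> t))\<^sup>2 + 2 * (B * (bracket \<xi>)\<^sup>2 * cmod (sol_coeff f g t \<xi>))\<^sup>2) * ?w"
        by (rule mult_right_mono) simp
      also have "\<dots> = 2 * ((cmod (f \<xi> t))\<^sup>2 * ?w)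
          + 2 * B\<^sup>2 * ((cmod (sol_coeff f g t \<xi>))\<^sup>2 * (?w * (bracket \<xi>) ^ 4))"
        unfolding power_mult_distrib distrib_right by (simp add: mult_ac)
      also have "\<dots> \<le> 2 * ((cmod (f \<xi> t))\<^sup>2 * bracket \<xi> powr (2 * r))
          + 2 * B\<^sup>2 * ((cmod (sol_coeff f g t \<xi>))\<^sup>2 * bracket \<xi> powr (2 * r))"
        unfolding w4[symmetric] using w by (intro add_mono mult_left_mono order_refl) auto
      finally show "(cmod (sol_coeff' f g t \<xi>))\<^sup>2 * ?w \<le> 2 * ((cmod (f \<xi> t))\<^sup>2 * bracket \<xi> powr (2 * r))
          + 2 * B\<^sup>2 * ((cmod (sol_coeff f g t \<xi>))\<^sup>2 * bracket \<xi> powr (2 * r))" .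
    qed
    also have "\<dots> = 2 * (\<Sum>\<xi>\<in>S. (cmod (f \<xi> t))\<^sup>2 * bracket \<xi> powr (2 * r)) + 2 * B\<^sup>2 * (\<Sum>\<xi>\<in>S. (cmod (sol_coeff f g t \<xi>))\<^sup>2 * bracket \<xi> powr (2 * r))"
      by (simp only: sum.distrib sum_distrib_left)
    also have "\<dots> \<le> 2 * \<epsilon> + 2 * B\<^sup>2 * \<epsilon>"
      by (intro add_mono mult_left_mono lef ley) auto
    also have "\<dots> = (2 + 2 * B\<^sup>2) * \<epsilon>" by (simp add: distrib_right)
    finally show "(\<Sum>\<xi>\<in>S. (cmod (sol_coeff' f g t \<xi>))\<^sup>2 * bracket \<xi> powr (2 * (r - 2))) \<le> (2 + 2 * B\<^sup>2) * \<epsilon>" .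
  qed simp
qed

text \<open>Averaging costs nothing: the squared length from the time integral cancels against the
  squared denominator, hence \<open>K = 1\<close>.\<close>

lemma sol_quotient_l2_tails:
  assumes f: "\<And>\<xi>. continuous_on {0..T} (f \<xi>)" and y': "l2_tails r {0..T} (sol_coeff' f g)"
  shows "l2_tails r quotient_times (sol_quotient f g)"
  using y'
proof (rule l2_tails_dominated[where K = 1])
  fix S :: "(int^'n) set" and \<epsilon> p
  assume S: "finite S" and p: "p \<in> quotient_times"
    and le: "\<And>i. i \<in> {0..T} \<Longrightarrow> (\<Sum>\<xi>\<in>S. (cmod (sol_coeff' f g i \<xi>))\<^sup>2 * bracket \<xi> powr (2 * r)) \<le> \<epsilon>"
  obtain t \<tau> where pt: "p = (t, \<tau>)" by (cases p)
  let ?a = "min t \<tau>" and ?b = "max t \<tau>"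
  have ab: "?a \<le> ?b" "{?a..?b} \<subseteq> {0..T}" "\<tau> \<noteq> t" "?b - ?a = \<bar>\<tau> - t\<bar>"
    using p pt by (auto simp: quotient_times_def)
  let ?I = "\<lambda>\<xi>. integral {?a..?b} (\<lambda>x. cmod (sol_coeff' f g x \<xi>))"
  have "(\<Sum>\<xi>\<in>S. (cmod (sol_quotient f g p \<xi>))\<^sup>2 * bracket \<xi> powr (2 * r))
      \<le> (\<Sum>\<xi>\<in>S. (?I \<xi> / \<bar>\<tau> - t\<bar>)\<^sup>2 * bracket \<xi> powr (2 * r))"
    using norm_sol_quotient_le[of f, OF f, of t \<tau> g] p unfolding pt
    by (intro sum_mono mult_right_mono power_mono) auto
  also have "\<dots> = (\<Sum>\<xi>\<in>S. (?I \<xi>)\<^sup>2 * bracket \<xi> powr (2 * r)) / \<bar>\<tau> - t\<bar>\<^sup>2"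
    by (simp add: power_divide sum_divide_distrib)
  also have "\<dots> \<le> ((?b - ?a)\<^sup>2 * \<epsilon>) / \<bar>\<tau> - t\<bar>\<^sup>2"
    using ab S by (intro divide_right_mono integral_cmod_square_sum_le le
        continuous_on_subset[OF sol_coeff'_continuous[of f, OF f] ab(2)]) auto
  also have "\<dots> = \<epsilon>" using ab(3) unfolding ab(4) by simp
  finally show "(\<Sum>\<xi>\<in>S. (cmod (sol_quotient f g p \<xi>))\<^sup>2 * bracket \<xi> powr (2 * r)) \<le> 1 * \<epsilon>" by simp
qed simp

subsection \<open>Tail bounds for Gevrey data\<close>

lemma sol_gevrey_tails:
  assumes f: "\<And>\<xi>. continuous_on {0..T} (f \<xi>)" and ft: "gevrey_tails s {0..T} (\<lambda>t \<xi>. f \<xi> t)"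
    and gt: "gevrey_tails s {()} (\<lambda>_. g)"
  shows "gevrey_tails s {0..T} (sol_coeff f g)"
proof -
  obtain M where M: "M \<ge> 0" "\<forall>f g \<xi>. continuous_on {0..T} (f \<xi>) \<longrightarrow> (\<forall>t\<in>{0..T}.
     cmod (sol_coeff f g t \<xi>) \<le> M * (cmod (g \<xi>) + integral {0..T} (\<lambda>\<tau>. cmod (f \<xi> \<tau>))))"
    using norm_sol_coeff_le by blast
  obtain C1 d1 where C1: "C1 > 0" "d1 > 0" "\<forall>t\<in>{0..T}. \<forall>\<xi>. cmod (f \<xi> t) \<le> C1 * gevrey_weight s d1 \<xi>"
    using ft unfolding gevrey_tails_def by blast
  obtain C2 d2 where C2: "C2 > 0" "d2 > 0" "\<forall>\<xi>. cmod (g \<xi>) \<le> C2 * gevrey_weight s d2 \<xi>"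
    using gt unfolding gevrey_tails_def by blast
  define d where "d = min d1 d2"
  \<comment> \<open>\<open>M + 1\<close> instead of \<open>M\<close> keeps the constant strictly
    positive, as \<open>gevrey_tails\<close> demands.\<close>
  have "cmod (sol_coeff f g t \<xi>) \<le> ((M + 1) * (C2 + T * C1)) * gevrey_weight s d \<xi>" if t: "t \<in> {0..T}" for t \<xi>
  proof -
    have m: "gevrey_weight s d1 \<xi> \<le> gevrey_weight s d \<xi>" "gevrey_weight s d2 \<xi> \<le> gevrey_weight s d \<xi>"
      by (auto intro!: gevrey_weight_mono simp: d_def)
    have g: "cmod (g \<xi>) \<le> C2 * gevrey_weight s d \<xi>"
      by (rule order_trans[OF C2(3)[rule_format] mult_left_mono[OF m(2)]]) (use C2 in simp)
    have f': "cmod (f \<xi> t) \<le> C1 * gevrey_weight s d \<xi>" if "t \<in> {0..T}" for t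
      by (rule order_trans[OF C1(3)[rule_format, OF that] mult_left_mono[OF m(1)]]) (use C1 in simp)
    have "integral {0..T} (\<lambda>\<tau>. cmod (f \<xi> \<tau>)) \<le> integral {0..T} (\<lambda>\<tau>. C1 * gevrey_weight s d \<xi>)"
      by (intro integral_le integrable_continuous_interval continuous_intros f f')
    also have "\<dots> = T * C1 * gevrey_weight s d \<xi>" using T by simp
    finally have I: "integral {0..T} (\<lambda>\<tau>. cmod (f \<xi> \<tau>)) \<le> T * C1 * gevrey_weight s d \<xi>" .
    have "cmod (sol_coeff f g t \<xi>) \<le> M * (cmod (g \<xi>) + integral {0..T} (\<lambda>\<tau>. cmod (f \<xi> \<tau>)))"
      using M(2) f t by blast
    also have "\<dots> \<le> (M + 1) * (C2 * gevrey_weight s d \<xi> + T * C1 * gevrey_weight s d \<xi>)"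
      using M(1) g I
      by (intro mult_mono add_mono add_nonneg_nonneg integral_nonneg integrable_continuous_interval continuous_intros f) auto
    finally show ?thesis by (simp add: algebra_simps)
  qed
  moreover have "(M + 1) * (C2 + T * C1) > 0" "d > 0"
    using M C1 C2 T by (auto intro!: mult_pos_pos add_pos_pos add_nonneg_pos simp: d_def simp del: mult_pos_pos zero_less_mult_iff)
  ultimately show ?thesis unfolding gevrey_tails_def by blast
qed

lemma sol'_gevrey_tails:
  assumes s: "s > 0" and ft: "gevrey_tails s {0..T} (\<lambda>t \<xi>. f \<xi> t)" and yt: "gevrey_tails s {0..T} (sol_coeff f g)"
  shows "gevrey_tails s {0..T} (sol_coeff' f g)"
proof -
  obtain B where B: "B \<ge> 0" "\<forall>\<xi>. \<forall>t\<in>{0..T}. cmod (symb t \<xi>) \<le> B * (bracket \<xi>)\<^sup>2"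
    using norm_sym_bounded by blast
  obtain C1 d1 where C1: "C1 > 0" "d1 > 0" "\<forall>t\<in>{0..T}. \<forall>\<xi>. cmod (f \<xi> t) \<le> C1 * gevrey_weight s d1 \<xi>"
    using ft unfolding gevrey_tails_def by blast
  obtain C2 d2 where C2: "C2 > 0" "d2 > 0" "\<forall>t\<in>{0..T}. \<forall>\<xi>. cmod (sol_coeff f g t \<xi>) \<le> C2 * gevrey_weight s d2 \<xi>"
    using yt unfolding gevrey_tails_def by blast
  \<comment> \<open>Halving the rate leaves one factor \<open>gevrey_weight s d \<xi>\<close> to
    absorb the quadratic growth of the symbol.\<close>
  define d where "d = min d1 d2 / 2"
  have d: "d > 0" "d \<le> d1" "d + d \<le> d2" using C1 C2 by (auto simp: d_def)
  obtain M where M: "M \<ge> 0" "\<forall>\<xi>::int^'n. bracket \<xi> ^ 2 * gevrey_weight s d \<xi> \<le> M"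
    using bracket_gevrey_weight_bounded[OF s d(1), of 2] by blast
  have "cmod (sol_coeff' f g t \<xi>) \<le> (C1 + B * M * C2) * gevrey_weight s d \<xi>" if t: "t \<in> {0..T}" for t \<xi>
  proof -
    have "cmod (sol_coeff' f g t \<xi>) \<le> cmod (f \<xi> t) + cmod (symb t \<xi>) * cmod (sol_coeff f g t \<xi>)"
      unfolding sol_coeff'_def norm_mult[of \<i>] norm_ii mult_1_left norm_mult[symmetric] by (rule norm_triangle_ineq4)
    also have "\<dots> \<le> C1 * gevrey_weight s d \<xi> + (B * (bracket \<xi>)\<^sup>2) * (C2 * gevrey_weight s (d + d) \<xi>)"
    proof (intro add_mono mult_mono)
      have "C1 * gevrey_weight s d1 \<xi> \<le> C1 * gevrey_weight s d \<xi>"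
        using C1 d by (intro mult_left_mono gevrey_weight_mono) auto
      then show "cmod (f \<xi> t) \<le> C1 * gevrey_weight s d \<xi>" using C1(3) t by (meson order_trans)
      have "C2 * gevrey_weight s d2 \<xi> \<le> C2 * gevrey_weight s (d + d) \<xi>"
        using C2 d by (intro mult_left_mono gevrey_weight_mono) auto
      then show "cmod (sol_coeff f g t \<xi>) \<le> C2 * gevrey_weight s (d + d) \<xi>" using C2(3) t by (meson order_trans)
      show "cmod (symb t \<xi>) \<le> B * (bracket \<xi>)\<^sup>2" using B(2) t by blast
    qed (use B in auto)
    also have "\<dots> = C1 * gevrey_weight s d \<xi> + B * C2 * (bracket \<xi> ^ 2 * gevrey_weight s d \<xi>) * gevrey_weight s d \<xi>"
      by (simp only: gevrey_weight_add mult_ac)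
    also have "\<dots> \<le> C1 * gevrey_weight s d \<xi> + B * C2 * M * gevrey_weight s d \<xi>"
      using M(2) B C2 by (intro add_left_mono mult_right_mono mult_left_mono) (auto simp: less_imp_le)
    finally show ?thesis by (simp add: algebra_simps)
  qed
  moreover have "C1 + B * M * C2 > 0" using C1 B M C2 by (intro add_pos_nonneg mult_nonneg_nonneg) auto
  ultimately show ?thesis unfolding gevrey_tails_def using d(1) by blast
qed

text \<open>A mean over time inherits a pointwise bound with the same \<open>C\<close> and the same
  rate.\<close>

lemma sol_quotient_gevrey_tails:
  assumes f: "\<And>\<xi>. continuous_on {0..T} (f \<xi>)" and y': "gevrey_tails s {0..T} (sol_coeff' f g)"
  shows "gevrey_tails s quotient_times (sol_quotient f g)"
proof -
  obtain C d where C: "C > 0" "d > 0" "\<forall>t\<in>{0..T}. \<forall>\<xi>. cmod (sol_coeff' f g t \<xi>) \<le> C * gevrey_weight s d \<xi>"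
    using y' unfolding gevrey_tails_def by blast
  have "cmod (sol_quotient f g p \<xi>) \<le> C * gevrey_weight s d \<xi>" if p: "p \<in> quotient_times" for p \<xi>
  proof -
    obtain t \<tau> where pt: "p = (t, \<tau>)" by (cases p)
    let ?a = "min t \<tau>" and ?b = "max t \<tau>"
    have ab: "?a \<le> ?b" "{?a..?b} \<subseteq> {0..T}" "\<tau> \<noteq> t" "?b - ?a = \<bar>\<tau> - t\<bar>"
      using p pt by (auto simp: quotient_times_def)
    have "integral {?a..?b} (\<lambda>x. cmod (sol_coeff' f g x \<xi>)) \<le> integral {?a..?b} (\<lambda>x. C * gevrey_weight s d \<xi>)"
    proof (intro integral_le integrable_continuous_interval continuous_intros
          continuous_on_subset[OF sol_coeff'_continuous[of f, OF f] ab(2)])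
      show "cmod (sol_coeff' f g x \<xi>) \<le> C * gevrey_weight s d \<xi>" if "x \<in> {?a..?b}" for x
        using C(3) subsetD[OF ab(2) that] by blast
    qed
    also have "\<dots> = \<bar>\<tau> - t\<bar> * (C * gevrey_weight s d \<xi>)" using ab(1,4) by simp
    finally have "integral {?a..?b} (\<lambda>x. cmod (sol_coeff' f g x \<xi>)) / \<bar>\<tau> - t\<bar> \<le> C * gevrey_weight s d \<xi>"
      using ab(3) by (simp add: pos_divide_le_eq mult.commute)
    then show ?thesis
      using norm_sol_quotient_le[of f, OF f, of t \<tau> g \<xi>] p unfolding pt by linarith
  qed
  then show ?thesis unfolding gevrey_tails_def using C(1,2) by blast
qed

end

section \<open>Existence and uniqueness\<close>

lemma eventually_at_in: "\<forall>\<^sub>F \<tau> in at t within S. \<tau> \<in> S - {t}"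
  by (simp add: eventually_at_filter)

text \<open>The distributions \<open>v i\<close> are known through their coefficients only;
  uniqueness identifies them with \<open>fourier_distr (c i)\<close>, which gives their membership
  in \<open>H^r\<close>.\<close>

lemma limitin_sobolev_tails:
  assumes tails: "l2_tails r A c" and A: "\<forall>\<^sub>F i in F. i \<in> A"
    and v: "\<And>i \<xi>. i \<in> A \<Longrightarrow> fourier_coeff (v i) \<xi> = c i \<xi>" and l: "l \<in> sobolev r"
    and lim: "\<And>\<xi>. ((\<lambda>i. c i \<xi>) \<longlongrightarrow> fourier_coeff l \<xi>) F"
  shows "limitin (sobolev_topology r) v l F"
proof (rule limitin_sobolevI[OF l A])
  show "v i \<in> sobolev r" if i: "i \<in> A" for i
  proof -
    have "v i = fourier_distr (c i)"
      by (rule distr_eqI) (simp add: v[OF i] fourier_coeff_fourier_distr[OF l2_tails_imp_sobolev(1)[OF tails i]])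
    then show ?thesis using l2_tails_imp_sobolev(2)[OF tails i] by simp
  qed
  show "l2_tails r A (\<lambda>i. fourier_coeff (v i))"
    using tails unfolding l2_tails_def by (simp add: v)
  show "((\<lambda>i. fourier_coeff (v i) \<xi>) \<longlongrightarrow> fourier_coeff l \<xi>) F" for \<xi>
  proof (rule Lim_transform_eventually[OF lim])
    show "\<forall>\<^sub>F i in F. c i \<xi> = fourier_coeff (v i) \<xi>" using A by eventually_elim (simp add: v)
  qed
qed

lemma limitin_gevrey_tails:
  assumes s: "s > 0" and tails: "gevrey_tails s A c" and A: "\<forall>\<^sub>F i in F. i \<in> A"
    and v: "\<And>i \<xi>. i \<in> A \<Longrightarrow> fourier_coeff (v i) \<xi> = c i \<xi>" and l: "l \<in> gevrey s"
    and lim: "\<And>\<xi>. ((\<lambda>i. c i \<xi>) \<longlongrightarrow> fourier_coeff l \<xi>) F"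
  shows "limitin (gevrey_topology s) v l F"
proof (rule limitin_gevreyI[OF s l A])
  show "gevrey_tails s A (\<lambda>i. fourier_coeff (v i))"
    using tails unfolding gevrey_tails_def by (simp add: v)
  show "((\<lambda>i. fourier_coeff (v i) \<xi>) \<longlongrightarrow> fourier_coeff l \<xi>) F" for \<xi>
  proof (rule Lim_transform_eventually[OF lim])
    show "\<forall>\<^sub>F i in F. c i \<xi> = fourier_coeff (v i) \<xi>" using A by eventually_elim (simp add: v)
  qed
qed

lemma l2_tails_comp: "l2_tails r B c \<Longrightarrow> (\<And>i. i \<in> A \<Longrightarrow> h i \<in> B) \<Longrightarrow> l2_tails r A (\<lambda>i. c (h i))"
proof -
  assume c: "l2_tails r B c" and h: "\<And>i. i \<in> A \<Longrightarrow> h i \<in> B"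
  show ?thesis
    by (rule l2_tails_dominated[OF c, where K = 1]) (use h in auto)
qed

lemma gevrey_tails_comp: "gevrey_tails s B c \<Longrightarrow> (\<And>i. i \<in> A \<Longrightarrow> h i \<in> B) \<Longrightarrow> gevrey_tails s A (\<lambda>i. c (h i))"
  unfolding gevrey_tails_def by blast

lemma l2_tails_mono:
  assumes "l2_tails r A c" "r' \<le> r"
  shows "l2_tails r' A c"
proof (rule l2_tails_dominated[OF assms(1), where K = 1])
  fix S :: "(int^'b) set" and \<epsilon> j
  assume "finite S" "j \<in> A"
    and le: "\<And>i. i \<in> A \<Longrightarrow> (\<Sum>\<xi>\<in>S. (cmod (c i \<xi>))\<^sup>2 * bracket \<xi> powr (2 * r)) \<le> \<epsilon>"
  have "(\<Sum>\<xi>\<in>S. (cmod (c j \<xi>))\<^sup>2 * bracket \<xi> powr (2 * r')) \<le> (\<Sum>\<xi>\<in>S. (cmod (c j \<xi>))\<^sup>2 * bracket \<xi> powr (2 * r))"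
    using assms(2) by (intro sum_mono mult_left_mono powr_mono bracket_ge_1) auto
  then show "(\<Sum>\<xi>\<in>S. (cmod (c j \<xi>))\<^sup>2 * bracket \<xi> powr (2 * r')) \<le> 1 * \<epsilon>"
    using le[OF \<open>j \<in> A\<close>] by linarith
qed simp

lemma sobolev_imp_l2_tails:
  assumes "g \<in> sobolev r"
  shows "l2_tails r {()} (\<lambda>_. fourier_coeff g)"
  unfolding l2_tails_def
proof (intro allI impI)
  fix \<epsilon> :: real
  assume "\<epsilon> > 0"
  then obtain F where F: "finite F" "\<And>S. finite S \<Longrightarrow> S \<inter> F = {} \<Longrightarrow> sum (sobolev_term r g) S \<le> \<epsilon>"
    using sobolev_tails[OF assms] by metis
  show "\<exists>F. finite F \<and> (\<forall>i\<in>{()}. \<forall>S. finite S \<and> S \<inter> F = {} \<longrightarrow>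
     (\<Sum>\<xi>\<in>S. (cmod (fourier_coeff g \<xi>))\<^sup>2 * bracket \<xi> powr (2 * r)) \<le> \<epsilon>)"
    using F by (intro exI[of _ F]) (simp add: sobolev_term_bracket)
qed

text \<open>The exponential weight absorbs any Sobolev weight and still sums, so Gevrey data become
  Sobolev data and the construction of the solution there is available to them.\<close>

lemma gevrey_tails_imp_l2_tails:
  fixes c :: "'i \<Rightarrow> int^'n::finite \<Rightarrow> complex"
  assumes s: "s > 0" and c: "gevrey_tails s A c"
  shows "l2_tails r A c"
  unfolding l2_tails_def
proof (intro allI impI)
  fix \<epsilon> :: real
  assume \<epsilon>: "\<epsilon> > 0"
  obtain C d where C: "C > 0" "d > 0" "\<forall>i\<in>A. \<forall>\<xi>. cmod (c i \<xi>) \<le> C * gevrey_weight s d \<xi>"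
    using c unfolding gevrey_tails_def by blast
  define k where "k = nat \<lceil>\<bar>2 * r\<bar>\<rceil>"
  obtain M where M: "M \<ge> 0" "\<forall>\<xi>::int^'n. bracket \<xi> ^ k * gevrey_weight s d \<xi> \<le> M"
    using bracket_gevrey_weight_bounded[OF s C(2), of k] by blast
  define w where "w \<xi> = C\<^sup>2 * M * gevrey_weight s d \<xi>" for \<xi> :: "int^'n"
  have sm: "w summable_on UNIV"
    unfolding w_def by (intro summable_on_cmult_right gevrey_weight_summable s C)
  have w0: "w \<xi> \<ge> 0" for \<xi> using M by (simp add: w_def less_imp_le)
  have le: "(cmod (c i \<xi>))\<^sup>2 * bracket \<xi> powr (2 * r) \<le> w \<xi>" if "i \<in> A" for i \<xi>
  proof -
    have "(cmod (c i \<xi>))\<^sup>2 * bracket \<xi> powr (2 * r) \<le> (C * gevrey_weight s d \<xi>)\<^sup>2 * bracket \<xi> ^ k"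
      unfolding k_def using C(3) that by (intro mult_mono power_mono powr_le_power_nat bracket_ge_1) auto
    also have "\<dots> = C\<^sup>2 * (bracket \<xi> ^ k * gevrey_weight s d \<xi>) * gevrey_weight s d \<xi>"
      by (simp add: power2_eq_square mult_ac)
    also have "\<dots> \<le> C\<^sup>2 * M * gevrey_weight s d \<xi>"
      using M(2) by (intro mult_right_mono mult_left_mono) (auto simp: less_imp_le)
    finally show ?thesis by (simp add: w_def)
  qed
  have "(sum w \<longlongrightarrow> infsum w UNIV) (finite_subsets_at_top UNIV)"
    using has_sum_infsum[OF sm] by (simp add: has_sum_def)
  then have "\<forall>\<^sub>F F in finite_subsets_at_top UNIV. dist (sum w F) (infsum w UNIV) < \<epsilon>"
    using \<epsilon> by (rule tendstoD)
  then obtain F where F: "finite F" "dist (sum w F) (infsum w UNIV) < \<epsilon>"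
    unfolding eventually_finite_subsets_at_top by blast
  have "(\<Sum>\<xi>\<in>S. (cmod (c i \<xi>))\<^sup>2 * bracket \<xi> powr (2 * r)) \<le> \<epsilon>"
    if "i \<in> A" "finite S" "S \<inter> F = {}" for i S
  proof -
    have "(\<Sum>\<xi>\<in>S. (cmod (c i \<xi>))\<^sup>2 * bracket \<xi> powr (2 * r)) \<le> sum w S"
      by (intro sum_mono le that)
    moreover have "sum w S + sum w F = sum w (S \<union> F)"
      using that F(1) by (simp add: sum.union_disjoint)
    moreover have "sum w (S \<union> F) \<le> infsum w UNIV"
      using that F(1) by (intro finite_sum_le_infsum sm w0) auto
    ultimately show ?thesis using F(2) unfolding dist_real_def by linarith
  qed
  then show "\<exists>F. finite F \<and> (\<forall>i\<in>A. \<forall>S. finite S \<and> S \<inter> F = {} \<longrightarrow>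
     (\<Sum>\<xi>\<in>S. (cmod (c i \<xi>))\<^sup>2 * bracket \<xi> powr (2 * r)) \<le> \<epsilon>)"
    using F(1) by blast
qed

lemma pairing_scaleR: "pairing (a *\<^sub>R u) \<psi> = of_real a * pairing u \<psi>"
  by (simp add: scaleR_torus_distr.rep_eq)

context torus_cauchy
begin

text \<open>One construction serves all three kinds of spaces, as it involves nothing but the
  coefficients of the data; \<open>restrict\<close> makes the map extensional.\<close>

definition solution :: "(real \<Rightarrow> 'n torus_distr) \<Rightarrow> 'n torus_distr \<Rightarrow> real \<Rightarrow> 'n torus_distr" where
  "solution f g = restrict (\<lambda>t. fourier_distr (sol_coeff (\<lambda>\<xi> t. fourier_coeff (f t) \<xi>) (fourier_coeff g) t)) {0..T}"

definition solution' :: "(real \<Rightarrow> 'n torus_distr) \<Rightarrow> 'n torus_distr \<Rightarrow> real \<Rightarrow> 'n torus_distr" where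
  "solution' f g = restrict (\<lambda>t. fourier_distr (sol_coeff' (\<lambda>\<xi> t. fourier_coeff (f t) \<xi>) (fourier_coeff g) t)) {0..T}"

text \<open>Both solutions are tested against the characters. Their right-hand sides coincide, so
  \<open>f\<close> cancels and the difference of the coefficients satisfies the homogeneous weak
  equation.\<close>

lemma solves_CP_unique:
  assumes u: "solves_CP T a2 a1 a0 f g u" and v: "solves_CP T a2 a1 a0 f g v" and t: "t \<in> {0..T}"
  shows "u t = v t"
proof (rule distr_eqI)
  fix \<xi> :: "int^'n"
  have cont: "continuous_on {0..T} (\<lambda>t. fourier_coeff (w t) \<xi>)" if w: "solves_CP T a2 a1 a0 f g w" for w
  proof -
    obtain \<rho> where "w \<in> C0_maps T (sobolev_topology \<rho>)" using w unfolding solves_CP_def by blast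
    then show ?thesis unfolding C0_maps_iff continuous_on_def by (blast intro: limitin_sobolev_coeff)
  qed
  have eq: "\<i> * integral {0..T} (\<lambda>t. time_deriv \<phi> t * fourier_coeff (w t) \<xi>)
      + integral {0..T} (\<lambda>t. \<phi> t * (symb t \<xi> * fourier_coeff (w t) \<xi>))
      = distr_integral T (\<lambda>t. \<phi> t *\<^sub>C f t) (test_exp \<xi>)"
    if w: "solves_CP T a2 a1 a0 f g w" and \<phi>: "\<phi> \<in> time_test T" for w \<phi>
  proof -
    have "weak_D_t T w \<phi> (test_exp \<xi>) = \<i> * integral {0..T} (\<lambda>t. time_deriv \<phi> t * fourier_coeff (w t) \<xi>)"
      unfolding weak_D_t_def distr_integral_def integral_mult_right[symmetric]
      by (simp add: scaleC.rep_eq fourier_coeff_def mult.assoc)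
    moreover have "distr_integral T (\<lambda>t. \<phi> t *\<^sub>C spatial_op (a2 t) (\<lambda>j. a1 j t) (a0 t) (w t)) (test_exp \<xi>)
        = integral {0..T} (\<lambda>t. \<phi> t * (symb t \<xi> * fourier_coeff (w t) \<xi>))"
      unfolding distr_integral_def by (simp add: scaleC.rep_eq fourier_coeff_def[symmetric] fourier_coeff_spatial_op)
    moreover have "weak_D_t T w \<phi> (test_exp \<xi>)
        + distr_integral T (\<lambda>t. \<phi> t *\<^sub>C spatial_op (a2 t) (\<lambda>j. a1 j t) (a0 t) (w t)) (test_exp \<xi>)
        = distr_integral T (\<lambda>t. \<phi> t *\<^sub>C f t) (test_exp \<xi>)"
      using w[unfolded solves_CP_def] \<phi> by blast
    ultimately show ?thesis by simp
  qed
  define d where "d t = fourier_coeff (u t) \<xi> - fourier_coeff (v t) \<xi>" for t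
  have "d t = 0"
  proof (rule weak_ode_unique[OF T _ sym_continuous _ _ t, of d \<xi>])
    show "continuous_on {0..T} d" unfolding d_def by (intro continuous_intros cont u v)
    show "d 0 = 0" using u v by (simp add: d_def solves_CP_def)
    fix \<phi>
    assume \<phi>: "\<phi> \<in> time_test T"
    have 1: "integral {0..T} (\<lambda>t. time_deriv \<phi> t * d t)
        = integral {0..T} (\<lambda>t. time_deriv \<phi> t * fourier_coeff (u t) \<xi>) - integral {0..T} (\<lambda>t. time_deriv \<phi> t * fourier_coeff (v t) \<xi>)"
      unfolding d_def right_diff_distrib
      by (intro integral_diff integrable_continuous_interval continuous_intros time_test_props[OF \<phi>] cont u v)
    have 2: "integral {0..T} (\<lambda>t. \<phi> t * (symb t \<xi> * d t))
        = integral {0..T} (\<lambda>t. \<phi> t * (symb t \<xi> * fourier_coeff (u t) \<xi>)) - integral {0..T} (\<lambda>t. \<phi> t * (symb t \<xi> * fourier_coeff (v t) \<xi>))"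
      unfolding d_def right_diff_distrib
      by (intro integral_diff integrable_continuous_interval continuous_intros time_test_props[OF \<phi>] sym_continuous cont u v)
    have "\<i> * integral {0..T} (\<lambda>t. time_deriv \<phi> t * d t) + integral {0..T} (\<lambda>t. \<phi> t * (symb t \<xi> * d t)) = 0"
      using eq[OF u \<phi>] eq[OF v \<phi>] unfolding 1 2 by (simp add: algebra_simps)
    \<comment> \<open>Since \<open>\<i> * \<i> = - 1\<close>, multiplying by \<open>\<i>\<close>
      isolates the term with the time derivative.\<close>
    then have "\<i> * (\<i> * integral {0..T} (\<lambda>t. time_deriv \<phi> t * d t) + integral {0..T} (\<lambda>t. \<phi> t * (symb t \<xi> * d t))) = 0"
      by (simp only: mult_zero_right)
    then show "integral {0..T} (\<lambda>t. time_deriv \<phi> t * d t) = \<i> * integral {0..T} (\<lambda>t. \<phi> t * (symb t \<xi> * d t))"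
      by (simp add: distrib_left mult.assoc[symmetric])
  qed
  then show "fourier_coeff (u t) \<xi> = fourier_coeff (v t) \<xi>" by (simp add: d_def)
qed

text \<open>Solution, derivative and source may have different Sobolev orders, because every limit
  is used only after pairing with a test function. The weak equation is then scalar integration by
  parts in time.\<close>

lemma solves_CP_classical:
  assumes u: "u \<in> C0_maps T (sobolev_topology r)" and u': "u' \<in> C0_maps T (sobolev_topology r')"
    and f: "f \<in> C0_maps T (sobolev_topology r'')"
    and der: "\<And>t. t \<in> {0..T} \<Longrightarrow>
      limitin (sobolev_topology r') (\<lambda>\<tau>. (u \<tau> - u t) /\<^sub>R (\<tau> - t)) (u' t) (at t within {0..T})"
    and eq: "\<And>t. t \<in> {0..T} \<Longrightarrow> spatial_op (a2 t) (\<lambda>j. a1 j t) (a0 t) (u t) = f t + \<i> *\<^sub>C u' t"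
    and 0: "u 0 = g"
  shows "solves_CP T a2 a1 a0 f g u"
  unfolding solves_CP_def
proof (intro conjI ballI allI)
  show "\<exists>\<rho>. u \<in> C0_maps T (sobolev_topology \<rho>)" using u by blast
  show "u 0 = g" by (rule 0)
  fix \<phi> and \<psi> :: "'n torus_test"
  assume \<phi>: "\<phi> \<in> time_test T"
  have cont: "continuous_on {0..T} (\<lambda>t. pairing (w t) \<psi>)" if "w \<in> C0_maps T (sobolev_topology s)" for w s
    using that unfolding C0_maps_iff continuous_on_def by (blast intro: limitin_sobolev_pairing)
  have der': "((\<lambda>t. pairing (u t) \<psi>) has_vector_derivative pairing (u' t) \<psi>) (at t within {0..T})"
    if t: "t \<in> {0..T}" for t
    using limitin_sobolev_pairing[OF der[OF t], of \<psi>]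
    unfolding has_vector_derivative_iff_quotient pairing_scaleR minus_torus_distr.rep_eq
    by (simp add: divide_inverse mult.commute)
  have "weak_D_t T u \<phi> \<psi> = \<i> * integral {0..T} (\<lambda>t. time_deriv \<phi> t * pairing (u t) \<psi>)"
    unfolding weak_D_t_def distr_integral_def integral_mult_right[symmetric]
    by (simp add: scaleC.rep_eq mult.assoc)
  also have "\<dots> = - \<i> * integral {0..T} (\<lambda>t. \<phi> t * pairing (u' t) \<psi>)"
    using time_test_by_parts[OF \<phi> T der' cont[OF u']] by simp
  finally have 1: "weak_D_t T u \<phi> \<psi> = - \<i> * integral {0..T} (\<lambda>t. \<phi> t * pairing (u' t) \<psi>)" .
  have "distr_integral T (\<lambda>t. \<phi> t *\<^sub>C spatial_op (a2 t) (\<lambda>j. a1 j t) (a0 t) (u t)) \<psi>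
      = integral {0..T} (\<lambda>t. \<phi> t * pairing (f t) \<psi> + \<i> * (\<phi> t * pairing (u' t) \<psi>))"
    unfolding distr_integral_def
    by (rule integral_cong) (simp add: eq scaleC.rep_eq plus_torus_distr.rep_eq distrib_left mult.left_commute)
  also have "\<dots> = integral {0..T} (\<lambda>t. \<phi> t * pairing (f t) \<psi>) + integral {0..T} (\<lambda>t. \<i> * (\<phi> t * pairing (u' t) \<psi>))"
    by (intro integral_add integrable_continuous_interval continuous_intros time_test_props[OF \<phi>] cont[OF u'] cont[OF f])
  also have "integral {0..T} (\<lambda>t. \<i> * (\<phi> t * pairing (u' t) \<psi>)) = \<i> * integral {0..T} (\<lambda>t. \<phi> t * pairing (u' t) \<psi>)"
    by (rule integral_mult_right)
  finally show "weak_D_t T u \<phi> \<psi> + distr_integral T (\<lambda>t. \<phi> t *\<^sub>C spatial_op (a2 t) (\<lambda>j. a1 j t) (a0 t) (u t)) \<psi>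
      = distr_integral T (\<lambda>t. \<phi> t *\<^sub>C f t) \<psi>"
    unfolding 1 by (simp add: distr_integral_def scaleC.rep_eq)
qed

section \<open>Continuity and differentiability in time of the constructed solution\<close>

context
  fixes f :: "real \<Rightarrow> 'n torus_distr" and g :: "'n torus_distr" and r :: real
  assumes f: "f \<in> C0_maps T (sobolev_topology r)" and g: "g \<in> sobolev r"
begin

abbreviation (input) "fc \<equiv> \<lambda>\<xi> t. fourier_coeff (f t) \<xi>"
abbreviation (input) "gc \<equiv> fourier_coeff g"

lemma fc_continuous: "continuous_on {0..T} (\<lambda>t. fourier_coeff (f t) \<xi>)"
  using f unfolding C0_maps_iff continuous_on_def by (blast intro: limitin_sobolev_coeff)

lemma fc_tails: "l2_tails r {0..T} (\<lambda>t \<xi>. fourier_coeff (f t) \<xi>)"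
  using sobolev_continuous_tails[OF compact_Icc, of 0 T r f] f unfolding C0_maps_iff by blast

lemma sol_tails: "l2_tails r {0..T} (sol_coeff fc gc)"
  by (rule sol_l2_tails[OF fc_continuous fc_tails sobolev_imp_l2_tails[OF g]])

lemma sol'_tails: "l2_tails (r - 2) {0..T} (sol_coeff' fc gc)"
  by (rule sol'_l2_tails[OF fc_tails sol_tails])

lemma coeff_solution: "t \<in> {0..T} \<Longrightarrow> fourier_coeff (solution f g t) \<xi> = sol_coeff fc gc t \<xi>"
  unfolding solution_def
  by (simp only: restrict_apply' fourier_coeff_fourier_distr[OF l2_tails_imp_sobolev(1)[OF sol_tails]])

lemma coeff_solution': "t \<in> {0..T} \<Longrightarrow> fourier_coeff (solution' f g t) \<xi> = sol_coeff' fc gc t \<xi>"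
  unfolding solution'_def
  by (simp only: restrict_apply' fourier_coeff_fourier_distr[OF l2_tails_imp_sobolev(1)[OF sol'_tails]])

lemma coeff_quotient:
  assumes "t \<in> {0..T}" "\<tau> \<in> {0..T} - {t}"
  shows "fourier_coeff ((solution f g \<tau> - solution f g t) /\<^sub>R (\<tau> - t)) \<xi> = sol_quotient fc gc (t, \<tau>) \<xi>"
  using assms by (simp add: coeff_solution sol_quotient_def divide_inverse mult.commute)

lemma solution_extensional: "solution f g \<in> extensional {0..T}" "solution' f g \<in> extensional {0..T}"
  by (simp_all add: solution_def solution'_def)

lemma sol_coeff_tendsto:
  assumes "t \<in> {0..T}"
  shows "((\<lambda>\<tau>. sol_coeff fc gc \<tau> \<xi>) \<longlongrightarrow> fourier_coeff (solution f g t) \<xi>) (at t within {0..T})"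
    and "((\<lambda>\<tau>. sol_coeff' fc gc \<tau> \<xi>) \<longlongrightarrow> fourier_coeff (solution' f g t) \<xi>) (at t within {0..T})"
    and "((\<lambda>\<tau>. sol_quotient fc gc (t, \<tau>) \<xi>) \<longlongrightarrow> fourier_coeff (solution' f g t) \<xi>) (at t within {0..T})"
  using sol_coeff_continuous[of fc \<xi> gc, OF fc_continuous] sol_coeff'_continuous[of fc \<xi> gc, OF fc_continuous]
    sol_quotient_tendsto[of fc \<xi> t gc, OF fc_continuous assms] assms
  by (simp_all add: continuous_on_def coeff_solution coeff_solution')

lemma solution_C0: "solution f g \<in> C0_maps T (sobolev_topology r)"
  unfolding C0_maps_iff
proof (intro conjI ballI solution_extensional)
  fix t
  assume t: "t \<in> {0..T}"
  show "limitin (sobolev_topology r) (solution f g) (solution f g t) (at t within {0..T})"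
  proof (rule limitin_sobolev_tails[OF sol_tails _ coeff_solution _ sol_coeff_tendsto(1)[OF t]])
    show "\<forall>\<^sub>F i in at t within {0..T}. i \<in> {0..T}" using eventually_at_in by (rule eventually_mono) blast
    show "solution f g t \<in> sobolev r"
      using l2_tails_imp_sobolev(2)[OF sol_tails t] t by (simp only: solution_def restrict_apply')
  qed
qed

lemma solution'_C0: "solution' f g \<in> C0_maps T (sobolev_topology (r - 2))"
  unfolding C0_maps_iff
proof (intro conjI ballI solution_extensional)
  fix t
  assume t: "t \<in> {0..T}"
  show "limitin (sobolev_topology (r - 2)) (solution' f g) (solution' f g t) (at t within {0..T})"
  proof (rule limitin_sobolev_tails[OF sol'_tails _ coeff_solution' _ sol_coeff_tendsto(2)[OF t]])
    show "\<forall>\<^sub>F i in at t within {0..T}. i \<in> {0..T}" using eventually_at_in by (rule eventually_mono) blast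
    show "solution' f g t \<in> sobolev (r - 2)"
      using l2_tails_imp_sobolev(2)[OF sol'_tails t] t by (simp only: solution'_def restrict_apply')
  qed
qed

lemma solution_quotient_limit:
  assumes t: "t \<in> {0..T}"
  shows "limitin (sobolev_topology (r - 2)) (\<lambda>\<tau>. (solution f g \<tau> - solution f g t) /\<^sub>R (\<tau> - t))
    (solution' f g t) (at t within {0..T})"
proof (rule limitin_sobolev_tails[OF _ eventually_at_in coeff_quotient[OF t] _ sol_coeff_tendsto(3)[OF t]])
  show "l2_tails (r - 2) ({0..T} - {t}) (\<lambda>\<tau>. sol_quotient fc gc (t, \<tau>))"
    by (rule l2_tails_comp[OF sol_quotient_l2_tails[OF fc_continuous sol'_tails]])
      (use t in \<open>auto simp: quotient_times_def\<close>)
  show "solution' f g t \<in> sobolev (r - 2)"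
    using solution'_C0 t unfolding C0_maps_iff limitin_sobolev by blast
qed

lemma solution_C1: "solution f g \<in> C1_maps T (sobolev_topology (r - 2))"
proof -
  \<comment> \<open>\<open>C1_maps\<close> also asks for continuity in its own topology, here the
    weaker one of order \<open>r - 2\<close>.\<close>
  have "limitin (sobolev_topology (r - 2)) (solution f g) (solution f g t) (at t within {0..T})" if t: "t \<in> {0..T}" for t
  proof (rule limitin_sobolev_tails[OF l2_tails_mono[OF sol_tails] _ coeff_solution _ sol_coeff_tendsto(1)[OF t]])
    show "\<forall>\<^sub>F i in at t within {0..T}. i \<in> {0..T}" using eventually_at_in by (rule eventually_mono) blast
    have "l2_tails (r - 2) {0..T} (sol_coeff fc gc)" by (rule l2_tails_mono[OF sol_tails]) simp
    from l2_tails_imp_sobolev(2)[OF this t]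
    show "solution f g t \<in> sobolev (r - 2)" using t by (simp only: solution_def restrict_apply')
  qed auto
  then have "solution f g \<in> C0_maps T (sobolev_topology (r - 2))"
    unfolding C0_maps_iff using solution_extensional(1) by blast
  then show ?thesis unfolding C1_maps_def using solution'_C0 solution_quotient_limit by blast
qed

lemma solution_solves: "solves_CP T a2 a1 a0 f g (solution f g)"
proof (rule solves_CP_classical[OF solution_C0 solution'_C0 f solution_quotient_limit])
  show "spatial_op (a2 t) (\<lambda>j. a1 j t) (a0 t) (solution f g t) = f t + \<i> *\<^sub>C solution' f g t" if t: "t \<in> {0..T}" for t
  proof (rule distr_eqI)
    fix \<xi>
    show "fourier_coeff (spatial_op (a2 t) (\<lambda>j. a1 j t) (a0 t) (solution f g t)) \<xi> = fourier_coeff (f t + \<i> *\<^sub>C solution' f g t) \<xi>"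
      by (simp add: fourier_coeff_spatial_op coeff_solution[OF t] coeff_solution'[OF t] sol_coeff'_def mult.assoc[symmetric])
  qed
  have "0 \<in> {0..T}" using T by simp
  then show "solution f g 0 = g"
    by (intro distr_eqI) (simp add: coeff_solution sol_coeff_def)
qed

text \<open>The Sobolev hypotheses of the context supply the formulas for the coefficients;
  convergence in the Gevrey topology comes from the exponential bounds on the data, passed to the
  solution, its derivative and its quotients.\<close>

lemma solution_gevrey:
  assumes s: "s > 0" and fg: "f \<in> C0_maps T (gevrey_topology s)" and gg: "g \<in> gevrey s"
  shows "solution f g \<in> C1_maps T (gevrey_topology s)"
proof -
  have ft: "gevrey_tails s {0..T} (\<lambda>t \<xi>. fourier_coeff (f t) \<xi>)"
    using gevrey_continuous_tails[OF s compact_Icc, of 0 T f] fg unfolding C0_maps_iff by blast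
  have gt: "gevrey_tails s {()} (\<lambda>_. fourier_coeff g)"
    unfolding gevrey_tails_def using gevrey_D[OF gg s] by metis
  have yt: "gevrey_tails s {0..T} (sol_coeff fc gc)" by (rule sol_gevrey_tails[OF fc_continuous ft gt])
  have yt': "gevrey_tails s {0..T} (sol_coeff' fc gc)" by (rule sol'_gevrey_tails[OF s ft yt])
  have qt: "gevrey_tails s quotient_times (sol_quotient fc gc)"
    by (rule sol_quotient_gevrey_tails[OF fc_continuous yt'])
  have mem: "v \<in> gevrey s"
    if c: "gevrey_tails s {0..T} c" and t: "t \<in> {0..T}" and v: "\<And>\<xi>. fourier_coeff v \<xi> = c t \<xi>"
    for v :: "'n torus_distr" and c t
  proof -
    obtain C d where C: "d > 0" "\<forall>t\<in>{0..T}. \<forall>\<xi>. cmod (c t \<xi>) \<le> C * gevrey_weight s d \<xi>"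
      using c unfolding gevrey_tails_def by blast
    show ?thesis by (rule gevreyI[OF s C(1), of _ C]) (use C(2) t v in simp)
  qed
  have ev: "\<forall>\<^sub>F i in at t within {0..T}. i \<in> {0..T}" for t using eventually_at_in by (rule eventually_mono) blast
  have u: "solution f g t \<in> gevrey s" and u': "solution' f g t \<in> gevrey s" if "t \<in> {0..T}" for t
    by (rule mem[OF yt that coeff_solution[OF that]], rule mem[OF yt' that coeff_solution'[OF that]])
  have "solution f g \<in> C0_maps T (gevrey_topology s)"
    unfolding C0_maps_iff
    by (intro conjI ballI solution_extensional limitin_gevrey_tails[OF s yt ev coeff_solution u sol_coeff_tendsto(1)])
  moreover have "solution' f g \<in> C0_maps T (gevrey_topology s)"
    unfolding C0_maps_iff
    by (intro conjI ballI solution_extensional limitin_gevrey_tails[OF s yt' ev coeff_solution' u' sol_coeff_tendsto(2)])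
  moreover have "limitin (gevrey_topology s) (\<lambda>\<tau>. (solution f g \<tau> - solution f g t) /\<^sub>R (\<tau> - t))
    (solution' f g t) (at t within {0..T})" if t: "t \<in> {0..T}" for t
  proof (rule limitin_gevrey_tails[OF s _ eventually_at_in coeff_quotient[OF t] u'[OF t] sol_coeff_tendsto(3)[OF t]])
    show "gevrey_tails s ({0..T} - {t}) (\<lambda>\<tau>. sol_quotient fc gc (t, \<tau>))"
      by (rule gevrey_tails_comp[OF qt]) (use t in \<open>auto simp: quotient_times_def\<close>)
  qed
  ultimately show ?thesis unfolding C1_maps_def by blast
qed

end

text \<open>\<open>solution f g\<close> does not depend on \<open>r\<close>, so the results for the
  various orders concern the same function and combine in the projective limit.\<close>

lemma solution_Cinf:
  assumes f: "\<And>r. f \<in> C0_maps T (sobolev_topology r)" and g: "\<And>r. g \<in> sobolev r"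
  shows "solution f g \<in> C1_maps T Cinf_topology"
proof -
  have ev: "\<forall>\<^sub>F i in at t within {0..T}. i \<in> {0..T}" for t using eventually_at_in by (rule eventually_mono) blast
  have C0: "w \<in> C0_maps T Cinf_topology" if w: "\<And>r. w \<in> C0_maps T (sobolev_topology r)" for w
    unfolding C0_maps_iff
  proof (intro conjI ballI)
    show "w \<in> extensional {0..T}" using w[of 0] by (simp add: C0_maps_iff)
    have mem: "w t \<in> Cinf" if "t \<in> {0..T}" for t
      using w that unfolding C0_maps_iff limitin_sobolev Cinf_def by blast
    fix t
    assume t: "t \<in> {0..T}"
    show "limitin Cinf_topology w (w t) (at t within {0..T})"
    proof (rule Cinf_limitinI)
      show "limitin (sobolev_topology r) w (w t) (at t within {0..T})" for r
        using w t unfolding C0_maps_iff by blast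
      show "\<forall>\<^sub>F i in at t within {0..T}. w i \<in> Cinf" using ev by (rule eventually_mono) (rule mem)
    qed
  qed
  have u: "solution f g \<in> C0_maps T Cinf_topology" by (intro C0 solution_C0 f g)
  have u': "solution' f g \<in> C0_maps T Cinf_topology"
  proof (rule C0)
    fix r
    \<comment> \<open>Data of order \<open>r + 2\<close> make up for the loss of two orders.\<close>
    show "solution' f g \<in> C0_maps T (sobolev_topology r)" using solution'_C0[OF f[of "r + 2"] g] by simp
  qed
  have "limitin Cinf_topology (\<lambda>\<tau>. (solution f g \<tau> - solution f g t) /\<^sub>R (\<tau> - t)) (solution' f g t) (at t within {0..T})"
    if t: "t \<in> {0..T}" for t
  proof (rule Cinf_limitinI)
    show "limitin (sobolev_topology r) (\<lambda>\<tau>. (solution f g \<tau> - solution f g t) /\<^sub>R (\<tau> - t)) (solution' f g t) (at t within {0..T})" for r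
      using solution_quotient_limit[OF f[of "r + 2"] g t] by simp
    have mem: "solution f g \<tau> \<in> sobolev r" if "\<tau> \<in> {0..T}" for \<tau> r
      using solution_C0[OF f[of r] g] that unfolding C0_maps_iff limitin_sobolev by blast
    show "\<forall>\<^sub>F \<tau> in at t within {0..T}. (solution f g \<tau> - solution f g t) /\<^sub>R (\<tau> - t) \<in> Cinf"
      using ev
    proof (rule eventually_mono)
      fix \<tau>
      assume \<tau>: "\<tau> \<in> {0..T}"
      show "(solution f g \<tau> - solution f g t) /\<^sub>R (\<tau> - t) \<in> Cinf"
        unfolding Cinf_def by (intro INT_I sobolev_scaleR sobolev_diff mem \<tau> t)
    qed
  qed
  then show ?thesis unfolding C1_maps_def using u u' by blast
qed

text \<open>The two topologies may differ, so that a solution from any of the classes can be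
  compared with the constructed one.\<close>

lemma unique_extensional:
  assumes "solves_CP T a2 a1 a0 f g u" "u \<in> C0_maps T X" "solves_CP T a2 a1 a0 f g v" "v \<in> C0_maps T Y"
  shows "u = v"
proof (rule extensionalityI)
  show "u \<in> extensional {0..T}" "v \<in> extensional {0..T}" using assms by (simp_all add: C0_maps_def)
  show "u t = v t" if "t \<in> {0..T}" for t by (rule solves_CP_unique[OF assms(1,3) that])
qed

theorem sobolev_well_posed:
  assumes f: "f \<in> C0_maps T (sobolev_topology r)" and g: "g \<in> sobolev r"
  shows "\<exists>!u. u \<in> C0_maps T (sobolev_topology r) \<inter> C1_maps T (sobolev_topology (r - 2)) \<and>
    solves_CP T a2 a1 a0 f g u"
proof (rule ex1I[of _ "solution f g"])
  show "solution f g \<in> C0_maps T (sobolev_topology r) \<inter> C1_maps T (sobolev_topology (r - 2)) \<and>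
    solves_CP T a2 a1 a0 f g (solution f g)"
    using solution_C0[OF f g] solution_C1[OF f g] solution_solves[OF f g] by blast
  fix u
  assume "u \<in> C0_maps T (sobolev_topology r) \<inter> C1_maps T (sobolev_topology (r - 2)) \<and> solves_CP T a2 a1 a0 f g u"
  then show "u = solution f g"
    by (intro unique_extensional[OF _ _ solution_solves[OF f g] solution_C0[OF f g]]) auto
qed

theorem Cinf_well_posed:
  assumes f: "f \<in> C0_maps T Cinf_topology" and g: "g \<in> Cinf"
  shows "\<exists>!u. u \<in> C1_maps T Cinf_topology \<and> solves_CP T a2 a1 a0 f g u"
proof -
  have f': "f \<in> C0_maps T (sobolev_topology r)" for r
    using f unfolding C0_maps_iff by (blast intro: Cinf_limitinD)
  have g': "g \<in> sobolev r" for r using g by (simp add: Cinf_def)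
  show ?thesis
  proof (rule ex1I[of _ "solution f g"])
    show "solution f g \<in> C1_maps T Cinf_topology \<and> solves_CP T a2 a1 a0 f g (solution f g)"
      using solution_Cinf[OF f' g'] solution_solves[OF f'[of 0] g'[of 0]] by blast
    fix u
    assume "u \<in> C1_maps T Cinf_topology \<and> solves_CP T a2 a1 a0 f g u"
    then show "u = solution f g"
      by (intro unique_extensional[OF _ _ solution_solves[OF f'[of 0] g'[of 0]] solution_C0[OF f'[of 0] g'[of 0]]])
        (auto simp: C1_maps_def)
  qed
qed

text \<open>Continuity into the Gevrey topology gives uniform exponential bounds on the compact
  interval, hence continuity into \<open>H^0\<close>. The Sobolev construction then yields the
  solution, and \<open>solution_gevrey\<close> its regularity.\<close>

theorem gevrey_well_posed:
  assumes s: "s > 0" and f: "f \<in> C0_maps T (gevrey_topology s)" and g: "g \<in> gevrey s"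
  shows "\<exists>!u. u \<in> C1_maps T (gevrey_topology s) \<and> solves_CP T a2 a1 a0 f g u"
proof -
  have ft: "gevrey_tails s {0..T} (\<lambda>t. fourier_coeff (f t))"
    using gevrey_continuous_tails[OF s compact_Icc, of 0 T f] f unfolding C0_maps_iff by blast
  have tails: "l2_tails 0 {0..T} (\<lambda>t. fourier_coeff (f t))" by (rule gevrey_tails_imp_l2_tails[OF s ft])
  have g': "g \<in> sobolev 0" using g by (simp add: gevrey_def Cinf_def)
  have f': "f \<in> C0_maps T (sobolev_topology 0)"
    unfolding C0_maps_iff
  proof (intro conjI ballI)
    show "f \<in> extensional {0..T}" using f by (simp add: C0_maps_def)
    fix t
    assume t: "t \<in> {0..T}"
    then have lim: "limitin (gevrey_topology s) f (f t) (at t within {0..T})" using f unfolding C0_maps_iff by blast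
    show "limitin (sobolev_topology 0) f (f t) (at t within {0..T})"
    proof (rule limitin_sobolev_tails[OF tails _ _ _ limitin_gevrey_coeff[OF s lim]])
      show "\<forall>\<^sub>F i in at t within {0..T}. i \<in> {0..T}" using eventually_at_in by (rule eventually_mono) blast
      have "f t \<in> gevrey s" using lim topspace_gevrey[OF s] by (auto simp: limitin_def)
      then show "f t \<in> sobolev 0" by (simp add: gevrey_def Cinf_def)
    qed simp
  qed
  show ?thesis
  proof (rule ex1I[of _ "solution f g"])
    show "solution f g \<in> C1_maps T (gevrey_topology s) \<and> solves_CP T a2 a1 a0 f g (solution f g)"
      using solution_gevrey[OF f' g' s f g] solution_solves[OF f' g'] by blast
    fix u
    assume "u \<in> C1_maps T (gevrey_topology s) \<and> solves_CP T a2 a1 a0 f g u"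
    then show "u = solution f g"
      by (intro unique_extensional[OF _ _ solution_solves[OF f' g'] solution_C0[OF f' g']])
        (auto simp: C1_maps_def)
  qed
qed

end

theorem corollary6p5:
  fixes T :: real
    and a2 a0 :: "real \<Rightarrow> complex"
    and a1 :: "'n::finite \<Rightarrow> real \<Rightarrow> complex"
  assumes "T > 0"
    and "continuous_on {0..T} a2"
    and "\<And>j. continuous_on {0..T} (a1 j)"
    and "continuous_on {0..T} a0"
    and "\<And>t. t \<in> {0..T} \<Longrightarrow> Im (a2 t) \<le> 0"
    and "\<And>j t. t \<in> {0..T} \<Longrightarrow> Im (a1 j t) = 0"
  shows
    "(\<forall>(r::real) (f :: real \<Rightarrow> 'n torus_distr) g.
        f \<in> C0_maps T (sobolev_topology r) \<and> g \<in> sobolev r \<longrightarrow>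
        (\<exists>!u. u \<in> C0_maps T (sobolev_topology r) \<inter> C1_maps T (sobolev_topology (r - 2)) \<and>
              solves_CP T a2 a1 a0 f g u))
     \<and> (\<forall>(f :: real \<Rightarrow> 'n torus_distr) g.
        f \<in> C0_maps T Cinf_topology \<and> g \<in> Cinf \<longrightarrow>
        (\<exists>!u. u \<in> C1_maps T Cinf_topology \<and> solves_CP T a2 a1 a0 f g u))
     \<and> (\<forall>(s::real) (f :: real \<Rightarrow> 'n torus_distr) g.
        s \<ge> 1 \<and> f \<in> C0_maps T (gevrey_topology s) \<and> g \<in> gevrey s \<longrightarrow>
        (\<exists>!u. u \<in> C1_maps T (gevrey_topology s) \<and> solves_CP T a2 a1 a0 f g u))"
proof -
  interpret torus_cauchy T a2 a0 a1
    by unfold_locales (use assms in blast)+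
  show ?thesis
  proof (intro conjI allI impI)
    fix r and f :: "real \<Rightarrow> 'n torus_distr" and g :: "'n torus_distr"
    assume "f \<in> C0_maps T (sobolev_topology r) \<and> g \<in> sobolev r"
    then show "\<exists>!u. u \<in> C0_maps T (sobolev_topology r) \<inter> C1_maps T (sobolev_topology (r - 2)) \<and> solves_CP T a2 a1 a0 f g u"
      by (elim conjE) (rule sobolev_well_posed)
  next
    fix f :: "real \<Rightarrow> 'n torus_distr" and g :: "'n torus_distr"
    assume "f \<in> C0_maps T Cinf_topology \<and> g \<in> Cinf"
    then show "\<exists>!u. u \<in> C1_maps T Cinf_topology \<and> solves_CP T a2 a1 a0 f g u"
      by (elim conjE) (rule Cinf_well_posed)
  next
    fix s :: real and f :: "real \<Rightarrow> 'n torus_distr" and g :: "'n torus_distr"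
    assume *: "1 \<le> s \<and> f \<in> C0_maps T (gevrey_topology s) \<and> g \<in> gevrey s"
    then have "s > 0" by linarith
    then show "\<exists>!u. u \<in> C1_maps T (gevrey_topology s) \<and> solves_CP T a2 a1 a0 f g u"
      using * by (intro gevrey_well_posed) blast+
  qed
qed

end
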